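(* Let $\alpha(t)=(y_1(t),y_2(t))$ be a solution of $$\ddot y_1=\frac{\partial\omega}{\partial y_1}+2\dot y_2,\qquad \ddot y_2=\frac{\partial\omega}{\partial y_2}-2\dot y_1$$ with Jacobian integral equal to $C$. Assume that $\alpha$ is $T$-periodic and $n$-simple around $(1-\mu,0)$ with lifting $\beta(t)$. Let $f=\sqrt{2\omega-C}$, let $\tilde\Omega$ be the region enclosed by $\beta$, and let $h=\ln\tilde f$ with $\tilde f=f\circ\phi_n$, where $$\phi_n(z_1,z_2)=(\mathrm{Re}\,\xi_n(z_1,z_2),\mathrm{Im}\,\xi_n(z_1,z_2)),\qquad \xi_n(z_1,z_2)=1-\mu+(z_1+\mu-1+i z_2)^n .$$ Then: - if $\beta$ goes clockwise around $\tilde\Omega$ and $\phi_n(\tilde\Omega)$ is contained in $U_C\cup\{(1-\mu,0)\}$, then $\displaystyle 2T=n\pi+\iint_{\tilde\Omega}\Delta h\,dz_1dz_2$; - if $\beta$ goes counterclockwise around $\tilde\Omega$ and $\phi_n(\tilde\Omega)$ is contained in $U_C\cup\{(1-\mu,0)\}$, then $\displaystyle 2T=-n\pi-\iint_{\tilde\Omega}\Delta h\,dz_1dz_2$.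
   Context: Fix a real number $\mu$ with $0<\mu\le \frac12$ (mass parameter of the planar circular restricted three body problem, in rotating coordinates). On $\mathbb{R}^2\setminus\{(-\mu,0),(1-\mu,0)\}$ define $$\omega(y_1,y_2)=\frac12(y_1^2+y_2^2)+\frac{1-\mu}{\sqrt{(y_1+\mu)^2+y_2^2}}+\frac{\mu}{\sqrt{(y_1+\mu-1)^2+y_2^2}}.$$ For every solution of the differential equation the quantity $-\dot y_1^2-\dot y_2^2+2\omega(y_1,y_2)$ is a constant $C$, called its Jacobian integral. For a constant $C$, $U_C=\{(y_1,y_2): 2\omega(y_1,y_2)-C\ge 0\}$, where the two points $(-\mu,0)$ and $(1-\mu,0)$ (at which $\omega$ is undefined) are not considered part of $U_C$. Definition ($n$ a positive integer). A closed curve $\alpha:[0,T]\to\mathbb{R}^2$, $\alpha(t)=(z_1(t),z_2(t))$, is $n$-simple around the point $p=(u,v)$ if there is a simple regular closed curve $\beta:[0,T]\to\mathbb{R}^2$, $\beta(t)=(w_1(t),w_2(t))$, going around $p$ (that is, the region enclosed by $\beta$ contains $p$), such that, identifying $(x,y)$ with $x+iy$, $$(u+iv)+\big((w_1(t)-u)+i(w_2(t)-v)\big)^n=z_1(t)+i z_2(t)\quad\text{for all } t.$$ The curve $\beta$ is called the lifting of $\alpha$. Regular means the derivative never vanishes. The region enclosed by a simple closed curve is the bounded component of its complement. $\Delta=\partial_{z_1}^2+\partial_{z_2}^2$; $h$ is not defined at $(1-\mu,0)$, and the integral over $\tilde\Omega$ is over $\tilde\Omega$ minus this point. *)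

theory Defs
  imports "HOL-Complex_Analysis.Complex_Analysis"
begin

text \<open>
  The plane is the type \<^typ>\<open>complex\<close>, a point \<open>(x, y)\<close> being identified with \<open>x + i y\<close>;
  Lebesgue measure on \<^typ>\<open>complex\<close> is then the area measure \<open>dx dy\<close>.
\<close>

definition omega :: "real \<Rightarrow> real \<Rightarrow> real \<Rightarrow> real" where
  "omega \<mu> y1 y2 = 1/2 * (y1\<^sup>2 + y2\<^sup>2)
     + (1 - \<mu>) / sqrt ((y1 + \<mu>)\<^sup>2 + y2\<^sup>2)
     + \<mu> / sqrt ((y1 + \<mu> - 1)\<^sup>2 + y2\<^sup>2)"

definition primary1 :: "real \<Rightarrow> complex" where
  "primary1 \<mu> = Complex (- \<mu>) 0"

definition primary2 :: "real \<Rightarrow> complex" where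
  "primary2 \<mu> = Complex (1 - \<mu>) 0"

text \<open>
  \<^const>\<open>omega\<close> is total (division by zero gives zero), so the two primaries, where the
  mathematical \<open>\<omega>\<close> is undefined, are excluded explicitly below.
\<close>

definition U_region :: "real \<Rightarrow> real \<Rightarrow> complex set" where
  "U_region \<mu> C = {z. z \<noteq> primary1 \<mu> \<and> z \<noteq> primary2 \<mu> \<and> 2 * omega \<mu> (Re z) (Im z) - C \<ge> 0}"

definition r3bp_solution :: "real \<Rightarrow> (real \<Rightarrow> complex) \<Rightarrow> bool" where
  "r3bp_solution \<mu> \<alpha> \<longleftrightarrow>
     (let y1 = (\<lambda>t. Re (\<alpha> t)); y2 = (\<lambda>t. Im (\<alpha> t)) in
      \<forall>t. \<alpha> t \<noteq> primary1 \<mu> \<and> \<alpha> t \<noteq> primary2 \<mu> \<and>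
          y1 field_differentiable (at t) \<and> y2 field_differentiable (at t) \<and>
          (deriv y1 has_real_derivative
             (deriv (\<lambda>x. omega \<mu> x (y2 t)) (y1 t) + 2 * deriv y2 t)) (at t) \<and>
          (deriv y2 has_real_derivative
             (deriv (\<lambda>y. omega \<mu> (y1 t) y) (y2 t) - 2 * deriv y1 t)) (at t))"

definition has_jacobi_integral :: "real \<Rightarrow> (real \<Rightarrow> complex) \<Rightarrow> real \<Rightarrow> bool" where
  "has_jacobi_integral \<mu> \<alpha> C \<longleftrightarrow>
     (\<forall>t. - (deriv (\<lambda>s. Re (\<alpha> s)) t)\<^sup>2 - (deriv (\<lambda>s. Im (\<alpha> s)) t)\<^sup>2
          + 2 * omega \<mu> (Re (\<alpha> t)) (Im (\<alpha> t)) = C)"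

text \<open>
  Paths in the library live on \<open>[0, 1]\<close>; this rescales a curve given on \<open>[0, T]\<close>.
\<close>

definition unit_path :: "real \<Rightarrow> (real \<Rightarrow> complex) \<Rightarrow> real \<Rightarrow> complex" where
  "unit_path T \<beta> = (\<lambda>s. \<beta> (T * s))"

definition simple_regular_closed_curve :: "real \<Rightarrow> (real \<Rightarrow> complex) \<Rightarrow> bool" where
  "simple_regular_closed_curve T \<beta> \<longleftrightarrow>
     simple_path (unit_path T \<beta>) \<and>
     pathfinish (unit_path T \<beta>) = pathstart (unit_path T \<beta>) \<and>
     (\<forall>t\<in>{0..T}. \<exists>d. d \<noteq> 0 \<and> (\<beta> has_vector_derivative d) (at t within {0..T}))"

definition enclosed_region :: "real \<Rightarrow> (real \<Rightarrow> complex) \<Rightarrow> complex set" where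
  "enclosed_region T \<beta> = inside (path_image (unit_path T \<beta>))"

text \<open>
  \<open>n_simple_with_lifting n p T \<alpha> \<beta>\<close>: the curve \<open>\<alpha>\<close> on \<open>[0, T]\<close> is \<open>n\<close>-simple around \<open>p\<close>,
  and \<open>\<beta>\<close> is its lifting. Thus \<open>\<alpha>\<close> is \<open>n\<close>-simple around \<open>p\<close> iff this holds for some \<open>\<beta>\<close>.
\<close>

definition n_simple_with_lifting ::
    "nat \<Rightarrow> complex \<Rightarrow> real \<Rightarrow> (real \<Rightarrow> complex) \<Rightarrow> (real \<Rightarrow> complex) \<Rightarrow> bool" where
  "n_simple_with_lifting n p T \<alpha> \<beta> \<longleftrightarrow>
     simple_regular_closed_curve T \<beta> \<and> p \<in> enclosed_region T \<beta> \<and>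
     (\<forall>t\<in>{0..T}. p + (\<beta> t - p) ^ n = \<alpha> t)"

definition counterclockwise :: "real \<Rightarrow> (real \<Rightarrow> complex) \<Rightarrow> bool" where
  "counterclockwise T \<beta> \<longleftrightarrow>
     (\<forall>z\<in>enclosed_region T \<beta>. winding_number (unit_path T \<beta>) z = 1)"

definition clockwise :: "real \<Rightarrow> (real \<Rightarrow> complex) \<Rightarrow> bool" where
  "clockwise T \<beta> \<longleftrightarrow>
     (\<forall>z\<in>enclosed_region T \<beta>. winding_number (unit_path T \<beta>) z = - 1)"

definition xi :: "real \<Rightarrow> nat \<Rightarrow> real \<Rightarrow> real \<Rightarrow> complex" where
  "xi \<mu> n z1 z2 = complex_of_real (1 - \<mu>)
     + (complex_of_real (z1 + \<mu> - 1) + \<i> * complex_of_real z2) ^ n"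

definition phi :: "real \<Rightarrow> nat \<Rightarrow> complex \<Rightarrow> complex" where
  "phi \<mu> n z = Complex (Re (xi \<mu> n (Re z) (Im z))) (Im (xi \<mu> n (Re z) (Im z)))"

definition f_speed :: "real \<Rightarrow> real \<Rightarrow> complex \<Rightarrow> real" where
  "f_speed \<mu> C z = sqrt (2 * omega \<mu> (Re z) (Im z) - C)"

definition f_tilde :: "real \<Rightarrow> real \<Rightarrow> nat \<Rightarrow> complex \<Rightarrow> real" where
  "f_tilde \<mu> C n = f_speed \<mu> C \<circ> phi \<mu> n"

definition h_fun :: "real \<Rightarrow> real \<Rightarrow> nat \<Rightarrow> complex \<Rightarrow> real" where
  "h_fun \<mu> C n z = ln (f_tilde \<mu> C n z)"

definition laplacian :: "(complex \<Rightarrow> real) \<Rightarrow> complex \<Rightarrow> real" where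
  "laplacian g z =
     deriv (deriv (\<lambda>x. g (Complex x (Im z)))) (Re z)
   + deriv (deriv (\<lambda>y. g (Complex (Re z) y))) (Im z)"

end

theory Submission
  imports Defs "HOL-Real_Asymp.Real_Asymp"
begin

text \<open>
  Write \<open>p\<close> for the second primary, \<open>L\<close> for the integral of \<open>\<Delta>h\<close>, and \<open>w = 1\<close> or \<open>w = -1\<close> for the
  winding number of \<open>\<beta>\<close> about the points of \<open>\<Omega>\<close>. On the orbit the speed equals \<open>f\<close>, and the
  equations of motion say that the velocity turns at the rate \<open>-2 - 2 Im (\<partial>h \<cdot> \<beta>')\<close>, where
  \<open>\<partial>h = (h\<^sub>x - i h\<^sub>y) / 2\<close>. Integrate this over a period. On the left, \<open>\<alpha>' = n (\<beta> - p)\<^sup>n\<^sup>-\<^sup>1 \<beta>'\<close> turns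
  \<open>(n - 1) w + w = n w\<close> times by Hopf's Umlaufsatz for \<open>\<beta>\<close>. On the right, \<open>h\<close> is
  \<open>- (n / 2) ln |z - p|\<close> plus a less singular function, so that Green's theorem gives
  \<open>w (L - n \<pi>) / 2\<close> for the imaginary part of the integral of \<open>\<partial>h\<close> along \<open>\<beta>\<close>. Hence
  \<open>2 \<pi> n w = - w (L - n \<pi>) - 2 T\<close>.

  Green's theorem is needed for a Jordan domain whose geometry is not known. It is obtained by
  integrating the Cauchy-Pompeiu formula along the curve: exchanging the two integrals turns the
  Cauchy kernel into a winding number.
\<close>

section \<open>Integration over the complex plane\<close>

text \<open>The obstacle is the collision point \<open>p\<close>. Once the pole
  \<open>- n / (4 (z - p))\<close> of \<open>dh\<close> is removed, the remainder \<open>g0\<close>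
  is bounded but need not have a limit at \<open>p\<close> (for \<open>n = 1\<close> it may jump
  like \<open>|z - p| / (z - p)\<close>), and its derivatives may grow like
  \<open>1 / |z - p|\<close>. All analysis is therefore done for functions that are C1 off one point
  with these bounds; \<open>1 / |z - p|\<close> is integrable in the plane, so no small disc around
  \<open>p\<close> has to be cut out. The coefficient \<open>n / 4\<close> comes from
  \<open>h = (1/2) ln (2 \<omega> - C)\<close>, where \<open>2 \<omega> - C\<close> at
  \<open>phi \<mu> n z\<close> is about \<open>2 \<mu> / |z - p|^n\<close>. The pole is holomorphic
  off \<open>p\<close>, so it does not affect the Laplacian and survives only through its winding
  number, as the term \<open>n \<pi>\<close>. The Umlaufsatz is proved without an extremal base
  point: orientation is read off from winding numbers at points pushed off the curve to either side.
  A lifting is only assumed to have a nonzero derivative; the continuity of this derivative is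
  recovered from \<open>\<alpha>\<close>.\<close>

text \<open>Every real-linear map of the plane has this form for exactly one pair, so this is real
  differentiability with \<open>a\<close> and \<open>b\<close> the derivatives in \<open>z\<close>
  and \<open>cnj z\<close>. For real-valued \<open>f\<close>, \<open>b = cnj a\<close>.\<close>

definition has_wirtinger :: "(complex \<Rightarrow> complex) \<Rightarrow> complex \<Rightarrow> complex \<Rightarrow> complex \<Rightarrow> bool" where
  "has_wirtinger f a b z \<longleftrightarrow> (f has_derivative (\<lambda>v. a * v + b * cnj v)) (at z)"

section \<open>Area measure as a product measure, and integration along lines\<close>

text \<open>Lebesgue measure is determined by its values on boxes, and a box is a product of two
  intervals. This gives access to Fubini on \<open>complex\<close>.\<close>

lemma lborel_complex_distr:
  "lborel = distr (lborel \<Otimes>\<^sub>M lborel) borel (\<lambda>(x, y). Complex x y)"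
proof (rule lborel_eqI)
  fix l u :: complex
  assume le: "\<And>b. b \<in> Basis \<Longrightarrow> l \<bullet> b \<le> u \<bullet> b"
  have le': "Re l \<le> Re u" "Im l \<le> Im u"
    using le[of 1] le[of \<i>] by (auto simp: Basis_complex_def)
  have meas: "(\<lambda>(x, y). Complex x y) \<in> borel_measurable (lborel \<Otimes>\<^sub>M lborel)"
    by (simp add: Complex_eq case_prod_beta)
  have box: "box l u \<in> sets borel" by simp
  have "(\<lambda>(x, y). Complex x y) -` box l u \<inter> space (lborel \<Otimes>\<^sub>M lborel) = {Re l<..<Re u} \<times> {Im l<..<Im u}"
    by (auto simp: in_box_complex_iff space_pair_measure)
  then have "emeasure (distr (lborel \<Otimes>\<^sub>M lborel) borel (\<lambda>(x, y). Complex x y)) (box l u)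
      = emeasure (lborel \<Otimes>\<^sub>M lborel) ({Re l<..<Re u} \<times> {Im l<..<Im u})"
    by (subst emeasure_distr[OF meas]) auto
  also have "\<dots> = ennreal (Re u - Re l) * ennreal (Im u - Im l)"
    using le' by (subst lborel.emeasure_pair_measure_Times) auto
  finally show "emeasure (distr (lborel \<Otimes>\<^sub>M lborel) borel (\<lambda>(x, y). Complex x y)) (box l u)
     = (\<Prod>b\<in>Basis. (u - l) \<bullet> b)"
    using le' by (simp add: Basis_complex_def ennreal_mult)
qed simp

lemma Complex_measurable [measurable]:
  "(\<lambda>(x, y). Complex x y) \<in> borel_measurable (lborel \<Otimes>\<^sub>M lborel)"
  by (simp add: Complex_eq case_prod_beta)

lemma integrable_lborel_complex_iff:
  fixes f :: "complex \<Rightarrow> 'b::{banach, second_countable_topology}"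
  assumes "f \<in> borel_measurable borel"
  shows "integrable lborel f \<longleftrightarrow> integrable (lborel \<Otimes>\<^sub>M lborel) (\<lambda>(x, y). f (Complex x y))"
  by (subst lborel_complex_distr, subst integrable_distr_eq[OF Complex_measurable assms])
     (simp add: case_prod_unfold)

lemma integral_lborel_complex:
  fixes f :: "complex \<Rightarrow> 'b::{banach, second_countable_topology}"
  assumes "f \<in> borel_measurable borel"
  shows "integral\<^sup>L lborel f = integral\<^sup>L (lborel \<Otimes>\<^sub>M lborel) (\<lambda>(x, y). f (Complex x y))"
  by (subst lborel_complex_distr, subst integral_distr[OF Complex_measurable assms])
     (simp add: case_prod_unfold)

lemma nn_integral_lborel_complex:
  assumes "f \<in> borel_measurable borel"
  shows "integral\<^sup>N lborel f = (\<integral>\<^sup>+y. \<integral>\<^sup>+x. f (Complex x y) \<partial>lborel \<partial>lborel)"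
proof -
  have "integral\<^sup>N lborel f = integral\<^sup>N (lborel \<Otimes>\<^sub>M lborel) (\<lambda>z. f (case z of (x, y) \<Rightarrow> Complex x y))"
    by (subst lborel_complex_distr, subst nn_integral_distr) (use assms in auto)
  also have "\<dots> = (\<integral>\<^sup>+y. \<integral>\<^sup>+x. f (Complex x y) \<partial>lborel \<partial>lborel)"
    using assms by (subst lborel_pair.nn_integral_snd[symmetric]) auto
  finally show ?thesis .
qed

lemma borel_measurable_punctured:
  fixes f :: "complex \<Rightarrow> complex"
  assumes "continuous_on (-{p}) f"
  shows "f \<in> borel_measurable borel"
  by (rule borel_measurable_continuous_countable_exceptions[OF _ assms]) simp

lemma has_wirtinger_imp_continuous:
  "has_wirtinger f a b z \<Longrightarrow> isCont f z"
  unfolding has_wirtinger_def using has_derivative_continuous by blast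

text \<open>The derivative in the direction 1; \<open>has_wirtinger_Im\<close> takes the direction
  \<open>\<i>\<close>. Together they give both partial derivatives in terms of \<open>a\<close> and
  \<open>b\<close>.\<close>

lemma has_wirtinger_Re:
  assumes "has_wirtinger f a b (Complex x y)"
  shows "((\<lambda>x. f (Complex x y)) has_vector_derivative (a + b)) (at x)"
proof -
  have "((\<lambda>x. Complex x y) has_derivative (\<lambda>d. complex_of_real d)) (at x)"
    unfolding Complex_eq by (auto intro!: derivative_eq_intros)
  from has_derivative_compose[OF this, of f "\<lambda>v. a * v + b * cnj v"] assms show ?thesis
    unfolding has_wirtinger_def has_vector_derivative_def
    by (simp add: scaleR_conv_of_real algebra_simps)
qed

lemma has_wirtinger_Im:
  assumes "has_wirtinger f a b (Complex x y)"
  shows "((\<lambda>y. f (Complex x y)) has_vector_derivative (\<i> * (a - b))) (at y)"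
proof -
  have "((\<lambda>y. Complex x y) has_derivative (\<lambda>d. \<i> * complex_of_real d)) (at y)"
    unfolding Complex_eq by (auto intro!: derivative_eq_intros)
  from has_derivative_compose[OF this, of f "\<lambda>v. a * v + b * cnj v"] assms show ?thesis
    unfolding has_wirtinger_def has_vector_derivative_def
    by (simp add: scaleR_conv_of_real algebra_simps)
qed

lemma continuous_on_Complex_line:
  "continuous_on S (\<lambda>x. Complex x y)" "continuous_on S (\<lambda>y. Complex x y)"
  unfolding Complex_eq by (intro continuous_intros)+

lemma integral_vector_derivative_compact_support:
  fixes F :: "real \<Rightarrow> complex"
  assumes F: "\<And>x. (F has_vector_derivative f x) (at x)"
    and f: "continuous_on UNIV f"
    and supp: "\<And>x. \<bar>x\<bar> > R \<Longrightarrow> F x = 0 \<and> f x = 0"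
  shows "integral\<^sup>L lborel f = 0"
proof -
  \<comment> \<open>\<open>R\<close> may be negative, and \<open>F\<close> must already vanish at
    both end points.\<close>
  let ?r = "\<bar>R\<bar> + 1"
  have "has_bochner_integral lborel (\<lambda>x. indicator {-?r..?r} x *\<^sub>R f x) (F ?r - F (-?r))"
    by (rule has_bochner_integral_FTC_Icc)
       (auto intro: has_vector_derivative_at_within F continuous_on_subset[OF f])
  moreover have "indicator {-?r..?r} x *\<^sub>R f x = f x" for x
    using supp[of x] by (auto simp: indicator_def)
  ultimately have "has_bochner_integral lborel f 0"
    using supp[of ?r] supp[of "-?r"] by simp
  then show ?thesis by (rule has_bochner_integral_integral_eq)
qed

text \<open>Almost every horizontal and vertical line misses \<open>p\<close>, so nothing is required of \<open>g\<close> at \<open>p\<close>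
  beyond the integrability of its derivatives.\<close>

lemma integral_dbar_eq_0:
  assumes wd: "\<And>z. z \<noteq> p \<Longrightarrow> has_wirtinger g (a z) (b z) z"
    and cont: "continuous_on (-{p}) a" "continuous_on (-{p}) b"
    and supp: "\<And>z. norm z > R \<Longrightarrow> g z = 0 \<and> a z = 0 \<and> b z = 0"
    and int: "integrable lborel a" "integrable lborel b"
  shows "integral\<^sup>L lborel b = 0"
proof -
  have [measurable]: "a \<in> borel_measurable borel" "b \<in> borel_measurable borel"
    using borel_measurable_punctured cont by auto
  \<comment> \<open>\<open>a + b\<close> is the x-derivative of \<open>g\<close>, so horizontal
    lines are integrated first; on each of them compact support leaves nothing.\<close>
  have sum0: "integral\<^sup>L lborel (\<lambda>z. a z + b z) = 0"
  proof -
    have I: "integrable (lborel \<Otimes>\<^sub>M lborel) (\<lambda>(x, y). a (Complex x y) + b (Complex x y))"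
      using integrable_lborel_complex_iff[of "\<lambda>z. a z + b z"] int by simp
    have "integral\<^sup>L lborel (\<lambda>z. a z + b z) =
      integral\<^sup>L (lborel \<Otimes>\<^sub>M lborel) (\<lambda>(x, y). a (Complex x y) + b (Complex x y))"
      by (rule integral_lborel_complex) simp
    also have "\<dots> = (\<integral>y. (\<integral>x. a (Complex x y) + b (Complex x y) \<partial>lborel) \<partial>lborel)"
      using lborel_pair.integral_snd[OF I] by simp
    also have "\<dots> = (\<integral>y. 0 \<partial>(lborel :: real measure))"
    proof (rule integral_cong_AE)
      show "AE y in lborel. (\<integral>x. a (Complex x y) + b (Complex x y) \<partial>lborel) = 0"
        using AE_lborel_singleton[of "Im p"]
      proof eventually_elim
        case (elim y)
        have ne: "Complex x y \<noteq> p" for x using elim by auto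
        show ?case
        proof (rule integral_vector_derivative_compact_support[where R=R])
          show "((\<lambda>x. g (Complex x y)) has_vector_derivative a (Complex x y) + b (Complex x y)) (at x)" for x
            by (rule has_wirtinger_Re[OF wd[OF ne]])
          show "continuous_on UNIV (\<lambda>x. a (Complex x y) + b (Complex x y))"
            by (intro continuous_intros continuous_on_compose2[OF cont(1)] continuous_on_compose2[OF cont(2)])
               (use ne in \<open>auto intro: continuous_on_Complex_line\<close>)
          show "\<bar>x\<bar> > R \<Longrightarrow> g (Complex x y) = 0 \<and> a (Complex x y) + b (Complex x y) = 0" for x
            using supp[of "Complex x y"] abs_Re_le_cmod[of "Complex x y"] by auto
        qed
      qed
    qed auto
    finally show ?thesis by simp
  qed
  \<comment> \<open>\<open>\<i> * (a z - b z)\<close> is the y-derivative, so here vertical lines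
    come first. The two results together isolate the integral of \<open>b\<close>.\<close>
  have diff0: "integral\<^sup>L lborel (\<lambda>z. \<i> * (a z - b z)) = 0"
  proof -
    have I: "integrable (lborel \<Otimes>\<^sub>M lborel) (\<lambda>(x, y). \<i> * (a (Complex x y) - b (Complex x y)))"
      using integrable_lborel_complex_iff[of "\<lambda>z. \<i> * (a z - b z)"] int by simp
    have "integral\<^sup>L lborel (\<lambda>z. \<i> * (a z - b z)) =
      integral\<^sup>L (lborel \<Otimes>\<^sub>M lborel) (\<lambda>(x, y). \<i> * (a (Complex x y) - b (Complex x y)))"
      by (rule integral_lborel_complex) simp
    also have "\<dots> = (\<integral>x. (\<integral>y. \<i> * (a (Complex x y) - b (Complex x y)) \<partial>lborel) \<partial>lborel)"
      using lborel_pair.integral_fst'[OF I] by simp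
    also have "\<dots> = (\<integral>x. 0 \<partial>(lborel :: real measure))"
    proof (rule integral_cong_AE)
      show "AE x in lborel. (\<integral>y. \<i> * (a (Complex x y) - b (Complex x y)) \<partial>lborel) = 0"
        using AE_lborel_singleton[of "Re p"]
      proof eventually_elim
        case (elim x)
        have ne: "Complex x y \<noteq> p" for y using elim by auto
        show ?case
        proof (rule integral_vector_derivative_compact_support[where R=R])
          show "((\<lambda>y. g (Complex x y)) has_vector_derivative \<i> * (a (Complex x y) - b (Complex x y))) (at y)" for y
            by (rule has_wirtinger_Im[OF wd[OF ne]])
          show "continuous_on UNIV (\<lambda>y. \<i> * (a (Complex x y) - b (Complex x y)))"
            by (intro continuous_intros continuous_on_compose2[OF cont(1)] continuous_on_compose2[OF cont(2)])
               (use ne in \<open>auto intro: continuous_on_Complex_line\<close>)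
          show "\<bar>y\<bar> > R \<Longrightarrow> g (Complex x y) = 0 \<and> \<i> * (a (Complex x y) - b (Complex x y)) = 0" for y
            using supp[of "Complex x y"] abs_Im_le_cmod[of "Complex x y"] by auto
        qed
      qed
    qed auto
    finally show ?thesis by simp
  qed
  have "integral\<^sup>L lborel a + integral\<^sup>L lborel b = 0" "integral\<^sup>L lborel a - integral\<^sup>L lborel b = 0"
    using sum0 diff0 int by simp_all
  then show ?thesis by simp
qed

section \<open>Integrability of the Cauchy kernel\<close>

lemma set_integrable_inverse_sqrt:
  assumes "R > 0"
  shows "set_integrable lborel {0<..<R} (\<lambda>x. 1 / sqrt x)"
proof -
  have "set_integrable lborel (einterval (ereal 0) (ereal R)) (\<lambda>x. 1 / sqrt x)"
  proof (rule interval_integral_FTC_nonneg(1)[where F = "\<lambda>x. 2 * sqrt x" and A = 0 and B = "2 * sqrt R"])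
    show "((\<lambda>x. 2 * sqrt x) has_real_derivative 1 / sqrt x) (at x)" if "ereal 0 < ereal x" for x
      using that by (auto intro!: derivative_eq_intros simp: field_simps)
    show "isCont (\<lambda>x. 1 / sqrt x) x" if "ereal 0 < ereal x" for x
      using that by (auto intro!: continuous_intros)
    have "((\<lambda>x::real. 2 * sqrt x) \<longlongrightarrow> 2 * sqrt 0) (at_right 0)"
      by (intro tendsto_intros)
    then show "(((\<lambda>x. 2 * sqrt x) \<circ> real_of_ereal) \<longlongrightarrow> 0) (at_right (ereal 0))"
      by (simp add: ereal_tendsto_simps)
    have "((\<lambda>x::real. 2 * sqrt x) \<longlongrightarrow> 2 * sqrt R) (at_left R)"
      by (intro tendsto_intros)
    then show "(((\<lambda>x. 2 * sqrt x) \<circ> real_of_ereal) \<longlongrightarrow> 2 * sqrt R) (at_left (ereal R))"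
      by (simp add: ereal_tendsto_simps)
  qed (use assms in auto)
  then show ?thesis by simp
qed

lemma nn_integral_inverse_sqrt_finite:
  "(\<integral>\<^sup>+x. ennreal (indicator {-R..R} x / sqrt \<bar>x\<bar>) \<partial>lborel) < \<infinity>"
proof -
  define r where "r = \<bar>R\<bar> + 1"
  have r: "r > 0" unfolding r_def by simp
  let ?k = "\<lambda>x::real. indicat_real {0<..<r} x * (1 / sqrt x)"
  have i1: "integrable lborel ?k"
    using set_integrable_inverse_sqrt[OF r] by (simp add: set_integrable_def)
  have i2: "integrable lborel (\<lambda>x. ?k (0 + (-1) * x))"
    by (rule lborel_integrable_real_affine[OF i1]) simp
  have nneg: "?k x \<ge> 0" for x by (auto simp: indicator_def)
  \<comment> \<open>A reflected copy covers the negative half line; the origin costs nothing, since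
    \<open>1 / sqrt 0 = 0\<close>.\<close>
  have "(\<integral>\<^sup>+x. ennreal (indicator {-R..R} x / sqrt \<bar>x\<bar>) \<partial>lborel)
      \<le> (\<integral>\<^sup>+x. ennreal (?k x + ?k (0 + (-1) * x)) \<partial>lborel)"
    by (intro nn_integral_mono ennreal_leI) (auto simp: indicator_def r_def)
  also have "\<dots> = ennreal (\<integral>x. ?k x + ?k (0 + (-1) * x) \<partial>lborel)"
    by (intro nn_integral_eq_integral Bochner_Integration.integrable_add i1 i2 AE_I2 add_nonneg_nonneg nneg)
  also have "\<dots> < \<infinity>" by simp
  finally show ?thesis .
qed

lemma sqrt_abs_mult_le_cmod: "sqrt \<bar>x\<bar> * sqrt \<bar>y\<bar> \<le> cmod (Complex x y)"
proof -
  have "\<bar>x\<bar> * \<bar>y\<bar> \<le> x\<^sup>2 + y\<^sup>2"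
  proof -
    have "2 * (\<bar>x\<bar> * \<bar>y\<bar>) \<le> x\<^sup>2 + y\<^sup>2" "0 \<le> \<bar>x\<bar> * \<bar>y\<bar>"
      using sum_squares_bound[of "\<bar>x\<bar>" "\<bar>y\<bar>"] by (simp_all add: mult.assoc)
    then show ?thesis by linarith
  qed
  then show ?thesis
    by (simp add: complex_norm real_sqrt_mult[symmetric])
qed

lemma inverse_dist_measurable [measurable]:
  "(\<lambda>z::complex. indicat_real (cball c R) z / norm (z - w)) \<in> borel_measurable borel"
  by (intro borel_measurable_divide borel_measurable_indicator borel_measurable_continuous_onI continuous_intros) auto

text \<open>Since \<open>1 / |x + i y| \<le> |x|\<^sup>-\<^sup>1\<^sup>/\<^sup>2 |y|\<^sup>-\<^sup>1\<^sup>/\<^sup>2\<close>, no polar coordinates are needed.\<close>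

lemma integrable_inverse_norm_cball:
  "integrable lborel (\<lambda>u::complex. indicator (cball 0 R) u / norm u)"
proof (rule integrableI_bounded)
  let ?k = "\<lambda>x::real. indicator {-R..R} x / sqrt \<bar>x\<bar>"
  let ?I = "\<integral>\<^sup>+x. ennreal (?k x) \<partial>lborel"
  have "(\<integral>\<^sup>+u. ennreal (norm (indicator (cball 0 R) u / norm (u::complex))) \<partial>lborel)
     = (\<integral>\<^sup>+y. \<integral>\<^sup>+x. ennreal (norm (indicator (cball 0 R) (Complex x y) / norm (Complex x y))) \<partial>lborel \<partial>lborel)"
    using inverse_dist_measurable[of 0 R 0] by (intro nn_integral_lborel_complex) simp
  also have "\<dots> \<le> (\<integral>\<^sup>+y. \<integral>\<^sup>+x. ennreal (?k x) * ennreal (?k y) \<partial>lborel \<partial>lborel)"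
  proof (rule nn_integral_mono_AE)
    show "AE y in lborel. (\<integral>\<^sup>+x. ennreal (norm (indicator (cball 0 R) (Complex x y) / norm (Complex x y))) \<partial>lborel)
       \<le> (\<integral>\<^sup>+x. ennreal (?k x) * ennreal (?k y) \<partial>lborel)"
      \<comment> \<open>The axes must be left out: there division by zero turns the product bound
        into 0.\<close>
      using AE_lborel_singleton[of 0]
    proof eventually_elim
      case (elim y)
      show ?case
      proof (rule nn_integral_mono_AE)
        show "AE x in lborel. ennreal (norm (indicator (cball 0 R) (Complex x y) / norm (Complex x y)))
           \<le> ennreal (?k x) * ennreal (?k y)"
          using AE_lborel_singleton[of 0]
        proof eventually_elim
          case (elim x)
          have "norm (indicator (cball 0 R) (Complex x y) / norm (Complex x y)) \<le> ?k x * ?k y"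
          proof (cases "Complex x y \<in> cball 0 R")
            case True
            then have "x \<in> {-R..R}" "y \<in> {-R..R}"
              using abs_Re_le_cmod[of "Complex x y"] abs_Im_le_cmod[of "Complex x y"] by auto
            moreover have "1 / cmod (Complex x y) \<le> 1 / (sqrt \<bar>x\<bar> * sqrt \<bar>y\<bar>)"
              by (rule divide_left_mono[OF sqrt_abs_mult_le_cmod]) (use elim \<open>y \<noteq> 0\<close> in \<open>auto intro!: mult_pos_pos simp: complex_eq_iff\<close>)
            ultimately show ?thesis using True by simp
          next
            case False then show ?thesis by simp
          qed
          then show ?case by (simp flip: ennreal_mult add: ennreal_leI)
        qed
      qed
    qed
  qed
  also have "\<dots> = ?I * ?I"
    by (simp add: nn_integral_cmult nn_integral_multc)
  also have "\<dots> < \<infinity>"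
    using nn_integral_inverse_sqrt_finite[of R] by (simp add: ennreal_mult_less_top)
  finally show "(\<integral>\<^sup>+u. ennreal (norm (indicator (cball 0 R) u / norm (u::complex))) \<partial>lborel) < \<infinity>" .
qed (use inverse_dist_measurable[of 0 R 0] in simp)

text \<open>Translation moves the singularity to the origin and the ball into one of radius
  \<open>R + Q\<close>. The bound depends on \<open>w\<close> only through \<open>Q\<close>, so it
  is uniform along a bounded curve.\<close>

lemma
  fixes w :: complex
  assumes Q: "norm w \<le> Q"
  shows integrable_inverse_dist: "integrable lborel (\<lambda>z. indicator (cball 0 R) z / norm (z - w))" (is ?A)
    and integral_inverse_dist_le: "(\<integral>z. indicator (cball 0 R) z / norm (z - w) \<partial>lborel)
     \<le> (\<integral>u. indicator (cball 0 (R + Q)) u / norm (u::complex) \<partial>lborel)" (is ?B)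
proof -
  have eq: "integrable lborel f \<longleftrightarrow> integrable lborel (\<lambda>u. f (w + u))"
      "integral\<^sup>L lborel f = integral\<^sup>L lborel (\<lambda>u. f (w + u))"
    if [measurable]: "f \<in> borel_measurable borel" for f :: "complex \<Rightarrow> real"
    by (subst lborel_distr_plus[of w, symmetric], subst integrable_distr_eq integral_distr; simp)+
  have le: "indicat_real (cball 0 R) (w + u) / cmod (w + u - w) \<le> indicat_real (cball 0 (R + Q)) u / norm u" for u
    using norm_triangle_ineq4[of "w + u" w] Q
    by (auto simp: indicator_def divide_right_mono)
  have i: "integrable lborel (\<lambda>u. indicat_real (cball 0 R) (w + u) / cmod (w + u - w))"
  proof (rule Bochner_Integration.integrable_bound[OF integrable_inverse_norm_cball[of "R + Q"]])
    show "AE u in lborel. norm (indicat_real (cball 0 R) (w + u) / cmod (w + u - w))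
        \<le> norm (indicat_real (cball 0 (R + Q)) u / norm u)"
    proof (rule AE_I2)
      fix u
      show "norm (indicat_real (cball 0 R) (w + u) / cmod (w + u - w))
        \<le> norm (indicat_real (cball 0 (R + Q)) u / norm u)"
        using le[of u] by (subst (1 2) real_norm_def, subst (1 2) abs_of_nonneg) auto
    qed
    from inverse_dist_measurable show "(\<lambda>u. indicat_real (cball 0 R) (w + u) / cmod (w + u - w)) \<in> borel_measurable lborel"
      by (rule measurable_compose[rotated]) simp
  qed
  then show ?A by (subst eq) auto
  show ?B
    by (subst eq, simp, rule integral_mono[OF i integrable_inverse_norm_cball le])
qed

section \<open>The mollifier and its mass\<close>

lemma nn_integral_FTC_UNIV:
  fixes f F :: "real \<Rightarrow> real"
  assumes F: "\<And>x. (F has_real_derivative f x) (at x)"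
    and f: "\<And>x. isCont f x" "\<And>x. f x \<ge> 0"
    and lim: "(F \<longlongrightarrow> A) at_bot" "(F \<longlongrightarrow> B) at_top"
  shows "(\<integral>\<^sup>+x. ennreal (f x) \<partial>lborel) = ennreal (B - A)"
proof -
  have i: "set_integrable lborel (einterval (-\<infinity>) \<infinity>) f"
    and e: "(LBINT x=-\<infinity>..\<infinity>. f x) = B - A"
    by (rule interval_integral_FTC_nonneg[where F = F];
        use assms in \<open>auto simp: ereal_tendsto_simps\<close>)+
  from i have i': "integrable lborel f"
    by (simp add: set_integrable_def)
  from e have "integral\<^sup>L lborel f = B - A"
    by (simp add: interval_lebesgue_integral_def set_lebesgue_integral_def)
  then show ?thesis
    using nn_integral_eq_integral[OF i'] f by simp
qed

text \<open>The inner integral for \<open>integral_mollifier\<close>, where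
  \<open>a = sqrt (1 + y\<^sup>2)\<close>.\<close>

lemma nn_integral_inverse_quartic:
  assumes "a > 0"
  shows "(\<integral>\<^sup>+x. ennreal (1 / (a\<^sup>2 + x\<^sup>2)\<^sup>2) \<partial>lborel) = ennreal (pi / (2 * a ^ 3))"
proof -
  have pos: "a\<^sup>2 + x\<^sup>2 > 0" for x using assms by (simp add: add_pos_nonneg)
  \<comment> \<open>The primitive given by the usual reduction of the squared denominator to an
    arctangent.\<close>
  let ?F = "\<lambda>x. x / (2 * a\<^sup>2 * (a\<^sup>2 + x\<^sup>2)) + arctan (x / a) / (2 * a ^ 3)"
  have "(\<integral>\<^sup>+x. ennreal (1 / (a\<^sup>2 + x\<^sup>2)\<^sup>2) \<partial>lborel) = ennreal (pi / (4 * a ^ 3) - - (pi / (4 * a ^ 3)))"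
  proof (rule nn_integral_FTC_UNIV[where F = ?F])
    fix x
    have e: "1 + (x / a)\<^sup>2 = (a\<^sup>2 + x\<^sup>2) / a\<^sup>2" using assms by (simp add: field_simps)
    have "((\<lambda>x. x / (2 * a\<^sup>2 * (a\<^sup>2 + x\<^sup>2))) has_real_derivative
       (a\<^sup>2 - x\<^sup>2) / (2 * a\<^sup>2 * (a\<^sup>2 + x\<^sup>2)\<^sup>2)) (at x)"
      using pos[of x] assms
      by (auto intro!: derivative_eq_intros simp: divide_simps power2_eq_square) (auto simp: algebra_simps)
    moreover have "((\<lambda>x. arctan (x / a) / (2 * a ^ 3)) has_real_derivative
       1 / (2 * a\<^sup>2 * (a\<^sup>2 + x\<^sup>2))) (at x)"
      using pos[of x] assms
      by (auto intro!: derivative_eq_intros simp: e divide_simps power2_eq_square power3_eq_cube)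
    ultimately have "(?F has_real_derivative (a\<^sup>2 - x\<^sup>2) / (2 * a\<^sup>2 * (a\<^sup>2 + x\<^sup>2)\<^sup>2) + 1 / (2 * a\<^sup>2 * (a\<^sup>2 + x\<^sup>2))) (at x)"
      by (rule DERIV_add)
    also have "(a\<^sup>2 - x\<^sup>2) / (2 * a\<^sup>2 * (a\<^sup>2 + x\<^sup>2)\<^sup>2) + 1 / (2 * a\<^sup>2 * (a\<^sup>2 + x\<^sup>2)) = 1 / (a\<^sup>2 + x\<^sup>2)\<^sup>2"
    proof -
      have D: "1 / (2 * a\<^sup>2 * D) = D / (2 * a\<^sup>2 * D\<^sup>2)" if "D > 0" for D :: real
        using that assms by (simp add: power2_eq_square)
      have "(a\<^sup>2 - x\<^sup>2) / (2 * a\<^sup>2 * (a\<^sup>2 + x\<^sup>2)\<^sup>2) + 1 / (2 * a\<^sup>2 * (a\<^sup>2 + x\<^sup>2))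
        = ((a\<^sup>2 - x\<^sup>2) + (a\<^sup>2 + x\<^sup>2)) / (2 * a\<^sup>2 * (a\<^sup>2 + x\<^sup>2)\<^sup>2)"
        using D[OF pos[of x]] by (simp only: add_divide_distrib)
      also have "\<dots> = 1 / (a\<^sup>2 + x\<^sup>2)\<^sup>2" using pos[of x] assms by (simp add: divide_simps)
      finally show ?thesis .
    qed
    finally show "(?F has_real_derivative 1 / (a\<^sup>2 + x\<^sup>2)\<^sup>2) (at x)" .
    show "isCont (\<lambda>x. 1 / (a\<^sup>2 + x\<^sup>2)\<^sup>2) x"
      using pos[of x] by (auto intro!: continuous_intros)
  next
    have "((\<lambda>x. x / (2 * a\<^sup>2 * (a\<^sup>2 + x\<^sup>2))) \<longlongrightarrow> 0) at_top" "((\<lambda>x. x / (2 * a\<^sup>2 * (a\<^sup>2 + x\<^sup>2))) \<longlongrightarrow> 0) at_bot"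
      using assms by real_asymp+
    moreover have "((\<lambda>x. arctan (x / a)) \<longlongrightarrow> pi / 2) at_top" "((\<lambda>x. arctan (x / a)) \<longlongrightarrow> - (pi / 2)) at_bot"
      using assms by real_asymp+
    ultimately have "(?F \<longlongrightarrow> 0 + (pi / 2) / (2 * a ^ 3)) at_top" "(?F \<longlongrightarrow> 0 + (- (pi / 2)) / (2 * a ^ 3)) at_bot"
      by (intro tendsto_intros; use assms in simp)+
    then show "(?F \<longlongrightarrow> pi / (4 * a ^ 3)) at_top" "(?F \<longlongrightarrow> - (pi / (4 * a ^ 3))) at_bot"
      by simp_all
  qed auto
  then show ?thesis by simp
qed

text \<open>The integrand is the antiholomorphic derivative of \<open>kern 1\<close>, and its mass
  is the factor \<open>pi\<close> in \<open>cauchy_pompeiu\<close>. Two one-dimensional primitives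
  compute it.\<close>

lemma
  shows integrable_mollifier: "integrable lborel (\<lambda>u::complex. 1 / (1 + (norm u)\<^sup>2)\<^sup>2)" (is ?A)
    and integral_mollifier: "(\<integral>u. 1 / (1 + (norm (u::complex))\<^sup>2)\<^sup>2 \<partial>lborel) = pi" (is ?B)
proof -
  have pos: "1 + y\<^sup>2 > 0" for y :: real by (simp add: add_pos_nonneg)
  have "(\<integral>\<^sup>+u. ennreal (1 / (1 + (norm (u::complex))\<^sup>2)\<^sup>2) \<partial>lborel)
     = (\<integral>\<^sup>+y. \<integral>\<^sup>+x. ennreal (1 / (1 + (norm (Complex x y))\<^sup>2)\<^sup>2) \<partial>lborel \<partial>lborel)"
    by (rule nn_integral_lborel_complex) simp
  also have "\<dots> = (\<integral>\<^sup>+y. \<integral>\<^sup>+x. ennreal (1 / ((sqrt (1 + y\<^sup>2))\<^sup>2 + x\<^sup>2)\<^sup>2) \<partial>lborel \<partial>lborel)"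
    using pos by (simp add: cmod_power2 add_ac less_imp_le)
  also have "\<dots> = (\<integral>\<^sup>+y. ennreal (pi / (2 * sqrt (1 + y\<^sup>2) ^ 3)) \<partial>lborel)"
    using pos by (subst nn_integral_inverse_quartic) auto
  also have "\<dots> = ennreal (pi / 2 - - (pi / 2))"
  proof (rule nn_integral_FTC_UNIV[where F = "\<lambda>y. pi / 2 * (y / sqrt (1 + y\<^sup>2))"])
    fix y :: real
    have s: "sqrt (1 + y\<^sup>2) > 0" "sqrt (1 + y\<^sup>2) ^ 2 = 1 + y\<^sup>2" using pos[of y] by auto
    have "((\<lambda>y. pi / 2 * (y / sqrt (1 + y\<^sup>2))) has_real_derivative
       pi / 2 * ((sqrt (1 + y\<^sup>2) - y * (y / sqrt (1 + y\<^sup>2))) / (sqrt (1 + y\<^sup>2))\<^sup>2)) (at y)"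
    proof -
      have "((\<lambda>y. sqrt (1 + y\<^sup>2)) has_real_derivative y / sqrt (1 + y\<^sup>2)) (at y)"
        using pos[of y] by (auto intro!: derivative_eq_intros simp: field_simps)
      from DERIV_cmult[OF DERIV_divide[OF DERIV_ident this], of "pi / 2"] s(1) show ?thesis
        by (simp add: power2_eq_square)
    qed
    also have "sqrt (1 + y\<^sup>2) - y * (y / sqrt (1 + y\<^sup>2)) = 1 / sqrt (1 + y\<^sup>2)"
      using s pos[of y] by (simp add: field_simps power2_eq_square)
    finally show "((\<lambda>y. pi / 2 * (y / sqrt (1 + y\<^sup>2))) has_real_derivative
       pi / (2 * sqrt (1 + y\<^sup>2) ^ 3)) (at y)"
      by (simp add: power2_eq_square power3_eq_cube mult_ac)
    show "isCont (\<lambda>y. pi / (2 * sqrt (1 + y\<^sup>2) ^ 3)) y"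
      using s by (intro continuous_intros) auto
    show "0 \<le> pi / (2 * sqrt (1 + y\<^sup>2) ^ 3)" using s by (intro divide_nonneg_pos) auto
  next
    show "((\<lambda>y. pi / 2 * (y / sqrt (1 + y\<^sup>2))) \<longlongrightarrow> pi / 2) at_top"
         "((\<lambda>y. pi / 2 * (y / sqrt (1 + y\<^sup>2))) \<longlongrightarrow> - (pi / 2)) at_bot"
      by real_asymp+
  qed
  finally have *: "(\<integral>\<^sup>+u. ennreal (1 / (1 + (norm (u::complex))\<^sup>2)\<^sup>2) \<partial>lborel) = ennreal pi" by simp
  show ?A by (rule integrableI_nn_integral_finite[OF _ _ *]) auto
  show ?B by (rule integral_eq_nn_integral[THEN trans]) (use * in auto)
qed

section \<open>Wirtinger derivatives and the Cauchy-Pompeiu formula\<close>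

lemma has_wirtinger_eq:
  "has_wirtinger f a b z \<Longrightarrow> a = a' \<Longrightarrow> b = b' \<Longrightarrow> has_wirtinger f a' b' z"
  by simp

lemma has_wirtinger_const: "has_wirtinger (\<lambda>_. c) 0 0 z"
  by (simp add: has_wirtinger_def)

lemma has_wirtinger_cnj:
  "has_wirtinger f a b z \<Longrightarrow> has_wirtinger (\<lambda>z. cnj (f z)) (cnj b) (cnj a) z"
  unfolding has_wirtinger_def
  by (drule bounded_linear.has_derivative[OF bounded_linear_cnj]) (simp add: add.commute)

lemma has_wirtinger_add:
  "has_wirtinger f a b z \<Longrightarrow> has_wirtinger g c d z \<Longrightarrow> has_wirtinger (\<lambda>z. f z + g z) (a + c) (b + d) z"
  unfolding has_wirtinger_def by (drule (1) has_derivative_add) (simp add: algebra_simps)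

lemma has_wirtinger_mult:
  "has_wirtinger f a b z \<Longrightarrow> has_wirtinger g c d z \<Longrightarrow>
     has_wirtinger (\<lambda>z. f z * g z) (f z * c + a * g z) (f z * d + b * g z) z"
  unfolding has_wirtinger_def by (drule (1) has_derivative_mult) (simp add: algebra_simps)

lemma has_wirtinger_inverse:
  assumes "has_wirtinger f a b z" "f z \<noteq> 0"
  shows "has_wirtinger (\<lambda>z. inverse (f z)) (- a * (inverse (f z))\<^sup>2) (- b * (inverse (f z))\<^sup>2) z"
  using Deriv.has_derivative_inverse[OF assms(2) assms(1)[unfolded has_wirtinger_def]]
  unfolding has_wirtinger_def by (simp add: algebra_simps power2_eq_square)

lemma has_wirtinger_holomorphic:
  "(f has_field_derivative f') (at z) \<Longrightarrow> has_wirtinger f f' 0 z"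
  unfolding has_wirtinger_def has_field_derivative_def by simp

lemma has_wirtinger_norm:
  assumes "has_wirtinger f a b z" "f z \<noteq> 0"
  shows "has_wirtinger (\<lambda>z. complex_of_real (norm (f z)))
    ((a * cnj (f z) + f z * cnj b) / (2 * norm (f z))) ((b * cnj (f z) + f z * cnj a) / (2 * norm (f z))) z"
proof -
  have "((\<lambda>z. norm (f z)) has_derivative (\<lambda>v. (a * v + b * cnj v) \<bullet> sgn (f z))) (at z)"
    using has_derivative_compose[OF assms(1)[unfolded has_wirtinger_def] has_derivative_norm[OF assms(2)]] .
  from has_derivative_of_real[OF this]
  have "((\<lambda>z. complex_of_real (norm (f z))) has_derivative
       (\<lambda>v. complex_of_real ((a * v + b * cnj v) \<bullet> sgn (f z)))) (at z)" .
  moreover have "complex_of_real (x \<bullet> sgn y) = (x * cnj y + cnj x * y) / (2 * norm y)" for x y :: complex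
  proof -
    have "complex_of_real (x \<bullet> y) = (x * cnj y + cnj x * y) / 2"
      by (simp add: complex_eq_iff inner_complex_def)
    moreover have "complex_of_real (x \<bullet> sgn y) = complex_of_real (x \<bullet> y) / norm y"
      by (simp add: sgn_div_norm divide_inverse mult.commute)
    ultimately show ?thesis by (simp only: divide_divide_eq_left of_real_mult of_real_numeral)
  qed
  ultimately show ?thesis
    unfolding has_wirtinger_def by (simp add: algebra_simps add_divide_distrib)
qed

lemma has_wirtinger_real_compose:
  fixes \<psi> :: "real \<Rightarrow> real"
  assumes f: "has_wirtinger (\<lambda>z. complex_of_real (f z)) a b z"
    and psi: "(\<psi> has_real_derivative d) (at (f z))"
  shows "has_wirtinger (\<lambda>z. complex_of_real (\<psi> (f z))) (d * a) (d * b) z"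
proof -
  have "((\<lambda>z. Re (complex_of_real (f z))) has_derivative (\<lambda>v. Re (a * v + b * cnj v))) (at z)"
    by (rule has_derivative_Re) (rule f[unfolded has_wirtinger_def])
  then have fd: "(f has_derivative (\<lambda>v. Re (a * v + b * cnj v))) (at z)" by simp
  have "((\<lambda>z. complex_of_real (f z)) has_derivative (\<lambda>v. of_real (Re (a * v + b * cnj v)))) (at z)"
    by (rule has_derivative_of_real[OF fd])
  \<comment> \<open>Uniqueness of the derivative: for real-valued \<open>f\<close> the form
    \<open>a * v + b * cnj v\<close> is itself real, so taking its real part loses nothing.\<close>
  then have re: "(\<lambda>v. complex_of_real (Re (a * v + b * cnj v))) = (\<lambda>v. a * v + b * cnj v)"
    using f unfolding has_wirtinger_def by (rule has_derivative_unique)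
  have D: "((\<lambda>z. \<psi> (f z)) has_derivative (\<lambda>v. d * Re (a * v + b * cnj v))) (at z)"
    by (rule has_derivative_compose[OF fd psi[unfolded has_field_derivative_def]])
  have "(\<lambda>v. complex_of_real (d * Re (a * v + b * cnj v))) = (\<lambda>v. d * a * v + d * b * cnj v)"
    by (rule ext) (simp only: of_real_mult fun_cong[OF re] distrib_left mult.assoc)
  moreover have "((\<lambda>z. complex_of_real (\<psi> (f z))) has_derivative (\<lambda>v. complex_of_real (d * Re (a * v + b * cnj v)))) (at z)"
    by (rule has_derivative_of_real[OF D])
  ultimately show ?thesis
    unfolding has_wirtinger_def by (simp only:)
qed

text \<open>A smooth regularisation of the Cauchy kernel \<open>1 / u\<close>; as \<open>e\<close> tends to \<open>0\<close>, its antiholomorphic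
  derivative is \<open>\<pi>\<close> times an approximate identity.\<close>

definition kern :: "real \<Rightarrow> complex \<Rightarrow> complex" where
  "kern e u = cnj u * inverse (u * cnj u + of_real (e\<^sup>2))"

lemma kern_denominator: "u * cnj u + complex_of_real (e\<^sup>2) = complex_of_real ((norm u)\<^sup>2 + e\<^sup>2)"
  by (simp only: of_real_add complex_norm_square)

lemma kern_denominator_pos: "e > 0 \<Longrightarrow> (norm u)\<^sup>2 + e\<^sup>2 > 0"
  by (simp add: add_nonneg_pos)

lemma kern_denominator_ne: "e > 0 \<Longrightarrow> u * cnj u + complex_of_real (e\<^sup>2) \<noteq> 0"
  unfolding kern_denominator of_real_eq_0_iff using kern_denominator_pos by force

text \<open>Quotient rule with \<open>D = u * cnj u + e\<^sup>2\<close>: the antiholomorphic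
  derivative is \<open>(D - u * cnj u) / D\<^sup>2\<close>, whose numerator is the constant
  \<open>e\<^sup>2\<close>.\<close>

lemma has_wirtinger_kern:
  assumes "e > 0"
  shows "has_wirtinger (\<lambda>z. kern e (z - w)) (- (kern e (z - w))\<^sup>2)
     (of_real (e\<^sup>2 / ((norm (z - w))\<^sup>2 + e\<^sup>2)\<^sup>2)) z"
proof -
  let ?D = "(z - w) * cnj (z - w) + complex_of_real (e\<^sup>2)"
  note ne = kern_denominator_ne[OF assms, of "z - w"]
  have u: "has_wirtinger (\<lambda>z. z - w) 1 0 z"
    by (rule has_wirtinger_holomorphic) (auto intro!: derivative_eq_intros)
  note cu = has_wirtinger_cnj[OF u]
  show ?thesis unfolding kern_def
  proof (rule has_wirtinger_eq[OF has_wirtinger_mult[OF cu has_wirtinger_inverse[OF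
         has_wirtinger_add[OF has_wirtinger_mult[OF u cu] has_wirtinger_const] ne]]])
    show "cnj (z - w) * (- (((z - w) * cnj 0 + 1 * cnj (z - w)) + 0) * (inverse ?D)\<^sup>2) + cnj 0 * inverse ?D
       = - (cnj (z - w) * inverse ?D)\<^sup>2"
      by (simp add: power2_eq_square algebra_simps)
    have "cnj (z - w) * (- (((z - w) * cnj 1 + 0 * cnj (z - w)) + 0) * (inverse ?D)\<^sup>2) + cnj 1 * inverse ?D
       = complex_of_real (e\<^sup>2) * (inverse ?D)\<^sup>2"
    proof -
      have "inverse ?D = ?D * (inverse ?D)\<^sup>2" using ne by (simp add: power2_eq_square)
      then have "cnj (z - w) * (- (z - w) * (inverse ?D)\<^sup>2) + inverse ?D
         = (?D - (z - w) * cnj (z - w)) * (inverse ?D)\<^sup>2" by (simp only: left_diff_distrib) (simp add: algebra_simps)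
      then show ?thesis by simp
    qed
    also have "\<dots> = of_real (e\<^sup>2 / ((norm (z - w))\<^sup>2 + e\<^sup>2)\<^sup>2)"
      unfolding kern_denominator by (simp add: divide_inverse power_inverse)
    finally show "cnj (z - w) * (- (((z - w) * cnj 1 + 0 * cnj (z - w)) + 0) * (inverse ?D)\<^sup>2) + cnj 1 * inverse ?D
       = of_real (e\<^sup>2 / ((norm (z - w))\<^sup>2 + e\<^sup>2)\<^sup>2)" .
  qed
qed

lemma norm_kern_eq: "norm (kern e u) = norm u / ((norm u)\<^sup>2 + e\<^sup>2)" if "e > 0"
  using kern_denominator_pos[OF that, of u]
  unfolding kern_def kern_denominator by (simp add: norm_mult norm_inverse divide_inverse del: of_real_add of_real_power)

text \<open>Independent of \<open>e\<close>, hence the domination for the limit in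
  \<open>cauchy_pompeiu\<close>; the bound \<open>1 / e\<close> of \<open>norm_kern_le'\<close>
  serves integrability for fixed \<open>e\<close>.\<close>

lemma norm_kern_le: "e > 0 \<Longrightarrow> norm (kern e u) \<le> 1 / norm u"
  using kern_denominator_pos[of e u] by (cases "u = 0") (auto simp: norm_kern_eq field_simps power2_eq_square)

lemma norm_kern_le': "e > 0 \<Longrightarrow> norm (kern e u) \<le> 1 / e"
  using kern_denominator_pos[of e u] sum_squares_bound[of "norm u" e]
    mult_nonneg_nonneg[of "norm u" e]
  by (auto simp: norm_kern_eq field_simps power2_eq_square)

lemma continuous_on_kern: "e > 0 \<Longrightarrow> continuous_on S (\<lambda>z. kern e (z - w))"
  unfolding kern_def by (intro continuous_intros ballI kern_denominator_ne)

lemma tendsto_kern: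
  "(\<lambda>n. kern (1 / real (Suc n)) u) \<longlonglongrightarrow> 1 / u"
proof (cases "u = 0")
  case False
  have "(\<lambda>n. 1 / real (Suc n)) \<longlonglongrightarrow> 0"
    by (rule LIMSEQ_Suc[OF lim_1_over_n])
  then have "(\<lambda>n. cnj u * inverse (u * cnj u + (of_real (1 / real (Suc n)))\<^sup>2)) \<longlonglongrightarrow> cnj u * inverse (u * cnj u + (of_real 0)\<^sup>2)"
    using False by (intro tendsto_intros) auto
  then show ?thesis using False by (simp add: kern_def field_simps)
qed (simp add: kern_def)

section \<open>The Cauchy-Pompeiu formula with one exceptional point\<close>

text \<open>Tailored to \<open>g0\<close> after a cut-off: bounded, possibly without a limit at
  \<open>p\<close>, with derivatives of order \<open>1 / |z - p|\<close>. At \<open>p\<close> itself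
  the bounds on \<open>a\<close> and \<open>b\<close> say nothing, since the factor
  \<open>norm (z - p)\<close> vanishes.\<close>

locale punctured_C1 =
  fixes g a b :: "complex \<Rightarrow> complex" and p :: complex and R M :: real
  assumes wd: "z \<noteq> p \<Longrightarrow> has_wirtinger g (a z) (b z) z"
    and cont: "continuous_on (-{p}) a" "continuous_on (-{p}) b"
    and supp: "norm z > R \<Longrightarrow> g z = 0 \<and> a z = 0 \<and> b z = 0"
    and bound: "norm (g z) \<le> M" "norm (a z) * norm (z - p) \<le> M" "norm (b z) * norm (z - p) \<le> M"
begin

lemma cont_g: "continuous_on (-{p}) g"
  using has_wirtinger_imp_continuous[OF wd] by (auto intro: continuous_at_imp_continuous_on)

lemma meas [measurable]:
  "a \<in> borel_measurable borel" "b \<in> borel_measurable borel" "g \<in> borel_measurable borel"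
  using borel_measurable_punctured cont cont_g by auto

lemma M_nonneg: "M \<ge> 0" using bound(1)[of 0] norm_ge_zero order_trans by blast

lemma norm_le:
  assumes "z \<noteq> p"
  shows "norm (a z) \<le> M * (indicator (cball 0 R) z / norm (z - p))"
    "norm (b z) \<le> M * (indicator (cball 0 R) z / norm (z - p))"
  using bound(2,3)[of z] supp[of z] assms by (auto simp: indicator_def field_simps)

lemma AE_norm_le:
  "AE z in lborel. norm (a z) \<le> M * (indicator (cball 0 R) z / norm (z - p))"
  "AE z in lborel. norm (b z) \<le> M * (indicator (cball 0 R) z / norm (z - p))"
  by (rule eventually_mono[OF AE_lborel_singleton[of p]], erule norm_le)+

lemma integrable: "integrable lborel a" "integrable lborel b"
proof -
  note i = integrable_mult_right[OF integrable_inverse_dist[OF order_refl, of R p], of M]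
  show "integrable lborel a" "integrable lborel b"
    by (rule Bochner_Integration.integrable_bound[OF i];
        use AE_norm_le M_nonneg in \<open>auto simp: abs_mult elim!: eventually_mono\<close>)+
qed

text \<open>Integration by parts: apply \<open>integral_dbar_eq_0\<close> to the product of
  \<open>g\<close> and the regularised kernel.\<close>

lemma integral_times_kern:
  assumes e: "e > 0"
  shows "(\<integral>z. b z * kern e (z - w) \<partial>lborel) =
    - (\<integral>z. g z * of_real (e\<^sup>2 / ((norm (z - w))\<^sup>2 + e\<^sup>2)\<^sup>2) \<partial>lborel)"
proof -
  let ?K = "\<lambda>z. kern e (z - w)" and ?m = "\<lambda>z. complex_of_real (e\<^sup>2 / ((norm (z - w))\<^sup>2 + e\<^sup>2)\<^sup>2)"
  have cK: "continuous_on S ?K" for S using e by (rule continuous_on_kern)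
  have cm: "continuous_on S ?m" for S
    using e by (intro continuous_intros) auto
  have [measurable]: "?K \<in> borel_measurable borel" "?m \<in> borel_measurable borel"
    by (intro borel_measurable_continuous_onI cK cm)+
  have m_le: "norm (?m z) \<le> 1 / e\<^sup>2" for z
  proof -
    have "e\<^sup>2 * e\<^sup>2 \<le> ((norm (z - w))\<^sup>2 + e\<^sup>2)\<^sup>2"
      using mult_mono[of "e\<^sup>2" "(norm (z - w))\<^sup>2 + e\<^sup>2" "e\<^sup>2" "(norm (z - w))\<^sup>2 + e\<^sup>2"] by (simp add: power2_eq_square)
    then show ?thesis using e kern_denominator_pos[OF e, of "z - w"]
      by (simp add: norm_divide norm_power field_simps del: of_real_add of_real_power)
  qed
  have ib: "integrable lborel (\<lambda>z. f z * k z)"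
    if "integrable lborel f" "k \<in> borel_measurable borel" "\<And>z. norm (k z) \<le> B" for f k :: "complex \<Rightarrow> complex" and B
  proof (rule Bochner_Integration.integrable_bound[OF integrable_mult_left[OF that(1), of "of_real B"]])
    show "(\<lambda>z. f z * k z) \<in> borel_measurable lborel" using that(1,2) by auto
    show "AE z in lborel. norm (f z * k z) \<le> norm (f z * of_real B)"
      using that(3) order_trans[OF norm_ge_zero that(3)] by (auto simp: norm_mult intro!: AE_I2 mult_left_mono)
  qed
  have ig: "integrable lborel g"
  proof (rule Bochner_Integration.integrable_bound)
    show "integrable lborel (\<lambda>z. M * indicator (cball 0 R) (z::complex))"
      by (intro integrable_mult_right integrable_real_indicator emeasure_lborel_cball_finite) simp
    show "AE z in lborel. norm (g z) \<le> norm (M * indicat_real (cball 0 R) z)"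
      using bound(1) supp M_nonneg by (auto simp: indicator_def)
  qed simp
  have K2: "norm (- (?K z)\<^sup>2) \<le> (1 / e)\<^sup>2" for z
    using norm_kern_le'[OF e] by (simp only: norm_minus_cancel norm_power) (intro power_mono norm_ge_zero)
  have i: "integrable lborel (\<lambda>z. g z * - (?K z)\<^sup>2 + a z * ?K z)"
     "integrable lborel (\<lambda>z. g z * ?m z + b z * ?K z)"
    by (intro Bochner_Integration.integrable_add ib[OF ig _ K2] ib[OF ig _ m_le]
        ib[OF integrable(1) _ norm_kern_le'[OF e]] ib[OF integrable(2) _ norm_kern_le'[OF e]]; simp)+
  have "(\<integral>z. g z * ?m z + b z * ?K z \<partial>lborel) = 0"
  proof (rule integral_dbar_eq_0[where p = p and R = R and g = "\<lambda>z. g z * ?K z" and a = "\<lambda>z. g z * - (?K z)\<^sup>2 + a z * ?K z"])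
    show "has_wirtinger (\<lambda>z. g z * ?K z) (g z * - (?K z)\<^sup>2 + a z * ?K z) (g z * ?m z + b z * ?K z) z" if "z \<noteq> p" for z
      by (rule has_wirtinger_mult[OF wd[OF that] has_wirtinger_kern[OF e]])
    show "continuous_on (-{p}) (\<lambda>z. g z * - (?K z)\<^sup>2 + a z * ?K z)"
      "continuous_on (-{p}) (\<lambda>z. g z * ?m z + b z * ?K z)"
      by (intro continuous_on_add continuous_on_mult continuous_on_minus continuous_on_power cont cont_g cK cm)+
  qed (use supp i in auto)
  moreover have "integrable lborel (\<lambda>z. g z * ?m z)" "integrable lborel (\<lambda>z. b z * ?K z)"
    by (intro ib[OF ig _ m_le] ib[OF integrable(2) _ norm_kern_le'[OF e]]; simp)+
  ultimately show ?thesis by (simp add: add_eq_0_iff2)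
qed

text \<open>Substitute \<open>z = w + e *\<^sub>R u\<close>. The Jacobian in the plane is
  \<open>e\<^sup>2\<close>, and it removes \<open>e\<close> from the weight.\<close>

lemma integral_mollify:
  assumes e: "e > 0"
  shows "(\<integral>z. g z * of_real (e\<^sup>2 / ((norm (z - w))\<^sup>2 + e\<^sup>2)\<^sup>2) \<partial>lborel)
    = (\<integral>u. g (w + e *\<^sub>R u) * of_real (1 / (1 + (norm u)\<^sup>2)\<^sup>2) \<partial>lborel)"
proof -
  let ?m = "\<lambda>z. complex_of_real (e\<^sup>2 / ((norm (z - w))\<^sup>2 + e\<^sup>2)\<^sup>2)"
  have cm: "continuous_on S ?m" for S
    using e by (intro continuous_intros) auto
  have [measurable]: "?m \<in> borel_measurable borel"
    by (intro borel_measurable_continuous_onI cm)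
  have "(\<integral>z. g z * ?m z \<partial>lborel) =
     (\<integral>z. g z * ?m z \<partial>density (distr lborel borel (\<lambda>x. w + e *\<^sub>R x)) (\<lambda>_. \<bar>e\<bar> ^ DIM(complex)))"
    using e by (subst lborel_affine[of e w]) auto
  also have "\<dots> = (\<integral>z. e\<^sup>2 *\<^sub>R (g z * ?m z) \<partial>distr lborel borel (\<lambda>x. w + e *\<^sub>R x))"
    using e by (subst integral_density) auto
  also have "\<dots> = (\<integral>u. e\<^sup>2 *\<^sub>R (g (w + e *\<^sub>R u) * ?m (w + e *\<^sub>R u)) \<partial>lborel)"
    by (subst integral_distr) auto
  also have "\<dots> = (\<integral>u. g (w + e *\<^sub>R u) * of_real (1 / (1 + (norm u)\<^sup>2)\<^sup>2) \<partial>lborel)"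
  proof (rule Bochner_Integration.integral_cong[OF refl])
    fix u :: complex
    have "e\<^sup>2 * (e\<^sup>2 / ((norm (w + e *\<^sub>R u - w))\<^sup>2 + e\<^sup>2)\<^sup>2) = 1 / (1 + (norm u)\<^sup>2)\<^sup>2"
    proof -
      have "(norm (w + e *\<^sub>R u - w))\<^sup>2 + e\<^sup>2 = e\<^sup>2 * (1 + (norm u)\<^sup>2)"
        by (simp add: power_mult_distrib algebra_simps)
      then show ?thesis using e by (simp add: power_mult_distrib power2_eq_square)
    qed
    then show "e\<^sup>2 *\<^sub>R (g (w + e *\<^sub>R u) * ?m (w + e *\<^sub>R u)) = g (w + e *\<^sub>R u) * of_real (1 / (1 + (norm u)\<^sup>2)\<^sup>2)"
      by (simp only: scaleR_conv_of_real mult.left_commute[of "of_real _" "g _"] of_real_mult[symmetric])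
  qed
  finally show ?thesis .
qed

text \<open>There are two singularities, one of \<open>b\<close> at \<open>p\<close> and one of the
  kernel at \<open>w\<close>. At distance at least \<open>d\<close> they can be separated, with a
  bound uniform in \<open>w\<close>.\<close>

lemma integrable_cauchy_kernel:
  assumes "norm w \<le> Q" "dist w p \<ge> d" "norm p \<le> Q" "d > 0"
  shows "integrable lborel (\<lambda>z. b z / (z - w))"
    and "(\<integral>z. norm (b z / (z - w)) \<partial>lborel) \<le> 2 * M / d * (\<integral>u. indicator (cball 0 (R + Q)) u / norm (u::complex) \<partial>lborel)"
proof -
  let ?h = "\<lambda>z. M / d * (indicator (cball 0 R) z / norm (z - p) + indicator (cball 0 R) z / norm (z - w))"
  have ih: "integrable lborel ?h"
    by (intro integrable_mult_right Bochner_Integration.integrable_add integrable_inverse_dist[OF order_refl])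
  have le: "AE z in lborel. norm (b z / (z - w)) \<le> ?h z"
    using AE_lborel_singleton[of p] AE_lborel_singleton[of w]
  proof eventually_elim
    case (elim z)
    \<comment> \<open>A substitute for partial fractions: multiply
      \<open>d \<le> norm (z - p) + norm (z - w)\<close> by the left-hand side and divide by
      \<open>d\<close>.\<close>
    have "1 / (norm (z - p) * norm (z - w)) \<le> 1 / d * (1 / norm (z - p) + 1 / norm (z - w))"
    proof -
      have "d \<le> norm (z - p) + norm (z - w)"
        using assms(2) dist_triangle[of w p z] by (simp add: dist_norm norm_minus_commute)
      then show ?thesis using elim assms(4) by (simp add: field_simps)
    qed
    then have *: "M * (1 / (norm (z - p) * norm (z - w))) \<le> M * (1 / d * (1 / norm (z - p) + 1 / norm (z - w)))"
      using M_nonneg by (rule mult_left_mono)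
    have "norm (b z / (z - w)) \<le> M * (indicator (cball 0 R) z / norm (z - p)) / norm (z - w)"
      unfolding norm_divide by (intro divide_right_mono norm_le elim norm_ge_zero)
    also have "\<dots> \<le> ?h z" using * by (auto simp: indicator_def)
    finally show ?case .
  qed
  show i: "integrable lborel (\<lambda>z. b z / (z - w))"
  proof (rule Bochner_Integration.integrable_bound[OF ih])
    show "AE z in lborel. norm (b z / (z - w)) \<le> norm (?h z)"
      using le by (rule eventually_mono) (rule order_trans, assumption, simp only: real_norm_def abs_ge_self)
  qed simp
  have "(\<integral>z. norm (b z / (z - w)) \<partial>lborel) \<le> integral\<^sup>L lborel ?h"
    by (rule integral_mono_AE[OF integrable_norm[OF i] ih le])
  also have "\<dots> = M / d * ((\<integral>z. indicator (cball 0 R) z / norm (z - p) \<partial>lborel) + (\<integral>z. indicator (cball 0 R) z / norm (z - w) \<partial>lborel))"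
    by (subst integral_mult_right_zero, subst Bochner_Integration.integral_add)
       (auto intro!: integrable_inverse_dist[OF order_refl])
  also have "\<dots> \<le> M / d * ((\<integral>u. indicator (cball 0 (R + Q)) u / norm (u::complex) \<partial>lborel) + (\<integral>u. indicator (cball 0 (R + Q)) u / norm (u::complex) \<partial>lborel))"
    using assms M_nonneg by (intro mult_left_mono add_mono integral_inverse_dist_le) auto
  finally show "(\<integral>z. norm (b z / (z - w)) \<partial>lborel) \<le> 2 * M / d * (\<integral>u. indicator (cball 0 (R + Q)) u / norm (u::complex) \<partial>lborel)"
    by (simp add: mult_ac)
qed

text \<open>Compact support removes the boundary term. The regularised identity passes to the limit
  on both sides by dominated convergence; the mollified side converges because \<open>g\<close> is
  continuous at \<open>w\<close>, which is where \<open>w \<noteq> p\<close> enters.\<close>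

theorem cauchy_pompeiu:
  assumes "w \<noteq> p"
  shows "(\<integral>z. b z / (z - w) \<partial>lborel) = - pi * g w"
proof -
  let ?e = "\<lambda>n. 1 / real (Suc n)"
  let ?m = "\<lambda>u::complex. complex_of_real (1 / (1 + (norm u)\<^sup>2)\<^sup>2)"
  have e: "?e n > 0" for n by simp
  have ik: "integrable lborel (\<lambda>z. b z / (z - w))"
    using integrable_cauchy_kernel(1)[of w "max (norm w) (norm p)" "dist w p"] assms by simp
  have mk: "(\<lambda>z. kern (?e n) (z - w)) \<in> borel_measurable borel" for n
    by (intro borel_measurable_continuous_onI continuous_on_kern e)
  have "(\<lambda>n. \<integral>z. b z * kern (?e n) (z - w) \<partial>lborel) \<longlonglongrightarrow> (\<integral>z. b z * (1 / (z - w)) \<partial>lborel)"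
  proof (rule integral_dominated_convergence[where w = "\<lambda>z. norm (b z / (z - w))"])
    show "AE z in lborel. (\<lambda>n. b z * kern (?e n) (z - w)) \<longlonglongrightarrow> b z * (1 / (z - w))"
      by (intro AE_I2 tendsto_intros tendsto_kern)
    show "AE z in lborel. norm (b z * kern (?e n) (z - w)) \<le> norm (b z / (z - w))" for n
      using mult_left_mono[OF norm_kern_le[OF e] norm_ge_zero] by (auto simp: norm_mult norm_divide)
    show "(\<lambda>z. b z * kern (?e n) (z - w)) \<in> borel_measurable lborel" for n
      using borel_measurable_times[OF meas(2) mk[of n]] by simp
  qed (use ik in auto)
  moreover have "(\<lambda>n. - (\<integral>u. g (w + ?e n *\<^sub>R u) * ?m u \<partial>lborel)) \<longlonglongrightarrow> - (\<integral>u. g w * ?m u \<partial>lborel)"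
  proof (intro tendsto_minus integral_dominated_convergence[where w = "\<lambda>u. M * (1 / (1 + (norm u)\<^sup>2)\<^sup>2)"])
    show "integrable lborel (\<lambda>u::complex. M * (1 / (1 + (norm u)\<^sup>2)\<^sup>2))"
      by (rule integrable_mult_right[OF integrable_mollifier])
    show "AE u in lborel. (\<lambda>n. g (w + ?e n *\<^sub>R u) * ?m u) \<longlonglongrightarrow> g w * ?m u"
    proof (intro AE_I2 tendsto_mult tendsto_const)
      fix u
      have "(\<lambda>n. w + ?e n *\<^sub>R u) \<longlonglongrightarrow> w + 0 *\<^sub>R u"
        by (intro tendsto_intros LIMSEQ_Suc[OF lim_1_over_n])
      then have "(\<lambda>n. w + ?e n *\<^sub>R u) \<longlonglongrightarrow> w" by simp
      with has_wirtinger_imp_continuous[OF wd[OF assms]]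
      show "(\<lambda>n. g (w + ?e n *\<^sub>R u)) \<longlonglongrightarrow> g w" by (rule isCont_tendsto_compose)
    qed
    show "AE u in lborel. norm (g (w + ?e n *\<^sub>R u) * ?m u) \<le> M * (1 / (1 + (norm u)\<^sup>2)\<^sup>2)" for n
      unfolding norm_mult norm_of_real by (intro AE_I2 mult_mono bound) (auto simp: M_nonneg)
  qed auto
  moreover have "(\<lambda>n. \<integral>z. b z * kern (?e n) (z - w) \<partial>lborel) = (\<lambda>n. - (\<integral>u. g (w + ?e n *\<^sub>R u) * ?m u \<partial>lborel))"
    using integral_times_kern[OF e] integral_mollify[OF e] by auto
  ultimately have "(\<integral>z. b z * (1 / (z - w)) \<partial>lborel) = - (\<integral>u. g w * ?m u \<partial>lborel)"
    using LIMSEQ_unique by force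
  also have "(\<integral>u. g w * ?m u \<partial>lborel) = g w * of_real (\<integral>u. 1 / (1 + (norm (u::complex))\<^sup>2)\<^sup>2 \<partial>lborel)"
    by (simp only: integral_mult_right_zero integral_complex_of_real)
  finally show ?thesis by (simp add: integral_mollifier mult.commute)
qed

end

section \<open>Green's theorem with winding numbers\<close>

lemma
  fixes \<gamma> \<gamma>' :: "real \<Rightarrow> complex"
  assumes der: "\<And>t. t \<in> {0..1} \<Longrightarrow> (\<gamma> has_vector_derivative \<gamma>' t) (at t within {0..1})"
    and cont: "continuous_on {0..1} \<gamma>'"
  shows valid_path_C1: "valid_path \<gamma>"
    and contour_integral_C1: "continuous_on (path_image \<gamma>) f \<Longrightarrow>
      contour_integral \<gamma> f = (LINT t:{0..1}|lborel. f (\<gamma> t) * \<gamma>' t)"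
proof -
  have cg: "continuous_on {0..1} \<gamma>"
    using der by (rule continuous_on_vector_derivative)
  \<comment> \<open>At the end points only a one-sided derivative is known, so they become the
    finite exceptional set of a piecewise C1 path.\<close>
  have "\<gamma> C1_differentiable_on ({0..1} - {0, 1})"
    unfolding C1_differentiable_on_def
  proof (intro exI conjI ballI)
    show "(\<gamma> has_vector_derivative \<gamma>' t) (at t)" if "t \<in> {0..1} - {0, 1}" for t
    proof -
      have "at t within {0..1} = at t"
        using that by (intro at_within_interior) auto
      then show ?thesis using der[of t] that by simp
    qed
    show "continuous_on ({0..1} - {0, 1}) \<gamma>'" by (rule continuous_on_subset[OF cont]) auto
  qed
  then show "valid_path \<gamma>"
    unfolding valid_path_def piecewise_C1_differentiable_on_def using cg by (intro conjI exI[of _ "{0, 1}"]) auto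
  assume f: "continuous_on (path_image \<gamma>) f"
  have c: "continuous_on {0..1} (\<lambda>t. f (\<gamma> t) * \<gamma>' t)"
    by (rule continuous_on_mult[OF continuous_on_compose2[OF f cg] cont]) (auto simp: path_image_def)
  have "contour_integral \<gamma> f = integral {0..1} (\<lambda>t. f (\<gamma> t) * vector_derivative \<gamma> (at t within {0..1}))"
    by (simp add: contour_integral_def integral_def has_contour_integral_def contour_integrable_on_def integrable_on_def)
  also have "\<dots> = integral {0..1} (\<lambda>t. f (\<gamma> t) * \<gamma>' t)"
    by (intro integral_cong) (use der in \<open>simp add: vector_derivative_within_cbox[of 0 1, simplified]\<close>)
  also have "\<dots> = (LINT t:{0..1}|lborel. f (\<gamma> t) * \<gamma>' t)"
    using set_borel_integral_eq_integral(2)[OF borel_integrable_atLeastAtMost'[OF c]] by simp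
  finally show "contour_integral \<gamma> f = (LINT t:{0..1}|lborel. f (\<gamma> t) * \<gamma>' t)" .
qed

text \<open>A merely continuous curve could have positive area. Differentiability makes the image
  negligible, and compactness makes it Borel, so that it is a null set of \<open>lborel\<close>
  itself.\<close>

lemma AE_not_in_C1_path:
  fixes \<gamma> \<gamma>' :: "real \<Rightarrow> complex"
  assumes der: "\<And>t. t \<in> {0..1} \<Longrightarrow> (\<gamma> has_vector_derivative \<gamma>' t) (at t within {0..1})"
  shows "AE z in lborel. z \<notin> path_image \<gamma>"
proof -
  have cg: "continuous_on {0..1} \<gamma>"
    using der by (rule continuous_on_vector_derivative)
  have "\<gamma> differentiable_on {0..1}"
    unfolding differentiable_on_def differentiable_def using der has_vector_derivative_def by blast
  then have "negligible (\<gamma> ` {0..1})"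
    by (intro negligible_differentiable_image_lowdim) auto
  moreover have "\<gamma> ` {0..1} \<in> sets lborel"
    using compact_continuous_image[OF cg] by (simp add: borel_compact)
  ultimately have "\<gamma> ` {0..1} \<in> null_sets lborel"
    by (simp add: negligible_iff_null_sets null_sets_completion_iff)
  then show ?thesis unfolding path_image_def by (rule AE_not_in)
qed

context punctured_C1
begin

text \<open>With the Cauchy-Pompeiu formula inserted for \<open>g\<close>, the inner integral over
  the curve becomes \<open>- b z\<close> times \<open>2 * pi * \<i>\<close> times the winding number
  about \<open>z\<close>. Dividing by \<open>- pi\<close> leaves the factor
  \<open>2 * \<i> * c\<close>.\<close>

theorem green_winding:
  fixes \<gamma> \<gamma>' :: "real \<Rightarrow> complex"
  assumes der: "\<And>t. t \<in> {0..1} \<Longrightarrow> (\<gamma> has_vector_derivative \<gamma>' t) (at t within {0..1})"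
    and contd: "continuous_on {0..1} \<gamma>'"
    and p: "p \<notin> path_image \<gamma>"
    and \<Omega>: "\<Omega> \<in> sets borel"
    and wn: "\<And>z. z \<notin> path_image \<gamma> \<Longrightarrow> winding_number \<gamma> z = c * indicator \<Omega> z"
  shows "contour_integral \<gamma> g = 2 * \<i> * c * (LINT z:\<Omega>|lborel. b z)"
proof -
  have cg: "continuous_on {0..1} \<gamma>"
    using der by (rule continuous_on_vector_derivative)
  note CI = contour_integral_C1[OF der contd]
  have AEz: "AE z in lborel. z \<notin> path_image \<gamma>" using der by (rule AE_not_in_C1_path)
  have cpi: "compact (path_image \<gamma>)" unfolding path_image_def by (rule compact_continuous_image[OF cg]) simp
  \<comment> \<open>The distance \<open>d\<close> from \<open>p\<close> and the radius
    \<open>Q\<close> make the bound \<open>?J\<close> below the same for all points of the curve, as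
    Fubini requires.\<close>
  define d where "d = setdist {p} (path_image \<gamma>)"
  have ne: "path_image \<gamma> \<noteq> {}" by (auto simp: path_image_def)
  have d: "d > 0" unfolding d_def
    using setdist_eq_0_sing_1[of p "path_image \<gamma>"] p ne cpi setdist_pos_le[of "{p}" "path_image \<gamma>"]
    by (auto simp: compact_imp_closed less_le)
  have dd: "dist (\<gamma> t) p \<ge> d" if "t \<in> {0..1}" for t
    unfolding d_def dist_commute[of "\<gamma> t"] using that by (intro setdist_le_dist) (auto simp: path_image_def)
  obtain Q0 where Q0: "\<And>t. t \<in> {0..1} \<Longrightarrow> norm (\<gamma> t) \<le> Q0"
    using compact_imp_bounded[OF cpi] unfolding bounded_iff path_image_def by blast
  define Q where "Q = max Q0 (norm p)"
  have Q: "norm (\<gamma> t) \<le> Q" if "t \<in> {0..1}" for t using Q0[OF that] by (simp add: Q_def)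
  have Qp: "norm p \<le> Q" by (simp add: Q_def)
  \<comment> \<open>Extension by zero makes the integrand jointly measurable on the whole product;
    outside the unit interval \<open>v\<close> kills it.\<close>
  define u where "u = (\<lambda>t. indicat_real {0..1} t *\<^sub>R \<gamma> t)"
  define v where "v = (\<lambda>t. indicat_real {0..1} t *\<^sub>R \<gamma>' t)"
  have [measurable]: "u \<in> borel_measurable borel" "v \<in> borel_measurable borel"
    unfolding u_def v_def by (intro borel_measurable_continuous_on_indicator cg contd; simp)+
  have uv: "u t = \<gamma> t" "v t = \<gamma>' t" if "t \<in> {0..1}" for t
    using that by (simp_all add: u_def v_def)
  have v0: "v t = 0" if "t \<notin> {0..1}" for t using that by (simp add: v_def)
  have iv: "integrable lborel v"
    using borel_integrable_atLeastAtMost'[OF contd] by (simp add: v_def set_integrable_def)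
  let ?J = "2 * M / d * (\<integral>u. indicator (cball 0 (R + Q)) u / norm (u::complex) \<partial>lborel)"
  define H where "H = (\<lambda>t z. b z / (z - u t) * v t)"
  have mH: "(\<lambda>(t, z). H t z) \<in> borel_measurable (lborel \<Otimes>\<^sub>M lborel)"
    unfolding H_def by measurable
  have Hi: "integrable lborel (H t)" for t
  proof (cases "t \<in> {0..1}")
    case True
    show ?thesis unfolding H_def uv[OF True]
      by (rule integrable_mult_left[OF integrable_cauchy_kernel(1)[OF Q[OF True] dd[OF True] Qp d]])
  qed (simp add: H_def v0)
  have Hle: "(\<integral>z. norm (H t z) \<partial>lborel) \<le> ?J * norm (v t)" for t
  proof (cases "t \<in> {0..1}")
    case True
    have "(\<integral>z. norm (H t z) \<partial>lborel) = (\<integral>z. norm (b z / (z - \<gamma> t)) \<partial>lborel) * norm (v t)"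
      unfolding H_def norm_mult uv(1)[OF True] by (rule integral_mult_left_zero)
    also have "\<dots> \<le> ?J * norm (v t)"
      by (intro mult_right_mono integrable_cauchy_kernel(2)[OF Q[OF True] dd[OF True] Qp d] norm_ge_zero)
    finally show ?thesis .
  qed (simp add: H_def v0)
  have HI: "integrable (lborel \<Otimes>\<^sub>M lborel) (\<lambda>(t, z). H t z)"
  proof (rule lborel_pair.Fubini_integrable[OF mH])
    show "integrable lborel (\<lambda>t. \<integral>z. norm (case (t, z) of (t, z) \<Rightarrow> H t z) \<partial>lborel)"
    proof (rule Bochner_Integration.integrable_bound)
      show "integrable lborel (\<lambda>t. ?J * norm (v t))" by (intro integrable_mult_right integrable_norm iv)
      have "(\<lambda>(t, z). norm (H t z)) \<in> borel_measurable (lborel \<Otimes>\<^sub>M lborel)"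
        unfolding H_def by measurable
      then show "(\<lambda>t. \<integral>z. norm (case (t, z) of (t, z) \<Rightarrow> H t z) \<partial>lborel) \<in> borel_measurable lborel"
        using lborel.borel_measurable_lebesgue_integral by simp
      show "AE t in lborel. norm (\<integral>z. norm (case (t, z) of (t, z) \<Rightarrow> H t z) \<partial>lborel) \<le> norm (?J * norm (v t))"
      proof (rule AE_I2)
        fix t
        have "0 \<le> (\<integral>z. norm (H t z) \<partial>lborel)" by simp
        with Hle[of t] show "norm (\<integral>z. norm (case (t, z) of (t, z) \<Rightarrow> H t z) \<partial>lborel) \<le> norm (?J * norm (v t))"
          by (simp only: prod.case real_norm_def)
      qed
    qed
  qed (simp add: Hi)
  have "(\<integral>t. (\<integral>z. H t z \<partial>lborel) \<partial>lborel) = (\<integral>t. - pi * (indicator {0..1} t *\<^sub>R (g (\<gamma> t) * \<gamma>' t)) \<partial>lborel)"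
  proof (rule Bochner_Integration.integral_cong[OF refl])
    fix t :: real
    show "(\<integral>z. H t z \<partial>lborel) = - pi * (indicator {0..1} t *\<^sub>R (g (\<gamma> t) * \<gamma>' t))"
    proof (cases "t \<in> {0..1}")
      case True
      then have "\<gamma> t \<noteq> p" using p by (auto simp: path_image_def)
      then have "(\<integral>z. H t z \<partial>lborel) = - pi * g (\<gamma> t) * \<gamma>' t"
        unfolding H_def uv[OF True] by (subst integral_mult_left_zero, subst cauchy_pompeiu) simp_all
      then show ?thesis using True by simp
    qed (simp add: H_def v0)
  qed
  also have "\<dots> = - pi * contour_integral \<gamma> g"
  proof -
    have "continuous_on (path_image \<gamma>) g"
      by (rule continuous_on_subset[OF cont_g]) (use p in auto)
    then show ?thesis
      by (simp only: CI set_lebesgue_integral_def integral_mult_right_zero)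
  qed
  finally have L: "(\<integral>t. (\<integral>z. H t z \<partial>lborel) \<partial>lborel) = - pi * contour_integral \<gamma> g" .
  \<comment> \<open>The other order. Off the null set \<open>path_image \<gamma>\<close> the inner
    integral is a winding number; the sign comes from \<open>z - \<gamma> t\<close> against
    \<open>\<gamma> t - z\<close>.\<close>
  have "(\<integral>z. (\<integral>t. H t z \<partial>lborel) \<partial>lborel) = (\<integral>z. - (2 * pi * \<i> * c) * (indicator \<Omega> z *\<^sub>R b z) \<partial>lborel)"
  proof (rule integral_cong_AE)
    show "AE z in lborel. (\<integral>t. H t z \<partial>lborel) = - (2 * pi * \<i> * c) * (indicator \<Omega> z *\<^sub>R b z)"
      using AEz
    proof (eventually_elim)
      case (elim z)
      have "(\<integral>t. H t z \<partial>lborel) = (\<integral>t. - b z * (indicator {0..1} t *\<^sub>R (1 / (\<gamma> t - z) * \<gamma>' t)) \<partial>lborel)"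
      proof (rule Bochner_Integration.integral_cong[OF refl])
        fix t :: real
        show "H t z = - b z * (indicator {0..1} t *\<^sub>R (1 / (\<gamma> t - z) * \<gamma>' t))"
        proof (cases "t \<in> {0..1}")
          case True
          have "H t z = b z / (- (\<gamma> t - z)) * \<gamma>' t" using True by (simp add: H_def uv)
          also have "\<dots> = - b z * (1 / (\<gamma> t - z) * \<gamma>' t)" by (simp only: divide_minus_right) simp
          finally show ?thesis using True by simp
        qed (simp add: H_def v0)
      qed
      also have "\<dots> = - b z * contour_integral \<gamma> (\<lambda>w. 1 / (w - z))"
      proof -
        have "continuous_on (path_image \<gamma>) (\<lambda>w. 1 / (w - z))"
          using elim by (intro continuous_intros) auto
        then show ?thesis
          by (simp only: CI set_lebesgue_integral_def integral_mult_right_zero)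
      qed
      also have "contour_integral \<gamma> (\<lambda>w. 1 / (w - z)) = 2 * pi * \<i> * winding_number \<gamma> z"
        using winding_number_valid_path[OF valid_path_C1[OF der contd] elim] by simp
      finally show ?case by (simp add: wn[OF elim] scaleR_conv_of_real mult_ac indicator_def)
    qed
    have "(\<lambda>(z, t). H t z) \<in> borel_measurable (lborel \<Otimes>\<^sub>M lborel)"
      unfolding H_def by measurable
    then show "(\<lambda>z. \<integral>t. H t z \<partial>lborel) \<in> borel_measurable lborel"
      by (rule lborel.borel_measurable_lebesgue_integral)
    show "(\<lambda>z. - (2 * pi * \<i> * c) * (indicator \<Omega> z *\<^sub>R b z)) \<in> borel_measurable lborel"
      using \<Omega> by measurable
  qed
  also have "\<dots> = - (2 * pi * \<i> * c) * (LINT z:\<Omega>|lborel. b z)"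
    unfolding set_lebesgue_integral_def by (rule integral_mult_right_zero)
  finally have "- pi * contour_integral \<gamma> g = - (2 * pi * \<i> * c) * (LINT z:\<Omega>|lborel. b z)"
    using lborel_pair.Fubini_integral[of H, OF HI] L by simp
  then have "pi * contour_integral \<gamma> g = pi * (2 * \<i> * c * (LINT z:\<Omega>|lborel. b z))"
    by (simp add: mult_ac)
  then show ?thesis by simp
qed

end

section \<open>Functions with an isolated singularity\<close>

lemma has_wirtinger_sum:
  assumes "finite I" "\<And>i. i \<in> I \<Longrightarrow> has_wirtinger (f i) (a i) (b i) z"
  shows "has_wirtinger (\<lambda>z. \<Sum>i\<in>I. f i z) (\<Sum>i\<in>I. a i) (\<Sum>i\<in>I. b i) z"
  using assms by (induction I rule: finite_induct) (auto intro!: has_wirtinger_add has_wirtinger_const)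

lemma has_wirtinger_diff:
  "has_wirtinger f a b z \<Longrightarrow> has_wirtinger g c d z \<Longrightarrow> has_wirtinger (\<lambda>z. f z - g z) (a - c) (b - d) z"
  unfolding has_wirtinger_def by (drule (1) has_derivative_diff) (simp add: algebra_simps)

lemma has_wirtinger_transform_open:
  assumes "has_wirtinger f a b z" "open U" "z \<in> U" "\<And>w. w \<in> U \<Longrightarrow> f w = g w"
  shows "has_wirtinger g a b z"
  using assms unfolding has_wirtinger_def by (rule has_derivative_transform_within_open)

text \<open>Squaring smooths the corner of the truncation at 0, which is enough for a C1
  cut-off.\<close>

lemma has_real_derivative_max_0_square:
  "((\<lambda>x::real. (max 0 x)\<^sup>2) has_real_derivative 2 * max 0 x) (at x)"
proof (cases "x = 0")
  case True
  have "((\<lambda>y::real. (max 0 y)\<^sup>2 / y) \<longlongrightarrow> 0) (at 0)"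
  proof (rule Lim_null_comparison)
    show "\<forall>\<^sub>F y in at 0. norm ((max 0 y)\<^sup>2 / y) \<le> \<bar>y\<bar>"
      by (rule always_eventually) (auto simp: max_def power2_eq_square)
    show "((\<lambda>y::real. \<bar>y\<bar>) \<longlongrightarrow> 0) (at 0)" by (intro tendsto_rabs_zero tendsto_ident_at)
  qed
  then show ?thesis using True by (simp add: DERIV_def)
next
  case False
  then consider "x > 0" | "x < 0" by linarith
  then show ?thesis
  proof cases
    case 1
    have "((\<lambda>x::real. x\<^sup>2) has_real_derivative 2 * x) (at x)" by (auto intro!: derivative_eq_intros)
    then have "((\<lambda>x::real. (max 0 x)\<^sup>2) has_real_derivative 2 * x) (at x)"
      by (rule has_field_derivative_transform_within_open[of _ _ _ "{0<..}"]) (use 1 in auto)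
    then show ?thesis using 1 by simp
  next
    case 2
    have "((\<lambda>x::real. 0) has_real_derivative 0) (at x)" by simp
    then have "((\<lambda>x::real. (max 0 x)\<^sup>2) has_real_derivative 0) (at x)"
      by (rule has_field_derivative_transform_within_open[of _ _ _ "{..<0}"]) (use 2 in auto)
    then show ?thesis using 2 by simp
  qed
qed

lemma has_wirtinger_norm_square:
  "has_wirtinger (\<lambda>z. complex_of_real ((norm (z - c))\<^sup>2)) (cnj (z - c)) (z - c) z"
proof -
  have u: "has_wirtinger (\<lambda>z. z - c) 1 0 z"
    by (rule has_wirtinger_holomorphic) (auto intro!: derivative_eq_intros)
  from has_wirtinger_mult[OF u has_wirtinger_cnj[OF u]] show ?thesis
    unfolding complex_norm_square by simp
qed

section \<open>Cut-off functions\<close>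

text \<open>Finitely many discs cover \<open>K\<close>. A sum of squared truncated paraboloids over
  these discs is positive on \<open>K\<close> and zero off them; a second truncation flattens it to
  1 on \<open>K\<close>. The derivatives on \<open>K\<close> are listed because \<open>K\<close>
  need not be open.\<close>

lemma C1_cutoff:
  fixes S K :: "complex set"
  assumes "open S" "compact K" "K \<subseteq> S"
  obtains \<eta> :: "complex \<Rightarrow> real" and xa xb L where
    "compact L" "L \<subseteq> S" "\<And>z. has_wirtinger (\<lambda>z. complex_of_real (\<eta> z)) (xa z) (xb z) z"
    "continuous_on UNIV \<eta>" "continuous_on UNIV xa" "continuous_on UNIV xb"
    "\<And>z. z \<notin> L \<Longrightarrow> \<eta> z = 0" "\<And>z. z \<notin> L \<Longrightarrow> xa z = 0" "\<And>z. z \<notin> L \<Longrightarrow> xb z = 0"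
    "\<And>z. z \<in> K \<Longrightarrow> \<eta> z = 1" "\<And>z. z \<in> K \<Longrightarrow> xa z = 0" "\<And>z. z \<in> K \<Longrightarrow> xb z = 0"
proof -
  have "\<exists>r>0. cball z r \<subseteq> S" if "z \<in> K" for z
    using assms that open_contains_cball by blast
  then obtain r where r: "\<And>z. z \<in> K \<Longrightarrow> r z > 0 \<and> cball z (r z) \<subseteq> S" by metis
  have "K \<subseteq> (\<Union>z\<in>K. ball z (r z))" using r by force
  then obtain I where I: "I \<subseteq> K" "finite I" "K \<subseteq> (\<Union>z\<in>I. ball z (r z))"
    using compactE_image[OF assms(2), of K "\<lambda>z. ball z (r z)"] by auto
  define L where "L = (\<Union>z\<in>I. cball z (r z))"
  let ?t = "\<lambda>c z. max 0 ((r c)\<^sup>2 - (norm (z - c))\<^sup>2)"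
  define P where "P = (\<lambda>z. \<Sum>c\<in>I. (?t c z)\<^sup>2)"
  define PA where "PA = (\<lambda>z. \<Sum>c\<in>I. of_real (2 * ?t c z) * (0 - cnj (z - c)))"
  define PB where "PB = (\<lambda>z. \<Sum>c\<in>I. of_real (2 * ?t c z) * (0 - (z - c)))"
  have t0: "?t c z = 0" if "z \<notin> L" "c \<in> I" for c z
  proof -
    have "r c < norm (z - c)" using that by (force simp: L_def dist_norm norm_minus_commute)
    moreover have "r c > 0" using r I that by blast
    ultimately have "(r c)\<^sup>2 \<le> (norm (z - c))\<^sup>2" by (intro power_mono) auto
    then show ?thesis by simp
  qed
  have P0: "P z = 0" "PA z = 0" "PB z = 0" if "z \<notin> L" for z
    using t0[OF that] by (simp_all add: P_def PA_def PB_def)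
  have wP: "has_wirtinger (\<lambda>z. complex_of_real (P z)) (PA z) (PB z) z" for z
  proof -
    have 1: "has_wirtinger (\<lambda>z. complex_of_real ((r c)\<^sup>2 - (norm (z - c))\<^sup>2)) (0 - cnj (z - c)) (0 - (z - c)) z" for c
      unfolding of_real_diff by (rule has_wirtinger_diff[OF has_wirtinger_const has_wirtinger_norm_square])
    show ?thesis
      unfolding P_def PA_def PB_def of_real_sum
      by (rule has_wirtinger_sum[OF I(2) has_wirtinger_real_compose[OF 1 has_real_derivative_max_0_square]])
  qed
  have cP: "continuous_on UNIV P" "continuous_on UNIV PA" "continuous_on UNIV PB"
    unfolding P_def PA_def PB_def by (intro continuous_intros)+
  have Ppos: "P z > 0" if z: "z \<in> K" for z
  proof -
    obtain c where c: "c \<in> I" "z \<in> ball c (r c)" using I(3) z by blast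
    then have "norm (z - c) < r c" by (simp add: dist_norm norm_minus_commute)
    then have "(norm (z - c))\<^sup>2 < (r c)\<^sup>2" by (intro power_strict_mono) auto
    then have "0 < (?t c z)\<^sup>2" by simp
    also have "\<dots> \<le> P z" unfolding P_def by (rule member_le_sum[OF c(1)]) (use I in auto)
    finally show ?thesis .
  qed
  obtain \<delta> where \<delta>: "\<delta> > 0" "\<And>z. z \<in> K \<Longrightarrow> \<delta> \<le> P z"
  proof (cases "K = {}")
    case False
    then obtain z0 where "z0 \<in> K" "\<And>z. z \<in> K \<Longrightarrow> P z0 \<le> P z"
      using continuous_attains_inf[OF assms(2) False continuous_on_subset[OF cP(1)]] by auto
    then show ?thesis using that Ppos by blast
  qed (use that[of 1] in auto)
  define s where "s = (\<lambda>z. 1 - P z / \<delta>)"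
  \<comment> \<open>Where \<open>P z \<ge> \<delta>\<close>, in particular on \<open>K\<close>, the
    truncated term and its derivative vanish; where \<open>P z = 0\<close>, \<open>s z = 1\<close>
    and the value is 0.\<close>
  define \<eta> where "\<eta> = (\<lambda>z. 1 - (max 0 (s z))\<^sup>2)"
  define xa where "xa = (\<lambda>z. 0 - of_real (2 * max 0 (s z)) * (0 - PA z * of_real (1 / \<delta>)))"
  define xb where "xb = (\<lambda>z. 0 - of_real (2 * max 0 (s z)) * (0 - PB z * of_real (1 / \<delta>)))"
  have ws: "has_wirtinger (\<lambda>z. complex_of_real (s z)) (0 - PA z * of_real (1 / \<delta>)) (0 - PB z * of_real (1 / \<delta>)) z" for z
  proof -
    have "has_wirtinger (\<lambda>z. 1 - complex_of_real (P z) * of_real (1 / \<delta>)) (0 - (of_real (P z) * 0 + PA z * of_real (1 / \<delta>)))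
       (0 - (of_real (P z) * 0 + PB z * of_real (1 / \<delta>))) z"
      by (intro has_wirtinger_diff has_wirtinger_const has_wirtinger_mult wP)
    then show ?thesis by (simp add: s_def)
  qed
  have w\<eta>: "has_wirtinger (\<lambda>z. complex_of_real (\<eta> z)) (xa z) (xb z) z" for z
  proof -
    have "has_wirtinger (\<lambda>z. 1 - complex_of_real ((max 0 (s z))\<^sup>2)) (xa z) (xb z) z"
      unfolding xa_def xb_def
      by (rule has_wirtinger_diff[OF has_wirtinger_const has_wirtinger_real_compose[OF ws has_real_derivative_max_0_square]])
    then show ?thesis by (simp only: \<eta>_def of_real_diff of_real_1)
  qed
  have cs: "continuous_on UNIV s" unfolding s_def using \<delta>(1) by (intro continuous_intros cP) auto
  have cx: "continuous_on UNIV \<eta>" "continuous_on UNIV xa" "continuous_on UNIV xb"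
    unfolding \<eta>_def xa_def xb_def by (intro continuous_intros cP cs)+
  have sK: "max 0 (s z) = 0" if "z \<in> K" for z using \<delta>(2)[OF that] \<delta>(1) by (simp add: s_def)
  show ?thesis
  proof (rule that[OF _ _ w\<eta> cx])
    show "compact L" unfolding L_def by (rule compact_UN[OF I(2)]) simp
    show "L \<subseteq> S" unfolding L_def using I(1) r by blast
  qed (use P0 sK in \<open>simp_all add: \<eta>_def xa_def xb_def s_def del: max.absorb1 max.absorb2\<close>)
qed

section \<open>A calculus of functions with a tame singularity\<close>

definition bounded_near :: "complex \<Rightarrow> (complex \<Rightarrow> complex) \<Rightarrow> bool" where
  "bounded_near p F \<longleftrightarrow> (\<exists>r>0. \<exists>M. \<forall>z\<in>ball p r - {p}. norm (F z) \<le> M)"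

text \<open>The local form of \<open>punctured_C1\<close>: the same growth at \<open>p\<close>, but
  on an open set and without compact support. \<open>tame_extend\<close> passes from one to the
  other.\<close>

definition tame :: "complex set \<Rightarrow> complex \<Rightarrow> (complex \<Rightarrow> complex) \<Rightarrow> (complex \<Rightarrow> complex) \<Rightarrow> (complex \<Rightarrow> complex) \<Rightarrow> bool" where
  "tame S p f a b \<longleftrightarrow> (\<forall>z\<in>S-{p}. has_wirtinger f (a z) (b z) z) \<and>
     continuous_on (S - {p}) a \<and> continuous_on (S - {p}) b \<and>
     bounded_near p f \<and> bounded_near p (\<lambda>z. a z * (z - p)) \<and> bounded_near p (\<lambda>z. b z * (z - p))"

lemma tame_continuous_on: "tame S p f a b \<Longrightarrow> open S \<Longrightarrow> continuous_on (S - {p}) f"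
  unfolding tame_def using has_wirtinger_imp_continuous by (blast intro: continuous_at_imp_continuous_on)

lemma bounded_punctured_compact:
  assumes "continuous_on (S - {p}) F" "compact L" "L \<subseteq> S" "bounded_near p F"
  shows "\<exists>B. \<forall>z\<in>L - {p}. norm (F z) \<le> B"
proof -
  obtain r M where r: "r > 0" "\<And>z. z \<in> ball p r - {p} \<Longrightarrow> norm (F z) \<le> M"
    using assms(4) unfolding bounded_near_def by blast
  have "compact (L - ball p r)" using assms(2) by (simp add: compact_diff)
  moreover have "continuous_on (L - ball p r) F"
    by (rule continuous_on_subset[OF assms(1)]) (use assms(3) r in auto)
  ultimately have "bounded (F ` (L - ball p r))" by (intro compact_imp_bounded compact_continuous_image)
  then obtain B where B: "\<And>z. z \<in> L - ball p r \<Longrightarrow> norm (F z) \<le> B" unfolding bounded_iff by blast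
  have "norm (F z) \<le> max M B" if "z \<in> L - {p}" for z
    using r(2)[of z] B[of z] that by (cases "z \<in> ball p r") (auto simp: le_max_iff_disj)
  then show ?thesis by blast
qed

text \<open>Multiplication by a cut-off that is 1 with vanishing derivatives on \<open>K\<close>
  changes neither \<open>g\<close> nor its antiholomorphic derivative there, while extension by zero
  gives a function on the whole plane.\<close>

lemma tame_extend:
  assumes tame: "tame S p g a b" and "open S" "compact K" "K \<subseteq> S"
  obtains g2 a2 b2 R M where "punctured_C1 g2 a2 b2 p R M"
    "\<And>z. z \<in> K \<Longrightarrow> g2 z = g z" "\<And>z. z \<in> K \<Longrightarrow> b2 z = b z"
proof -
  obtain \<eta> :: "complex \<Rightarrow> real" and xa xb L where L: "compact L" "L \<subseteq> S"
    and w\<eta>: "\<And>z. has_wirtinger (\<lambda>z. complex_of_real (\<eta> z)) (xa z) (xb z) z"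
    and c: "continuous_on UNIV \<eta>" "continuous_on UNIV xa" "continuous_on UNIV xb"
    and o: "\<And>z. z \<notin> L \<Longrightarrow> \<eta> z = 0" "\<And>z. z \<notin> L \<Longrightarrow> xa z = 0" "\<And>z. z \<notin> L \<Longrightarrow> xb z = 0"
    and i: "\<And>z. z \<in> K \<Longrightarrow> \<eta> z = 1" "\<And>z. z \<in> K \<Longrightarrow> xa z = 0" "\<And>z. z \<in> K \<Longrightarrow> xb z = 0"
    by (rule C1_cutoff[OF assms(2-4)]) (rule that)
  have ca: "continuous_on (S - {p}) a" and cb: "continuous_on (S - {p}) b"
    and wd: "\<And>z. z \<in> S - {p} \<Longrightarrow> has_wirtinger g (a z) (b z) z"
    using tame unfolding tame_def by auto
  note cg = tame_continuous_on[OF tame \<open>open S\<close>]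
  let ?X = "\<lambda>z. complex_of_real (\<eta> z)"
  let ?g = "\<lambda>z. ?X z * g z"
  let ?a = "\<lambda>z. ?X z * a z + xa z * g z"
  let ?b = "\<lambda>z. ?X z * b z + xb z * g z"
  have bd: "bounded (F ` L)" if "continuous_on UNIV F" for F :: "complex \<Rightarrow> complex"
    by (intro compact_imp_bounded compact_continuous_image L continuous_on_subset[OF that]) auto
  have r: "bounded_near p g" "bounded_near p (\<lambda>z. a z * (z - p))" "bounded_near p (\<lambda>z. b z * (z - p))"
    using tame unfolding tame_def by auto
  have ca': "continuous_on (S - {p}) (\<lambda>z. a z * (z - p))" and cb': "continuous_on (S - {p}) (\<lambda>z. b z * (z - p))"
    by (intro continuous_intros ca cb)+
  obtain G where G: "\<forall>z\<in>L - {p}. norm (g z) \<le> G"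
    using bounded_punctured_compact[OF cg L r(1)] by blast
  obtain A where A: "\<forall>z\<in>L - {p}. norm (a z * (z - p)) \<le> A"
    using bounded_punctured_compact[OF ca' L r(2)] by blast
  obtain B where B: "\<forall>z\<in>L - {p}. norm (b z * (z - p)) \<le> B"
    using bounded_punctured_compact[OF cb' L r(3)] by blast
  obtain X XA XB where X: "\<forall>z\<in>L. norm (?X z) \<le> X" and XA: "\<forall>z\<in>L. norm (xa z * (z - p)) \<le> XA"
    and XB: "\<forall>z\<in>L. norm (xb z * (z - p)) \<le> XB"
  proof -
    have "bounded (?X ` L)" "bounded ((\<lambda>z. xa z * (z - p)) ` L)" "bounded ((\<lambda>z. xb z * (z - p)) ` L)"
      by (intro bd continuous_intros c)+
    then show ?thesis using that unfolding bounded_iff by auto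
  qed
  obtain R where R: "\<And>z. z \<in> L \<Longrightarrow> norm z \<le> R" using compact_imp_bounded[OF L(1)] unfolding bounded_iff by blast
  \<comment> \<open>The value of \<open>g\<close> at \<open>p\<close> is not controlled by
    \<open>bounded_near\<close>, so it enters separately; the products are the bounds from the
    product rule.\<close>
  define M where "M = norm (?g p) + \<bar>X\<bar> * \<bar>G\<bar> + \<bar>X\<bar> * \<bar>A\<bar> + \<bar>X\<bar> * \<bar>B\<bar> + \<bar>XA\<bar> * \<bar>G\<bar> + \<bar>XB\<bar> * \<bar>G\<bar>"
  have nn: "0 \<le> \<bar>X\<bar> * \<bar>G\<bar>" "0 \<le> \<bar>X\<bar> * \<bar>A\<bar>" "0 \<le> \<bar>X\<bar> * \<bar>B\<bar>" "0 \<le> \<bar>XA\<bar> * \<bar>G\<bar>" "0 \<le> \<bar>XB\<bar> * \<bar>G\<bar>" by simp_all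
  have M0: "M \<ge> 0" unfolding M_def using nn norm_ge_zero[of "?g p"] by linarith
  have mm: "norm x * norm y \<le> \<bar>B1\<bar> * \<bar>B2\<bar>" if "norm x \<le> B1" "norm y \<le> B2" for x y :: complex and B1 B2
    using that by (intro mult_mono) auto
  have "punctured_C1 ?g ?a ?b p R M"
  proof
    fix z
    show "has_wirtinger ?g (?a z) (?b z) z" if "z \<noteq> p"
    proof (cases "z \<in> L")
      case True
      then show ?thesis using L that by (intro has_wirtinger_mult w\<eta> wd) auto
    next
      case False
      have "has_wirtinger ?g 0 0 z"
        by (rule has_wirtinger_transform_open[OF has_wirtinger_const[of 0], of "-L"])
           (use False o L in \<open>auto simp: compact_imp_closed open_Compl\<close>)
      then show ?thesis using o[OF False] by simp
    qed
    show "?g z = 0 \<and> ?a z = 0 \<and> ?b z = 0" if "norm z > R"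
    proof -
      have "z \<notin> L" using R[of z] that by auto
      then show ?thesis using o by simp
    qed
    show "norm (?g z) \<le> M"
    proof (cases "z \<in> L - {p}")
      case True
      then have "norm (?g z) \<le> \<bar>X\<bar> * \<bar>G\<bar>" unfolding norm_mult using X G by (intro mm) auto
      then show ?thesis unfolding M_def using nn norm_ge_zero[of "?g p"] by linarith
    next
      case False
      then consider "z = p" | "z \<notin> L" by auto
      then show ?thesis
      proof cases
        case 1
        then show ?thesis unfolding M_def using nn by simp
      qed (use o M0 in auto)
    qed
    have le: "norm (?X z * c z + x z * g z) * norm (z - p) \<le> M"
      if c: "\<forall>z\<in>L - {p}. norm (c z * (z - p)) \<le> C" and x: "\<forall>z\<in>L. norm (x z * (z - p)) \<le> XC" "z \<notin> L \<Longrightarrow> x z = 0"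
        and CM: "\<bar>X\<bar> * \<bar>C\<bar> + \<bar>XC\<bar> * \<bar>G\<bar> \<le> M" for c x :: "complex \<Rightarrow> complex" and C XC
    proof (cases "z \<in> L - {p}")
      case True
      have "(?X z * c z + x z * g z) * (z - p) = ?X z * (c z * (z - p)) + (x z * (z - p)) * g z" by (simp add: algebra_simps)
      then have "norm ((?X z * c z + x z * g z) * (z - p)) \<le> norm (?X z) * norm (c z * (z - p)) + norm (x z * (z - p)) * norm (g z)"
        using norm_triangle_ineq[of "?X z * (c z * (z - p))" "(x z * (z - p)) * g z"] by (simp only: norm_mult)
      also have "\<dots> \<le> \<bar>X\<bar> * \<bar>C\<bar> + \<bar>XC\<bar> * \<bar>G\<bar>" using True X c x(1) G by (intro add_mono mm) auto
      finally show ?thesis using CM by (simp only: norm_mult)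
    next
      case False
      then show ?thesis using M0 o(1)[of z] x(2) by auto
    qed
    have MM: "\<bar>X\<bar> * \<bar>A\<bar> + \<bar>XA\<bar> * \<bar>G\<bar> \<le> M" "\<bar>X\<bar> * \<bar>B\<bar> + \<bar>XB\<bar> * \<bar>G\<bar> \<le> M"
      unfolding M_def using nn norm_ge_zero[of "?g p"] by linarith+
    show "norm (?a z) * norm (z - p) \<le> M" by (rule le[OF A XA o(2) MM(1)])
    show "norm (?b z) * norm (z - p) \<le> M" by (rule le[OF B XB o(3) MM(2)])
  next
    have ext: "continuous_on (-{p}) F" if "continuous_on (S - {p}) F" "\<And>z. z \<notin> L \<Longrightarrow> F z = 0" for F :: "complex \<Rightarrow> complex"
    proof -
      have "continuous_on (-L) F" by (rule continuous_on_eq[OF continuous_on_const[of _ 0]]) (use that in auto)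
      then have "continuous_on ((S - {p}) \<union> -L) F"
        using that(1) L \<open>open S\<close> by (intro continuous_on_open_Un) (auto simp: compact_imp_closed open_Compl)
      then show ?thesis by (rule continuous_on_subset) (use L in auto)
    qed
    have cS: "continuous_on (S - {p}) \<eta>" "continuous_on (S - {p}) xa" "continuous_on (S - {p}) xb"
      using c continuous_on_subset by blast+
    show "continuous_on (-{p}) ?a" "continuous_on (-{p}) ?b"
      by (rule ext, intro continuous_intros cS ca cb cg, use o in simp)+
  qed
  then show ?thesis by (rule that) (use i in auto)
qed

lemma bounded_near_eq_Bfun: "bounded_near p F \<longleftrightarrow> Bfun F (at p)"
proof
  assume "bounded_near p F"
  then obtain r M where "r > 0" "\<forall>z\<in>ball p r - {p}. norm (F z) \<le> M"
    unfolding bounded_near_def by blast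
  then have "eventually (\<lambda>z. norm (F z) \<le> M) (at p)"
    unfolding eventually_at by (intro exI[of _ r]) (auto simp: dist_commute)
  then show "Bfun F (at p)" by (rule BfunI)
next
  assume "Bfun F (at p)"
  then obtain M where "eventually (\<lambda>z. norm (F z) \<le> M) (at p)" by (auto elim: BfunE)
  then obtain d where "d > 0" "\<forall>z. z \<noteq> p \<and> dist z p < d \<longrightarrow> norm (F z) \<le> M"
    unfolding eventually_at by auto
  then have "d > 0" "\<forall>z\<in>ball p d - {p}. norm (F z) \<le> M" by (auto simp: dist_commute)
  then show "bounded_near p F"
    unfolding bounded_near_def by blast
qed

lemma bounded_near_mono:
  assumes "bounded_near p F" "\<And>z. norm (G z) \<le> norm (F z)" shows "bounded_near p G"
proof -
  obtain r M where "r > 0" "\<And>z. z \<in> ball p r - {p} \<Longrightarrow> norm (F z) \<le> M"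
    using assms(1) unfolding bounded_near_def by blast
  with order_trans[OF assms(2)] show ?thesis unfolding bounded_near_def by blast
qed

lemma bounded_near_le: "(\<And>z. norm (F z) \<le> M) \<Longrightarrow> bounded_near p F"
  unfolding bounded_near_def by (intro exI[of _ 1]) auto

lemma bounded_near_isCont:
  assumes "isCont F p" shows "bounded_near p F"
proof -
  have "eventually (\<lambda>z. dist (F z) (F p) < 1) (at p)"
    using assms unfolding isCont_def by (rule tendstoD) simp
  then have "eventually (\<lambda>z. norm (F z) \<le> norm (F p) + 1) (at p)"
  proof eventually_elim
    case (elim z)
    then show ?case using norm_triangle_ineq2[of "F z" "F p"] by (simp add: dist_norm)
  qed
  then show ?thesis unfolding bounded_near_eq_Bfun by (rule BfunI)
qed

lemma bounded_near_add:
  assumes "bounded_near p F" "bounded_near p G" shows "bounded_near p (\<lambda>z. F z + G z)"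
proof -
  obtain M K where "eventually (\<lambda>z. norm (F z) \<le> M) (at p)" "eventually (\<lambda>z. norm (G z) \<le> K) (at p)"
    using assms unfolding bounded_near_eq_Bfun by (auto elim!: BfunE)
  then have "eventually (\<lambda>z. norm (F z + G z) \<le> M + K) (at p)"
    by eventually_elim (rule norm_triangle_mono)
  then show ?thesis unfolding bounded_near_eq_Bfun by (rule BfunI)
qed

lemma bounded_near_mult:
  assumes "bounded_near p F" "bounded_near p G" shows "bounded_near p (\<lambda>z. F z * G z)"
proof -
  obtain M K where "M > 0" "eventually (\<lambda>z. norm (F z) \<le> M) (at p)" "eventually (\<lambda>z. norm (G z) \<le> K) (at p)"
    using assms unfolding bounded_near_eq_Bfun by (auto elim!: BfunE)
  from this(2,3) have "eventually (\<lambda>z. norm (F z * G z) \<le> M * K) (at p)"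
    by eventually_elim (use \<open>M > 0\<close> in \<open>simp add: norm_mult mult_mono\<close>)
  then show ?thesis unfolding bounded_near_eq_Bfun by (rule BfunI)
qed

text \<open>Hiding the derivatives lets \<open>g0\<close> be treated by closure rules along its
  formula. Its antiholomorphic derivative is never computed; only its relation to the Laplacian
  matters.\<close>

definition istame :: "complex set \<Rightarrow> complex \<Rightarrow> (complex \<Rightarrow> complex) \<Rightarrow> bool" where
  "istame S p f \<longleftrightarrow> (\<exists>a b. tame S p f a b)"

lemma istameI:
  assumes "\<And>z. z \<in> S - {p} \<Longrightarrow> has_wirtinger f (a z) (b z) z"
     "continuous_on (S - {p}) a" "continuous_on (S - {p}) b"
     "bounded_near p f" "bounded_near p (\<lambda>z. a z * (z - p))" "bounded_near p (\<lambda>z. b z * (z - p))"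
  shows "istame S p f"
  unfolding istame_def tame_def using assms by blast

lemma tameD:
  assumes "tame S p f a b" "open S"
  shows "\<And>z. z \<in> S - {p} \<Longrightarrow> has_wirtinger f (a z) (b z) z"
     "continuous_on (S - {p}) f" "continuous_on (S - {p}) a" "continuous_on (S - {p}) b"
     "bounded_near p f" "bounded_near p (\<lambda>z. a z * (z - p))" "bounded_near p (\<lambda>z. b z * (z - p))"
  using assms(1) tame_continuous_on[OF assms] by (simp_all add: tame_def)

lemma istame_holomorphic:
  assumes f: "\<And>z. (f has_field_derivative f' z) (at z)" and f': "continuous_on UNIV f'"
  shows "istame S p f"
proof (rule istameI)
  show "has_wirtinger f (f' z) 0 z" for z by (rule has_wirtinger_holomorphic[OF f])
  show "bounded_near p f" by (intro bounded_near_isCont DERIV_isCont[OF f])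
  have "isCont f' p" using f' by (simp add: continuous_on_eq_continuous_at)
  then show "bounded_near p (\<lambda>z. f' z * (z - p))" by (intro bounded_near_isCont continuous_intros)
  show "bounded_near p (\<lambda>z. 0 * (z - p))" by (rule bounded_near_le[of _ 0]) simp
  show "continuous_on (S - {p}) f'" by (rule continuous_on_subset[OF f']) simp
qed (rule continuous_on_const)

lemma istame_const: "istame S p (\<lambda>_. c)"
  by (rule istame_holomorphic[where f' = "\<lambda>_. 0"]) simp_all

lemma istame_power_diff: "istame S p (\<lambda>z. (z - c) ^ n)"
proof (rule istame_holomorphic)
  show "((\<lambda>z. (z - c) ^ n) has_field_derivative of_nat n * (z - c) ^ (n - 1)) (at z)" for z
    by (auto intro!: derivative_eq_intros)
  show "continuous_on UNIV (\<lambda>z. of_nat n * (z - c) ^ (n - 1))"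
    by (intro continuous_intros)
qed

lemma istame_diff_const: "istame S p (\<lambda>z. z - c)"
  using istame_power_diff[of S p c 1] by simp

lemma istame_add:
  assumes "open S" "istame S p f" "istame S p g" shows "istame S p (\<lambda>z. f z + g z)"
proof -
  obtain a b where tf: "tame S p f a b" using assms(2) unfolding istame_def by blast
  note f = tameD[OF tf assms(1)]
  obtain c d where tg: "tame S p g c d" using assms(3) unfolding istame_def by blast
  note g = tameD[OF tg assms(1)]
  show ?thesis
  proof (rule istameI[where a = "\<lambda>z. a z + c z" and b = "\<lambda>z. b z + d z"])
    show "bounded_near p (\<lambda>z. f z + g z)" "bounded_near p (\<lambda>z. (a z + c z) * (z - p))" "bounded_near p (\<lambda>z. (b z + d z) * (z - p))"
      unfolding distrib_right
      by (rule bounded_near_add[OF f(5) g(5)] bounded_near_add[OF f(6) g(6)] bounded_near_add[OF f(7) g(7)])+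
    show "continuous_on (S - {p}) (\<lambda>z. a z + c z)" "continuous_on (S - {p}) (\<lambda>z. b z + d z)"
      by (rule continuous_on_add[OF f(3) g(3)] continuous_on_add[OF f(4) g(4)])+
  qed (rule has_wirtinger_add[OF f(1) g(1)])
qed

lemma istame_mult:
  assumes "open S" "istame S p f" "istame S p g" shows "istame S p (\<lambda>z. f z * g z)"
proof -
  obtain a b where tf: "tame S p f a b" using assms(2) unfolding istame_def by blast
  note f = tameD[OF tf assms(1)]
  obtain c d where tg: "tame S p g c d" using assms(3) unfolding istame_def by blast
  note g = tameD[OF tg assms(1)]
  show ?thesis
  proof (rule istameI[where a = "\<lambda>z. f z * c z + a z * g z" and b = "\<lambda>z. f z * d z + b z * g z"])
    from bounded_near_add[OF bounded_near_mult[OF f(5) g(6)] bounded_near_mult[OF f(6) g(5)]]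
      bounded_near_add[OF bounded_near_mult[OF f(5) g(7)] bounded_near_mult[OF f(7) g(5)]]
    show "bounded_near p (\<lambda>z. (f z * c z + a z * g z) * (z - p))" "bounded_near p (\<lambda>z. (f z * d z + b z * g z) * (z - p))"
      by (simp_all add: algebra_simps)
    show "bounded_near p (\<lambda>z. f z * g z)" by (rule bounded_near_mult[OF f(5) g(5)])
    show "continuous_on (S - {p}) (\<lambda>z. f z * c z + a z * g z)" "continuous_on (S - {p}) (\<lambda>z. f z * d z + b z * g z)"
      by (rule continuous_on_add[OF continuous_on_mult[OF f(2) g(3)] continuous_on_mult[OF f(3) g(2)]]
          continuous_on_add[OF continuous_on_mult[OF f(2) g(4)] continuous_on_mult[OF f(4) g(2)]])+
  qed (rule has_wirtinger_mult[OF f(1) g(1)])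
qed

lemma istame_power:
  assumes "open S" "istame S p f" shows "istame S p (\<lambda>z. f z ^ n)"
proof (induction n)
  case (Suc n)
  from istame_mult[OF assms Suc] show ?case by simp
qed (simp add: istame_const)

lemma istame_cnj:
  assumes "open S" "istame S p f" shows "istame S p (\<lambda>z. cnj (f z))"
proof -
  obtain a b where tf: "tame S p f a b" using assms(2) unfolding istame_def by blast
  note f = tameD[OF tf assms(1)]
  show ?thesis
  proof (rule istameI[where a = "\<lambda>z. cnj (b z)" and b = "\<lambda>z. cnj (a z)"])
    show "bounded_near p (\<lambda>z. cnj (f z))" "bounded_near p (\<lambda>z. cnj (b z) * (z - p))" "bounded_near p (\<lambda>z. cnj (a z) * (z - p))"
      by (rule bounded_near_mono[OF f(5)] bounded_near_mono[OF f(7)] bounded_near_mono[OF f(6)], simp add: norm_mult)+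
    show "continuous_on (S - {p}) (\<lambda>z. cnj (b z))" "continuous_on (S - {p}) (\<lambda>z. cnj (a z))"
      by (intro continuous_intros f)+
  qed (rule has_wirtinger_cnj[OF f(1)])
qed

text \<open>The reciprocal is bounded near \<open>p\<close> because \<open>f\<close> is continuous
  and nonzero there, hence the conditions on all of \<open>S\<close> including
  \<open>p\<close>.\<close>

lemma istame_inverse:
  assumes "open S" "p \<in> S" "istame S p f" "continuous_on S f" "\<And>z. z \<in> S \<Longrightarrow> f z \<noteq> 0"
  shows "istame S p (\<lambda>z. inverse (f z))"
proof -
  obtain a b where tf: "tame S p f a b" using assms(3) unfolding istame_def by blast
  note f = tameD[OF tf assms(1)]
  have ci: "continuous_on S (\<lambda>z. inverse (f z))" using assms(4,5) by (intro continuous_intros) auto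
  then have "isCont (\<lambda>z. inverse (f z)) p" using assms(1,2) by (simp add: continuous_on_eq_continuous_at)
  then have bi: "bounded_near p (\<lambda>z. inverse (f z))" by (rule bounded_near_isCont)
  have m: "bounded_near p (\<lambda>z. - F z)" if "bounded_near p F" for F
    by (rule bounded_near_mono[OF that]) simp
  show ?thesis
  proof (rule istameI[where a = "\<lambda>z. - a z * (inverse (f z))\<^sup>2" and b = "\<lambda>z. - b z * (inverse (f z))\<^sup>2"])
    from m[OF bounded_near_mult[OF bi bounded_near_mult[OF bi f(6)]]] m[OF bounded_near_mult[OF bi bounded_near_mult[OF bi f(7)]]]
    show "bounded_near p (\<lambda>z. - a z * (inverse (f z))\<^sup>2 * (z - p))" "bounded_near p (\<lambda>z. - b z * (inverse (f z))\<^sup>2 * (z - p))"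
      by (simp_all add: power2_eq_square mult_ac)
    show "has_wirtinger (\<lambda>z. inverse (f z)) (- a z * (inverse (f z))\<^sup>2) (- b z * (inverse (f z))\<^sup>2) z" if "z \<in> S - {p}" for z
      by (rule has_wirtinger_inverse[OF f(1)[OF that]]) (use assms(5) that in auto)
    have ci': "continuous_on (S - {p}) (\<lambda>z. inverse (f z))" by (rule continuous_on_subset[OF ci]) auto
    show "continuous_on (S - {p}) (\<lambda>z. - a z * (inverse (f z))\<^sup>2)" "continuous_on (S - {p}) (\<lambda>z. - b z * (inverse (f z))\<^sup>2)"
      by (intro continuous_on_mult continuous_on_minus continuous_on_power ci' f)+
  qed (rule bi)
qed

text \<open>A zero at \<open>p\<close> is allowed: the derivative of the norm brings in only
  quotients like \<open>cnj (f z) / (2 * norm (f z))\<close>, of modulus at most 1/2.\<close>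

lemma istame_norm:
  assumes "open S" "istame S p f" "\<And>z. z \<in> S - {p} \<Longrightarrow> f z \<noteq> 0"
  shows "istame S p (\<lambda>z. complex_of_real (norm (f z)))"
proof -
  obtain a b where tf: "tame S p f a b" using assms(2) unfolding istame_def by blast
  note f = tameD[OF tf assms(1)]
  have h: "bounded_near p (\<lambda>z. cnj (f z) / (2 * norm (f z)))" "bounded_near p (\<lambda>z. f z / (2 * norm (f z)))"
    by (rule bounded_near_le[of _ "1/2"], simp add: norm_divide norm_mult)+
  have c: "bounded_near p (\<lambda>z. cnj (a z) * (z - p))" "bounded_near p (\<lambda>z. cnj (b z) * (z - p))"
    by (rule bounded_near_mono[OF f(6)], simp add: norm_mult) (rule bounded_near_mono[OF f(7)], simp add: norm_mult)
  show ?thesis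
  proof (rule istameI[where a = "\<lambda>z. (a z * cnj (f z) + f z * cnj (b z)) / (2 * norm (f z))"
        and b = "\<lambda>z. (b z * cnj (f z) + f z * cnj (a z)) / (2 * norm (f z))"])
    have "bounded_near p (\<lambda>z. (cnj (f z) / (2 * norm (f z))) * (a z * (z - p)) + (f z / (2 * norm (f z))) * (cnj (b z) * (z - p)))"
      by (rule bounded_near_add[OF bounded_near_mult[OF h(1) f(6)] bounded_near_mult[OF h(2) c(2)]])
    moreover have "bounded_near p (\<lambda>z. (cnj (f z) / (2 * norm (f z))) * (b z * (z - p)) + (f z / (2 * norm (f z))) * (cnj (a z) * (z - p)))"
      by (rule bounded_near_add[OF bounded_near_mult[OF h(1) f(7)] bounded_near_mult[OF h(2) c(1)]])
    moreover have eq: "(x * y' + y * x') / k * t = (y' / k) * (x * t) + (y / k) * (x' * t)" for x y x' y' k t :: complex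
      by (simp add: add_divide_distrib algebra_simps)
    ultimately show "bounded_near p (\<lambda>z. (a z * cnj (f z) + f z * cnj (b z)) / (2 * norm (f z)) * (z - p))"
       "bounded_near p (\<lambda>z. (b z * cnj (f z) + f z * cnj (a z)) / (2 * norm (f z)) * (z - p))"
      by (simp_all only: eq)
    show "bounded_near p (\<lambda>z. complex_of_real (norm (f z)))" by (rule bounded_near_mono[OF f(5)]) simp
    show "has_wirtinger (\<lambda>z. complex_of_real (norm (f z))) ((a z * cnj (f z) + f z * cnj (b z)) / (2 * norm (f z)))
       ((b z * cnj (f z) + f z * cnj (a z)) / (2 * norm (f z))) z" if "z \<in> S - {p}" for z
      by (rule has_wirtinger_norm[OF f(1)[OF that] assms(3)[OF that]])
    show "continuous_on (S - {p}) (\<lambda>z. (a z * cnj (f z) + f z * cnj (b z)) / (2 * norm (f z)))"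
      "continuous_on (S - {p}) (\<lambda>z. (b z * cnj (f z) + f z * cnj (a z)) / (2 * norm (f z)))"
      by (intro continuous_intros f; use assms(3) in simp)+
  qed
qed

text \<open>This factor of \<open>g0\<close> has no limit at \<open>p\<close>. It is of modulus at
  most 1, and its derivatives are of order \<open>1 / |z - p|\<close>, exactly what
  \<open>tame\<close> admits.\<close>

lemma istame_direction: "open S \<Longrightarrow> istame S p (\<lambda>z. complex_of_real (norm (z - p)) * inverse (z - p))"
proof (rule istameI[where a = "\<lambda>z. norm (z - p) * (- 1 * (inverse (z - p))\<^sup>2) + cnj (z - p) / (2 * norm (z - p)) * inverse (z - p)"
     and b = "\<lambda>z. (z - p) / (2 * norm (z - p)) * inverse (z - p)"])
  fix z assume "z \<in> S - {p}"
  then have ne: "z - p \<noteq> 0" by auto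
  have v: "has_wirtinger (\<lambda>z. z - p) 1 0 z"
    by (rule has_wirtinger_holomorphic) (auto intro!: derivative_eq_intros)
  show "has_wirtinger (\<lambda>z. complex_of_real (norm (z - p)) * inverse (z - p))
     (norm (z - p) * (- 1 * (inverse (z - p))\<^sup>2) + cnj (z - p) / (2 * norm (z - p)) * inverse (z - p))
     ((z - p) / (2 * norm (z - p)) * inverse (z - p)) z"
    by (rule has_wirtinger_eq[OF has_wirtinger_mult[OF has_wirtinger_norm[OF v ne] has_wirtinger_inverse[OF v ne]]]) simp_all
next
  show "bounded_near p (\<lambda>z. complex_of_real (norm (z - p)) * inverse (z - p))"
  proof (rule bounded_near_le[of _ 1])
    show "norm (complex_of_real (norm (z - p)) * inverse (z - p)) \<le> 1" for z
      by (cases "z = p") (simp_all add: norm_mult norm_inverse)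
  qed
  have "norm ((norm (z - p) * (- 1 * (inverse (z - p))\<^sup>2) + cnj (z - p) / (2 * norm (z - p)) * inverse (z - p)) * (z - p)) \<le> 2" for z
  proof -
    have tri: "norm ((x * (- 1 * y) + t) * v) \<le> norm (x * y * v) + norm (t * v)" for x y t v :: complex
      using norm_triangle_ineq[of "- (x * y * v)" "t * v"] by (simp add: distrib_right left_diff_distrib)
    have "norm ((norm (z - p) * (- 1 * (inverse (z - p))\<^sup>2) + cnj (z - p) / (2 * norm (z - p)) * inverse (z - p)) * (z - p))
      \<le> norm (complex_of_real (norm (z - p)) * (inverse (z - p))\<^sup>2 * (z - p)) + norm (cnj (z - p) / (2 * norm (z - p)) * inverse (z - p) * (z - p))"
      by (rule tri)
    also have "\<dots> \<le> 1 + 1/2"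
    proof (rule add_mono)
      have "norm (complex_of_real (norm v) * (inverse v)\<^sup>2 * v) \<le> 1" for v :: complex
        by (cases "v = 0") (simp_all add: norm_mult norm_inverse norm_divide power2_eq_square field_simps)
      then show "norm (complex_of_real (norm (z - p)) * (inverse (z - p))\<^sup>2 * (z - p)) \<le> 1" .
      have "norm (cnj v / (2 * norm v) * inverse v * v) \<le> 1/2" for v :: complex
        by (cases "v = 0") (simp_all add: norm_mult norm_divide norm_inverse field_simps)
      then show "norm (cnj (z - p) / (2 * norm (z - p)) * inverse (z - p) * (z - p)) \<le> 1/2" .
    qed
    finally show ?thesis by simp
  qed
  then show "bounded_near p (\<lambda>z. (norm (z - p) * (- 1 * (inverse (z - p))\<^sup>2) + cnj (z - p) / (2 * norm (z - p)) * inverse (z - p)) * (z - p))"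
    by (rule bounded_near_le)
  show "bounded_near p (\<lambda>z. (z - p) / (2 * norm (z - p)) * inverse (z - p) * (z - p))"
  proof (rule bounded_near_le[of _ 1])
    show "norm ((z - p) / (2 * norm (z - p)) * inverse (z - p) * (z - p)) \<le> 1" for z
      by (cases "z = p") (simp_all add: norm_mult norm_divide norm_inverse)
  qed
qed (intro continuous_intros; auto)+

section \<open>Hopf's Umlaufsatz\<close>

text \<open>The difference divided by \<open>2 * pi * \<i>\<close> is continuous with integer
  values, and distinct integers are at distance at least 1.\<close>

lemma continuous_log_unique:
  fixes q r :: "'a::metric_space \<Rightarrow> complex"
  assumes "connected S" "continuous_on S q" "continuous_on S r"
    and "\<And>x. x \<in> S \<Longrightarrow> exp (q x) = exp (r x)"
  obtains k :: int where "\<And>x. x \<in> S \<Longrightarrow> q x = r x + 2 * pi * \<i> * of_int k"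
proof (cases "S = {}")
  case False
  define f where "f = (\<lambda>x. (q x - r x) / (2 * pi * \<i>))"
  have int: "\<exists>k::int. f x = of_int k" if x: "x \<in> S" for x
  proof -
    obtain k :: int where "q x = r x + (of_int (2 * k) * pi) * \<i>"
      using assms(4)[OF x] unfolding exp_eq by blast
    then show ?thesis by (intro exI[of _ k]) (simp add: f_def)
  qed
  have "f constant_on S"
  proof (rule continuous_discrete_range_constant[OF assms(1)])
    show "continuous_on S f" unfolding f_def by (intro continuous_intros assms) auto
    fix x assume x: "x \<in> S"
    obtain k :: int where k: "f x = of_int k" using int[OF x] by blast
    have "1 \<le> norm (f y - f x)" if y: "y \<in> S" "f y \<noteq> f x" for y
    proof -
      obtain j :: int where j: "f y = of_int j" using int[OF y(1)] by blast
      with k y(2) have "j \<noteq> k" by auto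
      then show ?thesis unfolding j k of_int_diff[symmetric] norm_of_int by linarith
    qed
    then show "\<exists>e>0. \<forall>y. y \<in> S \<and> f y \<noteq> f x \<longrightarrow> e \<le> norm (f y - f x)"
      by (intro exI[of _ 1]) auto
  qed
  then obtain c where c: "\<And>x. x \<in> S \<Longrightarrow> f x = c" unfolding constant_on_def by blast
  obtain k :: int where "c = of_int k" using False int c by fastforce
  then have "q x = r x + 2 * pi * \<i> * of_int k" if "x \<in> S" for x
    using c[OF that] by (auto simp: f_def field_simps)
  then show ?thesis by (rule that)
qed (use that in auto)

text \<open>Any two continuous logarithms differ by a constant, so each has the increment that the
  winding number prescribes.\<close>

lemma winding_number_continuous_log:
  assumes q: "continuous_on {0..1} q" and eq: "\<And>t. t \<in> {0..1} \<Longrightarrow> \<gamma> t = z + exp (q t)"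
  shows "winding_number \<gamma> z = (q 1 - q 0) / (2 * pi * \<i>)"
proof -
  have "path (\<lambda>t. z + exp (q t))" unfolding path_def by (intro continuous_intros q)
  then have p: "path \<gamma>" by (rule path_eq) (use eq in auto)
  have z: "z \<notin> path_image \<gamma>" using eq by (auto simp: path_image_def)
  obtain r where r: "path r" "pathfinish r - pathstart r = 2 * of_real pi * \<i> * winding_number \<gamma> z"
     "\<And>t. t \<in> {0..1} \<Longrightarrow> \<gamma> t = z + exp (r t)"
    by (rule winding_number_as_continuous_log[OF p z]) (rule that)
  obtain k :: int where k: "\<And>t. t \<in> {0..1} \<Longrightarrow> q t = r t + 2 * pi * \<i> * of_int k"
    by (rule continuous_log_unique[of "{0..1}" q r]) (use q r eq in \<open>auto simp: path_def\<close>)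
  from k[of 0] k[of 1] r(2) show ?thesis by (simp add: pathfinish_def pathstart_def)
qed

definition slope :: "(real \<Rightarrow> complex) \<Rightarrow> (real \<Rightarrow> complex) \<Rightarrow> real \<times> real \<Rightarrow> complex" where
  "slope f f' = (\<lambda>(s, t). if s = t then f' s else (f t - f s) / of_real (t - s))"

text \<open>Only the diagonal is critical. Near \<open>(s, s)\<close> the mean value inequality
  bounds the deviation from \<open>f' s\<close> by the oscillation of \<open>f'\<close>, which is
  small by continuity.\<close>

lemma continuous_on_slope:
  assumes der: "\<And>t. (f has_vector_derivative f' t) (at t)" and cont: "continuous_on UNIV f'"
  shows "continuous_on UNIV (slope f f')"
proof -
  have cf: "continuous_on UNIV f"
    using der by (intro continuous_on_vector_derivative) (auto simp: has_vector_derivative_at_within)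
  have "isCont (slope f f') (s, t)" for s t
  proof (cases "s = t")
    case False
    have "continuous_on {x. fst x \<noteq> snd x} (\<lambda>x::real\<times>real. (f (snd x) - f (fst x)) / of_real (snd x - fst x))"
      by (intro continuous_intros continuous_on_compose2[OF cf]) auto
    then have "continuous_on {x. fst x \<noteq> snd x} (slope f f')"
      by (rule continuous_on_eq) (auto simp: slope_def)
    moreover have "open {x::real\<times>real. fst x \<noteq> snd x}"
      by (intro open_Collect_neq continuous_intros)
    ultimately show ?thesis using False by (simp add: continuous_on_eq_continuous_at)
  next
    case True
    have "\<exists>d>0. \<forall>x. dist x (s, s) < d \<longrightarrow> dist (slope f f' x) (slope f f' (s, s)) < e" if e: "e > 0" for e
    proof -
      obtain d where d: "d > 0" "\<And>x. dist x s < d \<Longrightarrow> dist (f' x) (f' s) < e / 2"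
        using cont e unfolding continuous_on_iff by (metis UNIV_I half_gt_zero)
      have "dist (slope f f' x) (slope f f' (s, s)) < e" if x: "dist x (s, s) < d" for x
      proof -
        obtain a b where ab: "x = (a, b)" by fastforce
        have a: "dist a s < d" and b: "dist b s < d"
          using x dist_fst_le[of x "(s, s)"] dist_snd_le[of x "(s, s)"] by (auto simp: ab)
        show ?thesis
        proof (cases "a = b")
          case True
          then show ?thesis using d(2)[OF a] e by (simp add: ab slope_def)
        next
          case False
          have "norm (f b - f a - (b - a) *\<^sub>R f' s) \<le> norm (b - a) * (e / 2)"
          proof (rule vector_differentiable_bound_linearization[where S = "ball s d" and f' = f'])
            show "(f has_vector_derivative f' x) (at x within ball s d)" if "x \<in> ball s d" for x
              by (rule has_vector_derivative_at_within[OF der])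
            show "closed_segment a b \<subseteq> ball s d"
              by (rule closed_segment_subset) (use a b in \<open>auto simp: dist_commute\<close>)
            show "norm (f' x - f' s) \<le> e / 2" if "x \<in> ball s d" for x
              using less_imp_le[OF d(2)[of x]] that by (simp add: dist_norm norm_minus_commute abs_minus_commute)
          qed (use d in auto)
          then have "norm (f b - f a - (b - a) *\<^sub>R f' s) / norm (b - a) \<le> e / 2"
            using False by (subst pos_divide_le_eq) (simp_all only: mult.commute zero_less_norm_iff right_minus_eq not_sym[OF False] not_False_eq_True)
          then have "norm ((f b - f a - (b - a) *\<^sub>R f' s) / of_real (b - a)) \<le> e / 2"
            by (simp only: norm_divide norm_of_real real_norm_def)
          moreover have "(f b - f a - (b - a) *\<^sub>R f' s) / of_real (b - a) = slope f f' x - slope f f' (s, s)"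
            using False by (simp add: ab slope_def diff_divide_distrib scaleR_conv_of_real del: of_real_diff)
          ultimately show ?thesis using e by (simp add: dist_norm)
        qed
      qed
      then show ?thesis using d(1) by blast
    qed
    then show ?thesis unfolding True continuous_at_eps_delta by (simp add: True)
  qed
  then show ?thesis by (auto intro: continuous_at_imp_continuous_on)
qed

section \<open>Hopf's chord map\<close>

text \<open>The unit circle with period 1; \<open>cis1 s = cis1 t\<close> expresses equality of
  parameters modulo 1.\<close>

definition cis1 :: "real \<Rightarrow> complex" where "cis1 t = exp (2 * pi * \<i> * t)"

lemma cis1_ne_0 [simp]: "cis1 t \<noteq> 0" by (simp add: cis1_def)

lemma cis1_0 [simp]: "cis1 0 = 1" by (simp add: cis1_def)

lemma cis1_eq_iff: "cis1 s = cis1 t \<longleftrightarrow> (\<exists>k::int. s = t + k)"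
proof -
  have "cis1 s = cis1 t \<longleftrightarrow> (\<exists>k::int. 2 * pi * \<i> * s = 2 * pi * \<i> * t + (of_int (2 * k) * pi) * \<i>)"
    unfolding cis1_def exp_eq ..
  also have "\<dots> \<longleftrightarrow> (\<exists>k::int. s = t + k)"
  proof (intro ex_cong1)
    fix k :: int
    have "2 * pi * \<i> * s = 2 * pi * \<i> * t + (of_int (2 * k) * pi) * \<i> \<longleftrightarrow>
        complex_of_real (2 * pi) * \<i> * s = complex_of_real (2 * pi) * \<i> * of_real (t + k)"
      by (simp add: algebra_simps)
    also have "\<dots> \<longleftrightarrow> s = t + k"
      by (simp only: mult_cancel_left of_real_eq_iff) simp
    finally show "2 * pi * \<i> * s = 2 * pi * \<i> * t + (of_int (2 * k) * pi) * \<i> \<longleftrightarrow> s = t + k" .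
  qed
  finally show ?thesis .
qed

lemma cis1_add_int [simp]: "cis1 (t + of_int k) = cis1 t"
  using cis1_eq_iff by blast

lemma cis1_has_vector_derivative:
  "(cis1 has_vector_derivative 2 * pi * \<i> * cis1 t) (at t)"
proof -
  have "((\<lambda>z. exp (2 * pi * \<i> * z)) has_field_derivative 2 * pi * \<i> * exp (2 * pi * \<i> * of_real t)) (at (complex_of_real t))"
    by (auto intro!: derivative_eq_intros)
  from has_vector_derivative_real_field[OF this] show ?thesis
    by (simp add: cis1_def[abs_def])
qed

lemma continuous_on_cis1 [continuous_intros]:
  "continuous_on S f \<Longrightarrow> continuous_on S (\<lambda>x. cis1 (f x))"
  unfolding cis1_def by (intro continuous_intros)

text \<open>A simple regular closed curve as a function on the whole line: there are no end points,
  and derivatives are two-sided everywhere.\<close>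

locale simple_periodic_C1 =
  fixes \<gamma> \<gamma>' :: "real \<Rightarrow> complex"
  assumes der: "(\<gamma> has_vector_derivative \<gamma>' t) (at t)"
    and cont: "continuous_on UNIV \<gamma>'"
    and periodic: "\<gamma> (t + 1) = \<gamma> t"
    and inj: "\<gamma> s = \<gamma> t \<Longrightarrow> \<exists>k::int. s = t + k"
    and nz: "\<gamma>' t \<noteq> 0"
begin

lemma cont_\<gamma>: "continuous_on UNIV \<gamma>"
  using der by (intro continuous_on_vector_derivative) (auto simp: has_vector_derivative_at_within)

lemma periodic_nat: "\<gamma> (t + of_nat n) = \<gamma> t"
proof (induction n arbitrary: t)
  case (Suc n)
  then show ?case using Suc[of "t + 1"] periodic[of t] by (simp add: add_ac)
qed simp

lemma periodic_int [simp]: "\<gamma> (t + of_int k) = \<gamma> t"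
proof (cases "k \<ge> 0")
  case True
  then show ?thesis using periodic_nat[of t "nat k"] by simp
next
  case False
  then show ?thesis using periodic_nat[of "t + of_int k" "nat (- k)"] by simp
qed

lemma eq_iff_cis1: "\<gamma> s = \<gamma> t \<longleftrightarrow> cis1 s = cis1 t"
  using inj cis1_eq_iff by fastforce

lemma \<gamma>'_periodic_int [simp]: "\<gamma>' (t + of_int k) = \<gamma>' t"
proof -
  have "((\<gamma> \<circ> (\<lambda>s. s + of_int k)) has_vector_derivative 1 *\<^sub>R \<gamma>' (t + of_int k)) (at t)"
    by (rule vector_diff_chain_at) (auto intro!: derivative_eq_intros der)
  moreover have "\<gamma> \<circ> (\<lambda>s. s + of_int k) = \<gamma>" by auto
  ultimately show ?thesis using vector_derivative_unique_at[OF der[of t]] by simp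
qed

lemma \<gamma>'_cong: "cis1 s = cis1 t \<Longrightarrow> \<gamma>' s = \<gamma>' t"
  by (auto simp: cis1_eq_iff)

text \<open>The chord map of Hopf's proof, divided by that of the unit circle: it extends
  continuously across the diagonal and has no zeros on the torus.\<close>

definition chord :: "real \<times> real \<Rightarrow> complex" where
  "chord = (\<lambda>(s, t). if cis1 s = cis1 t then \<gamma>' s / (2 * pi * \<i> * cis1 s)
     else (\<gamma> t - \<gamma> s) / (cis1 t - cis1 s))"

lemma chord_ne_0: "chord x \<noteq> 0"
  by (auto simp: chord_def nz eq_iff_cis1 split: prod.splits)

text \<open>The swap changes the sign of numerator and denominator alike. The undivided chord map is
  antisymmetric, the origin of the half turns in Hopf's argument.\<close>

lemma chord_commute: "chord (s, t) = chord (t, s)"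
  using \<gamma>'_cong[of s t] minus_divide_divide[of "\<gamma> t - \<gamma> s" "cis1 t - cis1 s"] by (auto simp: chord_def)

lemma chord_add_int: "chord (s, t + of_int k) = chord (s, t)"
  by (simp add: chord_def)

lemma continuous_on_chord: "continuous_on UNIV chord"
proof -
  \<comment> \<open>Open strips around the lines \<open>t = s + k\<close>. In \<open>U 0\<close> the
    parameters agree modulo 1 only on the diagonal, so \<open>chord\<close> is a quotient of two
    slopes; periodicity gives the other strips.\<close>
  define U where "U = (\<lambda>k::int. {x::real\<times>real. \<bar>snd x - fst x - of_int k\<bar> < 1})"
  have op: "open (U k)" for k
    unfolding U_def by (intro open_Collect_less continuous_intros)
  have cD: "continuous_on UNIV (slope \<gamma> \<gamma>')" by (rule continuous_on_slope[OF der cont])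
  have cE: "continuous_on UNIV (slope cis1 (\<lambda>t. 2 * pi * \<i> * cis1 t))"
    by (rule continuous_on_slope[OF cis1_has_vector_derivative]) (intro continuous_intros)
  have ne: "cis1 s \<noteq> cis1 t" if "s \<noteq> t" "\<bar>t - s\<bar> < 1" for s t
    using that by (auto simp: cis1_eq_iff)
  have c0: "continuous_on (U 0) chord"
  proof (rule continuous_on_eq)
    show "continuous_on (U 0) (\<lambda>x. slope \<gamma> \<gamma>' x / slope cis1 (\<lambda>t. 2 * pi * \<i> * cis1 t) x)"
      by (intro continuous_on_divide continuous_on_subset[OF cD] continuous_on_subset[OF cE])
         (use ne in \<open>auto simp: U_def slope_def\<close>)
    show "slope \<gamma> \<gamma>' x / slope cis1 (\<lambda>t. 2 * pi * \<i> * cis1 t) x = chord x" if "x \<in> U 0" for x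
      using that ne[of "fst x" "snd x"] by (cases x) (auto simp: U_def slope_def chord_def)
  qed
  have ck: "continuous_on (U k) chord" for k
  proof (rule continuous_on_eq)
    show "continuous_on (U k) (\<lambda>x. chord (fst x, snd x - of_int k))"
      by (intro continuous_on_compose2[OF c0] continuous_intros) (auto simp: U_def algebra_simps)
    show "chord (fst x, snd x - of_int k) = chord x" if "x \<in> U k" for x
      using chord_add_int[of "fst x" "snd x - of_int k" k] by (cases x) simp
  qed
  have "(\<Union>k. U k) = UNIV"
  proof -
    have "x \<in> U (round (snd x - fst x))" for x
      using of_int_round_abs_le[of "snd x - fst x"] by (simp add: U_def abs_minus_commute)
    then show ?thesis by blast
  qed
  moreover have "continuous_on (\<Union>k. U k) chord"
    by (rule continuous_on_open_UN) (use op ck in auto)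
  ultimately show ?thesis by simp
qed

text \<open>From \<open>(0, 0)\<close> to \<open>(1, 1)\<close> along the diagonal, a logarithm of
  \<open>chord\<close> grows as much as along the sides through \<open>(1, 0)\<close>; by symmetry
  and periodicity each side contributes \<open>d\<close>. The additional 1 is the turning of the
  tangent of the unit circle.\<close>

lemma rotation_eq_chord_degree:
  obtains d :: int and q where "continuous_on UNIV q" "\<And>t. chord (0, t) = exp (q t)"
    "q 1 - q 0 = 2 * pi * \<i> * d" "winding_number \<gamma>' 0 = 2 * d + 1"
proof -
  obtain L where L: "continuous_on UNIV L" "\<And>x. chord x = exp (L x)"
    using continuous_logarithm_on_contractible[OF continuous_on_chord]
    by (metis UNIV_I chord_ne_0 contractible_UNIV)
  note cL = continuous_on_compose2[OF L(1)]
  obtain k :: int where k: "L (snd x, fst x) = L x + 2 * pi * \<i> * of_int k" for x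
    by (rule continuous_log_unique[of UNIV "\<lambda>x. L (snd x, fst x)" L])
       (use L(2) chord_commute in \<open>auto intro!: cL continuous_intros L(1) simp flip: L(2)\<close>)
  \<comment> \<open>The swap fixes the diagonal, so the constant integer is 0.\<close>
  from k[of "(0, 0)"] have "k = 0" by simp
  with k[of "(0, 1)"] have sym: "L (1, 0) = L (0, 1)" by simp
  obtain d :: int where d: "L (s, 1) = L (s, 0) + 2 * pi * \<i> * of_int d" for s
    by (rule continuous_log_unique[of UNIV "\<lambda>s. L (s, 1)" "\<lambda>s. L (s, 0)"])
       (use chord_add_int[of _ 0 1] in \<open>auto intro!: cL continuous_intros simp flip: L(2)\<close>)
  have \<gamma>': "\<gamma>' t = 0 + exp (Ln (2 * pi * \<i>) + 2 * pi * \<i> * t + L (t, t))" for t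
  proof -
    have "\<gamma>' t = 2 * pi * \<i> * cis1 t * chord (t, t)" by (simp add: chord_def)
    also have "\<dots> = exp (Ln (2 * pi * \<i>) + 2 * pi * \<i> * t + L (t, t))"
      by (simp add: exp_add exp_Ln cis1_def L(2))
    finally show ?thesis by simp
  qed
  have "winding_number \<gamma>' 0 = ((Ln (2 * pi * \<i>) + 2 * pi * \<i> * (1::real) + L (1, 1)) - (Ln (2 * pi * \<i>) + 2 * pi * \<i> * (0::real) + L (0, 0))) / (2 * pi * \<i>)"
    by (rule winding_number_continuous_log[OF _ \<gamma>']) (intro continuous_intros cL; simp)
  also have "\<dots> = 2 * d + 1"
    using d[of 0] d[of 1] sym by (simp add: field_simps)
  finally have "winding_number \<gamma>' 0 = 2 * d + 1" .
  moreover have "continuous_on UNIV (\<lambda>t. L (0, t))" by (intro continuous_intros cL) auto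
  moreover have "L (0, 1) - L (0, 0) = 2 * pi * \<i> * d" using d[of 0] by simp
  ultimately show ?thesis using that[of "\<lambda>t. L (0, t)" d] L(2) by auto
qed

end

section \<open>Winding numbers on the two sides of the curve\<close>

lemma norm_cis1 [simp]: "norm (cis1 t) = 1"
  unfolding cis1_def by (subst norm_exp_eq_Re) simp

lemma cis1_circle_ne:
  assumes "\<bar>s\<bar> < 1" "\<not> (cis1 t = 1 \<and> s = 0)"
  shows "cis1 t - 1 + of_real s \<noteq> 0"
proof
  assume "cis1 t - 1 + of_real s = 0"
  then have "cis1 t = of_real (1 - s)" by (simp add: algebra_simps add_eq_0_iff)
  moreover from this have "\<bar>1 - s\<bar> = 1" using norm_cis1[of t] by (simp only: norm_of_real)
  ultimately show False using assms by auto
qed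

lemma cis1_eq_circlepath: "cis1 = circlepath 0 1"
  by (simp add: fun_eq_iff cis1_def circlepath)

text \<open>The model case: \<open>1 - s\<close> is the base point of the unit circle pushed by
  \<open>s\<close>, inside for \<open>s > 0\<close> and outside for \<open>s < 0\<close>.\<close>

lemma winding_number_cis1:
  assumes "\<bar>s\<bar> < 1" "s \<noteq> 0"
  shows "winding_number cis1 (of_real (1 - s)) = (if s > 0 then 1 else 0)"
proof (cases "s > 0")
  case True
  have "winding_number (circlepath 0 1) (of_real (1 - s)) = 1"
    by (rule winding_number_circlepath) (use assms True in \<open>simp del: of_real_diff\<close>)
  then show ?thesis using True by (simp add: cis1_eq_circlepath)
next
  case False
  have "winding_number (circlepath 0 1) (of_real (1 - s)) = 0"
    by (rule winding_number_zero_outside[where s = "cball 0 1"])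
       (use assms False in \<open>auto simp: path_image_circlepath simp del: of_real_diff\<close>)
  then show ?thesis using False by (simp add: cis1_eq_circlepath)
qed

context simple_periodic_C1
begin

text \<open>\<^term>\<open>push s\<close> lies to the left of the curve at \<^term>\<open>\<gamma> 0\<close> for small \<open>s > 0\<close> and to its right for \<open>s < 0\<close>.\<close>

definition push :: "real \<Rightarrow> complex" where
  "push s = \<gamma> 0 + \<i> * \<gamma>' 0 * of_real s / (2 * pi)"

text \<open>The chord map with its base point moved off the curve, divided by its analogue for the
  unit circle, where the pushed point is \<open>1 - s\<close>. The \<open>2 * pi\<close> in
  \<open>push\<close> gives the two displacements the ratio
  \<open>\<gamma>' 0 / (2 * pi * \<i>)\<close>, the value chosen at the common zero.\<close>

definition pushed_chord :: "real \<times> real \<Rightarrow> complex" where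
  "pushed_chord = (\<lambda>(t, s). if cis1 t = 1 \<and> s = 0 then \<gamma>' 0 / (2 * pi * \<i>)
     else (\<gamma> t - push s) / (cis1 t - 1 + of_real s))"

lemma pushed_chord_0: "pushed_chord (t, 0) = chord (0, t)"
  using eq_iff_cis1[of t 0] by (auto simp: pushed_chord_def chord_def push_def)

lemma pushed_chord_add_int: "pushed_chord (t + of_int k, s) = pushed_chord (t, s)"
  by (simp add: pushed_chord_def)

text \<open>In \<open>\<gamma> t - push s - c * D\<close> the displacements cancel, leaving
  \<open>t * (A t - c * E t)\<close>. Since \<open>|t| \<le> norm D\<close> near the origin, the
  deviation from \<open>c\<close> is at most \<open>norm (A t - c * E t)\<close>, which tends to 0
  with \<open>t\<close>.\<close>

lemma isCont_pushed_chord_origin: "isCont pushed_chord (0, 0)"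
proof -
  let ?E' = "\<lambda>t. 2 * pi * \<i> * cis1 t"
  define A where "A = (\<lambda>t. slope \<gamma> \<gamma>' (0, t))"
  define E where "E = (\<lambda>t. slope cis1 ?E' (0, t))"
  define c where "c = \<gamma>' 0 / (2 * pi * \<i>)"
  have cA: "continuous_on UNIV A" unfolding A_def
    by (rule continuous_on_compose2[OF continuous_on_slope[OF der cont]]) (auto intro!: continuous_intros)
  have cE: "continuous_on UNIV E" unfolding E_def
    by (rule continuous_on_compose2[OF continuous_on_slope[OF cis1_has_vector_derivative]]) (auto intro!: continuous_intros)
  have A: "\<gamma> t = \<gamma> 0 + t * A t" and E: "cis1 t = 1 + t * E t" for t
    by (auto simp: A_def E_def slope_def)
  have E0: "E 0 = 2 * pi * \<i>" and A0: "A 0 = \<gamma>' 0" by (simp_all add: E_def A_def slope_def)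
  have tA: "(A \<longlongrightarrow> A 0) (nhds 0)" and tE: "(E \<longlongrightarrow> E 0) (nhds 0)"
    using cA cE by (auto simp: continuous_on_eq_continuous_at continuous_at tendsto_nhds_iff)
  have fst0: "filterlim fst (nhds 0) (at (0::real, 0::real))" and snd0: "filterlim snd (nhds 0) (at (0::real, 0::real))"
    using tendsto_fst[OF tendsto_ident_at, of "(0::real, 0::real)" UNIV] tendsto_snd[OF tendsto_ident_at, of "(0::real, 0::real)" UNIV] by auto
  have "((\<lambda>x. pushed_chord x - c) \<longlongrightarrow> 0) (at (0, 0))"
  proof (rule Lim_null_comparison)
    have "((\<lambda>x. norm (A (fst x) - c * E (fst x))) \<longlongrightarrow> norm (A 0 - c * E 0)) (at (0::real, 0::real))"
      by (intro tendsto_intros filterlim_compose[OF tA fst0] filterlim_compose[OF tE fst0])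
    then show "((\<lambda>x. norm (A (fst x) - c * E (fst x))) \<longlongrightarrow> 0) (at (0::real, 0::real))"
      by (simp add: A0 E0 c_def)
    have "((\<lambda>x. Im (E (fst x))) \<longlongrightarrow> Im (E 0)) (at (0::real, 0::real))"
      by (intro tendsto_intros filterlim_compose[OF tE fst0])
    \<comment> \<open>\<open>E 0 = 2 * pi * \<i>\<close>; any positive lower bound for the imaginary
      part would do, and 1 is convenient. Being real, \<open>s\<close> does not enter the imaginary
      part of the denominator.\<close>
    moreover have "Im (E 0) > 1" using pi_gt3 by (simp add: E0)
    ultimately have "eventually (\<lambda>x::real\<times>real. Im (E (fst x)) > 1) (at (0, 0))"
      by (rule order_tendstoD)
    moreover have "eventually (\<lambda>x::real\<times>real. \<bar>snd x\<bar> < 1) (at (0, 0))"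
      using order_tendstoD(2)[OF tendsto_rabs[OF snd0], of 1] by simp
    ultimately show "eventually (\<lambda>x. norm (pushed_chord x - c) \<le> norm (A (fst x) - c * E (fst x))) (at (0, 0))"
    proof eventually_elim
      case (elim x)
      obtain t s where x: "x = (t, s)" by fastforce
      show ?case
      proof (cases "cis1 t = 1 \<and> s = 0")
        case True
        then show ?thesis by (simp add: x pushed_chord_def c_def)
      next
        case False
        define D where "D = cis1 t - 1 + of_real s"
        have D0: "D \<noteq> 0" unfolding D_def by (rule cis1_circle_ne) (use elim False in \<open>auto simp: x\<close>)
        \<comment> \<open>\<open>1 / \<i> = - \<i>\<close>, so the pushed point is
          \<open>\<gamma> 0 - c * s\<close>.\<close>
        have cs: "\<i> * \<gamma>' 0 * of_real s / (2 * pi) = - (c * s)"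
          by (simp add: c_def field_simps)
        have "pushed_chord x = (\<gamma> t - push s) / D"
          using False by (simp only: x pushed_chord_def prod.case if_False D_def)
        then have "pushed_chord x - c = (\<gamma> t - push s - c * D) / D"
          using D0 by (simp add: diff_divide_distrib)
        also have "\<gamma> t - push s - c * D = t * (A t - c * E t)"
          unfolding push_def cs D_def E[of t] A[of t] by (simp add: algebra_simps)
        finally have eq: "pushed_chord x - c = t * (A t - c * E t) / D" .
        have "\<bar>t\<bar> \<le> \<bar>t * Im (E t)\<bar>" using elim by (simp add: x abs_mult mult_le_cancel_left1)
        also have "t * Im (E t) = Im D" unfolding D_def E[of t] by simp
        also have "\<bar>Im D\<bar> \<le> norm D" by (rule abs_Im_le_cmod)
        finally have "\<bar>t\<bar> \<le> norm D" .
        from mult_right_mono[OF this norm_ge_zero[of "A t - c * E t"]] show ?thesis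
          using D0 unfolding eq by (simp add: x norm_mult norm_divide divide_le_eq mult.commute)
      qed
    qed
  qed
  then have "(pushed_chord \<longlongrightarrow> c) (at (0, 0))" by (rule LIM_zero_cancel)
  moreover have "pushed_chord (0, 0) = c" by (simp add: pushed_chord_def c_def)
  ultimately show ?thesis by (simp add: continuous_at)
qed

lemma continuous_on_pushed_chord: "continuous_on (UNIV \<times> {-1<..<1}) pushed_chord"
proof -
  have "isCont pushed_chord (t, s)" if s: "\<bar>s\<bar> < 1" for t s
  proof (cases "cis1 t = 1 \<and> s = 0")
    case True
    then obtain k :: int where k: "t = of_int k" using cis1_eq_iff[of t 0] by auto
    have "isCont (\<lambda>x::real\<times>real. (fst x - of_int k, snd x)) (of_int k, 0)"
      by (intro continuous_intros)
    moreover have "isCont pushed_chord ((\<lambda>x::real\<times>real. (fst x - of_int k, snd x)) (of_int k, 0))"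
      using isCont_pushed_chord_origin by simp
    ultimately have "isCont (\<lambda>x. pushed_chord (fst x - of_int k, snd x)) (of_int k, 0)"
      by (rule isCont_o2)
    moreover have "pushed_chord (fst x - of_int k, snd x) = pushed_chord x" for x
      using pushed_chord_add_int[of "fst x - of_int k" k "snd x"] by (cases x) simp
    ultimately show ?thesis using True k by simp
  next
    case False
    let ?U = "{x::real\<times>real. cis1 (fst x) - 1 + of_real (snd x) \<noteq> 0}"
    have "continuous_on ?U (\<lambda>x. (\<gamma> (fst x) - push (snd x)) / (cis1 (fst x) - 1 + of_real (snd x)))"
      unfolding push_def by (intro continuous_intros continuous_on_compose2[OF cont_\<gamma>]) auto
    then have "continuous_on ?U pushed_chord"
      by (rule continuous_on_eq) (auto simp: pushed_chord_def)
    moreover have "open ?U" by (intro open_Collect_neq continuous_intros)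
    moreover have "(t, s) \<in> ?U" using cis1_circle_ne[OF s False] by simp
    ultimately show ?thesis by (simp add: continuous_on_eq_continuous_at)
  qed
  then show ?thesis by (force intro: continuous_at_imp_continuous_on)
qed

text \<open>For small \<open>s\<close> the quotient \<open>pushed_chord\<close> is still free of
  zeros, so its degree in \<open>t\<close> is that of \<open>chord (0, t)\<close>, namely
  \<open>d\<close>. Multiplying the circle back in adds the winding number of the circle about
  \<open>1 - s\<close>.\<close>

lemma winding_number_push:
  assumes q: "continuous_on UNIV q" "\<And>t. chord (0, t) = exp (q t)" "q 1 - q 0 = 2 * pi * \<i> * d"
  obtains \<delta> where "\<delta> > 0"
    "\<And>s. s \<noteq> 0 \<Longrightarrow> \<bar>s\<bar> \<le> \<delta> \<Longrightarrow> push s \<notin> path_image \<gamma> \<and> winding_number \<gamma> (push s) = d + (if s > 0 then 1 else 0)"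
proof -
  let ?K = "{0..1::real} \<times> {-(1/2)..1/2::real}"
  have cK: "continuous_on ?K pushed_chord"
    by (rule continuous_on_subset[OF continuous_on_pushed_chord]) auto
  have uc: "uniformly_continuous_on ?K pushed_chord"
    by (rule compact_uniformly_continuous[OF cK]) (intro compact_Times compact_Icc)
  have "\<exists>t0\<in>{0..1}. \<forall>t\<in>{0..1}. norm (chord (0, t0)) \<le> norm (chord (0, t))"
    by (rule continuous_attains_inf) (auto intro!: continuous_intros continuous_on_compose2[OF continuous_on_chord])
  then obtain t0 where t0: "\<And>t. t \<in> {0..1} \<Longrightarrow> norm (chord (0, t0)) \<le> norm (chord (0, t))" by blast
  have "norm (chord (0, t0)) > 0" using chord_ne_0 by simp
  then obtain \<epsilon> where \<epsilon>: "\<epsilon> > 0" "\<And>x y. x \<in> ?K \<Longrightarrow> y \<in> ?K \<Longrightarrow> dist y x < \<epsilon> \<Longrightarrow> dist (pushed_chord y) (pushed_chord x) < norm (chord (0, t0))"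
    using uc unfolding uniformly_continuous_on_def by metis
  define \<delta> where "\<delta> = min (1/2) (\<epsilon> / 2)"
  have \<delta>: "\<delta> > 0" "\<delta> \<le> 1/2" "\<delta> < \<epsilon>" using \<epsilon>(1) by (auto simp: \<delta>_def)
  let ?K' = "{0..1::real} \<times> {-\<delta>..\<delta>}"
  have nz': "pushed_chord x \<noteq> 0" if "x \<in> ?K'" for x
  proof
    obtain t s where x: "x = (t, s)" by fastforce
    assume "pushed_chord x = 0"
    moreover have "dist (pushed_chord (t, s)) (pushed_chord (t, 0)) < norm (chord (0, t0))"
      by (rule \<epsilon>(2)) (use that \<delta> in \<open>auto simp: x dist_Pair_Pair\<close>)
    ultimately show False using t0[of t] that by (simp add: x pushed_chord_0)
  qed
  have cK': "continuous_on ?K' pushed_chord"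
    by (rule continuous_on_subset[OF cK]) (use \<delta> in auto)
  have "contractible ?K'" by (intro convex_imp_contractible convex_Times convex_real_interval)
  then obtain M where M: "continuous_on ?K' M" "\<And>x. x \<in> ?K' \<Longrightarrow> pushed_chord x = exp (M x)"
    using continuous_logarithm_on_contractible[OF cK'] nz' by blast
  have cMt: "continuous_on {0..1} (\<lambda>t. M (t, s))" if "\<bar>s\<bar> \<le> \<delta>" for s
    by (rule continuous_on_compose2[OF M(1)]) (use that in \<open>auto intro!: continuous_intros\<close>)
  have cMs: "continuous_on {-\<delta>..\<delta>} (\<lambda>s. M (t, s))" if "t \<in> {0..1}" for t
    by (rule continuous_on_compose2[OF M(1)]) (use that in \<open>auto intro!: continuous_intros\<close>)
  \<comment> \<open>The increment of the logarithm over one period is a multiple of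
    \<open>2 * pi * \<i>\<close> and therefore the same for all \<open>s\<close>.\<close>
  obtain m :: int where m: "\<And>s. s \<in> {-\<delta>..\<delta>} \<Longrightarrow> M (1, s) = M (0, s) + 2 * pi * \<i> * of_int m"
  proof (rule continuous_log_unique[of "{-\<delta>..\<delta>}" "\<lambda>s. M (1, s)" "\<lambda>s. M (0, s)"])
    show "exp (M (1, s)) = exp (M (0, s))" if "s \<in> {-\<delta>..\<delta>}" for s
      using that M(2)[of "(1, s)"] M(2)[of "(0, s)"] pushed_chord_add_int[of 0 1 s] by simp
  qed (use cMs in auto)
  \<comment> \<open>At \<open>s = 0\<close> the map is \<open>chord (0, t)\<close>, so comparison
    with \<open>q\<close> identifies the common increment.\<close>
  obtain j :: int where j: "\<And>t. t \<in> {0..1} \<Longrightarrow> M (t, 0) = q t + 2 * pi * \<i> * of_int j"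
  proof (rule continuous_log_unique[of "{0..1}" "\<lambda>t. M (t, 0)" q])
    show "exp (M (t, 0)) = exp (q t)" if "t \<in> {0..1}" for t
      using that M(2)[of "(t, 0)"] \<delta> by (simp add: pushed_chord_0 q(2))
  qed (use cMt[of 0] \<delta> continuous_on_subset[OF q(1)] in auto)
  have md: "2 * pi * \<i> * of_int m = 2 * pi * \<i> * d"
    using j[of 0] j[of 1] m[of 0] q(3) \<delta> by (simp add: algebra_simps)
  have "push s \<notin> path_image \<gamma> \<and> winding_number \<gamma> (push s) = d + (if s > 0 then 1 else 0)"
    if s: "s \<noteq> 0" "\<bar>s\<bar> \<le> \<delta>" for s
  proof
    have s1: "\<bar>s\<bar> < 1" and sK: "s \<in> {-\<delta>..\<delta>}" using s \<delta> by auto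
    have ne: "cis1 t \<noteq> of_real (1 - s)" for t
      using cis1_circle_ne[OF s1, of t] s by (auto simp: algebra_simps)
    have "path cis1" unfolding path_def cis1_def by (intro continuous_intros)
    moreover have "of_real (1 - s) \<notin> path_image cis1" using ne unfolding path_image_def by (metis image_iff)
    ultimately obtain r where r: "path r" "pathfinish r - pathstart r = 2 * of_real pi * \<i> * winding_number cis1 (of_real (1 - s))"
       "\<And>t. t \<in> {0..1} \<Longrightarrow> cis1 t = of_real (1 - s) + exp (r t)"
      by (rule winding_number_as_continuous_log) (rule that)
    \<comment> \<open>Logarithms of the two factors, circle and quotient, add up to a logarithm of
      \<open>\<gamma> t - push s\<close>.\<close>
    have eq: "\<gamma> t = push s + exp (r t + M (t, s))" if "t \<in> {0..1}" for t
    proof -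
      have "(\<gamma> t - push s) / exp (r t) = exp (M (t, s))"
        using M(2)[of "(t, s)"] s sK that r(3)[OF that] by (simp add: pushed_chord_def)
      then show ?thesis by (simp add: exp_add field_simps)
    qed
    then show "push s \<notin> path_image \<gamma>" by (auto simp: path_image_def)
    have "winding_number \<gamma> (push s) = ((r 1 + M (1, s)) - (r 0 + M (0, s))) / (2 * pi * \<i>)"
      by (rule winding_number_continuous_log[OF _ eq])
         (use r(1) cMt[OF s(2)] in \<open>auto simp: path_def intro!: continuous_intros\<close>)
    also have "(r 1 + M (1, s)) - (r 0 + M (0, s)) = (pathfinish r - pathstart r) + 2 * pi * \<i> * d"
      using m[OF sK] md by (simp add: pathfinish_def pathstart_def)
    also have "\<dots> = 2 * pi * \<i> * (d + (if s > 0 then 1 else 0))"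
      unfolding r(2) winding_number_cis1[OF s1 s(1)] by (simp add: algebra_simps)
    finally show "winding_number \<gamma> (push s) = d + (if s > 0 then 1 else 0)" by simp
  qed
  with \<delta>(1) show ?thesis using that by blast
qed

text \<open>With \<open>d\<close> the degree of the chord map in one variable, the rotation number is \<open>2d + 1\<close>, the sum of
  the winding numbers \<open>d + 1\<close> and \<open>d\<close> on the two sides of the curve. One of these must be \<open>0\<close> and
  the other one \<open>w\<close>.\<close>

theorem umlaufsatz:
  assumes w: "\<And>z. z \<notin> path_image \<gamma> \<Longrightarrow> winding_number \<gamma> z \<in> {0, w}"
  shows "winding_number \<gamma>' 0 = w"
proof -
  obtain d :: int and q where q: "continuous_on UNIV q" "\<And>t. chord (0, t) = exp (q t)"
    "q 1 - q 0 = 2 * pi * \<i> * d" and rot: "winding_number \<gamma>' 0 = 2 * d + 1"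
    by (rule rotation_eq_chord_degree) (rule that)
  obtain \<delta> where \<delta>: "\<delta> > 0"
    "\<And>s. s \<noteq> 0 \<Longrightarrow> \<bar>s\<bar> \<le> \<delta> \<Longrightarrow> push s \<notin> path_image \<gamma> \<and> winding_number \<gamma> (push s) = of_int d + (if s > 0 then 1 else 0)"
    by (rule winding_number_push[OF q]) (rule that)
  have L: "of_int d + 1 \<in> {0, w}" using \<delta>(2)[of \<delta>] \<delta>(1) w[of "push \<delta>"] by simp
  have R: "of_int d \<in> {0, w}" using \<delta>(2)[of "-\<delta>"] \<delta>(1) w[of "push (-\<delta>)"] by simp
  show ?thesis
  proof (cases "d = 0")
    case True
    then show ?thesis using L rot by simp
  next
    case False
    then have "w = of_int d" using R by auto
    then have "complex_of_int d + 1 = 0" using L by auto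
    then have "of_int (d + 1) = (0::complex)" by simp
    then have "d + 1 = 0" by (simp only: of_int_eq_0_iff)
    then have "d = - 1" by simp
    then show ?thesis using rot \<open>w = of_int d\<close> by simp
  qed
qed

end

section \<open>From closed curves on the unit interval to periodic ones\<close>

lemma frac_eq_on_unit_interval:
  assumes "Q 0 = Q 1" "t \<in> {of_int k..of_int k + 1}"
  shows "Q (frac t) = Q (t - of_int k)"
proof (cases "t = of_int k + 1")
  case True
  then have "t = of_int (k + 1)" by simp
  then have "frac t = 0" by (simp only: frac_of_int)
  then show ?thesis using True assms(1) by simp
next
  case False
  then have "floor t = k" using assms(2) by (intro floor_unique) auto
  then show ?thesis by (simp add: frac_def)
qed

lemma continuous_on_compose_frac:
  fixes Q :: "real \<Rightarrow> 'a::topological_space"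
  assumes Q: "continuous_on {0..1} Q" "Q 0 = Q 1"
  shows "continuous_on UNIV (\<lambda>t. Q (frac t))"
proof -
  have k: "continuous_on {of_int k..of_int k + 1} (\<lambda>t. Q (frac t))" for k
  proof (rule continuous_on_eq)
    show "continuous_on {of_int k..of_int k + 1} (\<lambda>t. Q (t - of_int k))"
      by (rule continuous_on_compose2[OF Q(1)]) (auto intro!: continuous_intros)
  qed (use frac_eq_on_unit_interval[of Q, OF Q(2)] in simp)
  have "isCont (\<lambda>t. Q (frac t)) t" for t
  proof -
    define k where "k = floor t"
    have "continuous_on ({of_int (k - 1)..of_int (k - 1) + 1} \<union> {of_int k..of_int k + 1}) (\<lambda>t. Q (frac t))"
      by (intro continuous_on_closed_Un k) auto
    then have "continuous_on {of_int k - 1<..<of_int k + 1} (\<lambda>t. Q (frac t))"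
      by (rule continuous_on_subset) auto
    moreover have "t \<in> {of_int k - 1<..<of_int k + 1}" unfolding k_def by (simp; linarith)
    ultimately show ?thesis by (simp add: continuous_on_eq_continuous_at)
  qed
  then show ?thesis by (auto intro: continuous_at_imp_continuous_on)
qed

lemma has_vector_derivative_Un:
  assumes "(f has_vector_derivative d) (at x within A)" "(f has_vector_derivative d) (at x within B)"
  shows "(f has_vector_derivative d) (at x within (A \<union> B))"
  using assms unfolding has_vector_derivative_def has_derivative_within by (auto intro: Lim_Un)

text \<open>At an integer the one-sided derivatives from the two adjacent unit intervals are glued;
  they agree because \<open>P' 0 = P' 1\<close>.\<close>

lemma has_vector_derivative_compose_frac:
  fixes P P' :: "real \<Rightarrow> complex"
  assumes P: "\<And>t. t \<in> {0..1} \<Longrightarrow> (P has_vector_derivative P' t) (at t within {0..1})" and "P 0 = P 1" "P' 0 = P' 1"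
  shows "((\<lambda>t. P (frac t)) has_vector_derivative P' (frac t)) (at t)"
proof -
  have k: "((\<lambda>t. P (frac t)) has_vector_derivative P' (frac t)) (at t within {of_int k..of_int k + 1})"
    if t: "t \<in> {of_int k..of_int k + 1}" for k t
  proof -
    let ?S = "{of_int k..of_int k + (1::real)}"
    have img: "(\<lambda>s. s - of_int k) ` ?S = {0..1}"
    proof (intro equalityI subsetI)
      fix x :: real assume "x \<in> {0..1}"
      then show "x \<in> (\<lambda>s. s - of_int k) ` ?S" by (intro image_eqI[of _ _ "x + of_int k"]) auto
    qed auto
    have "((P \<circ> (\<lambda>s. s - of_int k)) has_vector_derivative 1 *\<^sub>R P' (t - of_int k)) (at t within ?S)"
    proof (rule vector_diff_chain_within)
      show "((\<lambda>s. s - of_int k) has_vector_derivative 1) (at t within ?S)"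
        by (auto intro!: derivative_eq_intros)
      show "(P has_vector_derivative P' (t - of_int k)) (at (t - of_int k) within (\<lambda>s. s - of_int k) ` ?S)"
        unfolding img by (rule P) (use t in auto)
    qed
    then have "((\<lambda>s. P (s - of_int k)) has_vector_derivative P' (frac t)) (at t within ?S)"
      using frac_eq_on_unit_interval[of P', OF assms(3) t] by (simp add: o_def)
    then show ?thesis
      by (rule has_vector_derivative_transform[rotated 2])
         (use t frac_eq_on_unit_interval[of P, OF assms(2)] in auto)
  qed
  define m where "m = floor t"
  show ?thesis
  proof (cases "t = of_int m")
    case True
    have "((\<lambda>t. P (frac t)) has_vector_derivative P' (frac t))
       (at t within ({of_int (m - 1)..of_int (m - 1) + 1} \<union> {of_int m..of_int m + 1}))"
      by (intro has_vector_derivative_Un k) (use True in auto)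
    moreover have "t \<in> interior ({of_int (m - 1)..of_int (m - 1) + 1} \<union> {of_int m..of_int m + 1})"
    proof (rule interiorI[of "{of_int m - 1<..<of_int m + 1}"])
      show "{real_of_int m - 1<..<real_of_int m + 1} \<subseteq> {of_int (m - 1)..of_int (m - 1) + 1} \<union> {of_int m..of_int m + 1}" by auto
    qed (use True in auto)
    ultimately show ?thesis by (simp only: at_within_interior)
  next
    case False
    then have "t \<in> {of_int m<..<of_int m + 1}" unfolding m_def by (simp; linarith)
    then have "t \<in> {of_int m..of_int m + 1}" "t \<in> interior {of_int m..of_int m + 1}" by auto
    with k[of t m] show ?thesis by (simp only: at_within_interior)
  qed
qed

lemma umlaufsatz_simple_closed:
  fixes P P' :: "real \<Rightarrow> complex"
  assumes der: "\<And>t. t \<in> {0..1} \<Longrightarrow> (P has_vector_derivative P' t) (at t within {0..1})"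
    and cont: "continuous_on {0..1} P'" and nz: "\<And>t. t \<in> {0..1} \<Longrightarrow> P' t \<noteq> 0"
    and simple: "simple_path P" and closed: "P 0 = P 1" "P' 0 = P' 1"
    and w: "\<And>z. z \<in> inside (path_image P) \<Longrightarrow> winding_number P z = w"
  shows "winding_number P' 0 = w"
proof -
  have path: "path P" using simple by (rule simple_path_imp_path)
  interpret simple_periodic_C1 "\<lambda>t. P (frac t)" "\<lambda>t. P' (frac t)"
  proof
    fix s t :: real
    show "((\<lambda>t. P (frac t)) has_vector_derivative P' (frac t)) (at t)"
      by (rule has_vector_derivative_compose_frac[OF der closed])
    show "continuous_on UNIV (\<lambda>t. P' (frac t))" by (rule continuous_on_compose_frac[OF cont closed(2)])
    show "P (frac (t + 1)) = P (frac t)" by (simp add: frac_1_eq)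
    show "P' (frac t) \<noteq> 0" by (rule nz) (simp add: frac_ge_0 frac_lt_1 less_imp_le)
    assume "P (frac s) = P (frac t)"
    \<comment> \<open>A fractional part is never 1, which excludes the coincidence of the end points
      that a simple path permits.\<close>
    moreover have "frac s \<in> {0..1}" "frac t \<in> {0..1}" "frac s \<noteq> 1" "frac t \<noteq> 1"
      using frac_lt_1[of s] frac_lt_1[of t] by (auto simp: frac_ge_0 less_imp_le)
    ultimately have "frac s = frac t" using simple unfolding simple_path_def loop_free_def by metis
    then have "s = t + of_int (floor s - floor t)" by (simp add: frac_def)
    then show "\<exists>k::int. s = t + of_int k" by blast
  qed
  have eq: "P (frac t) = P t" "P' (frac t) = P' t" if "0 \<le> t" "t \<le> 1" for t
    using frac_eq_on_unit_interval[of P t 0] frac_eq_on_unit_interval[of P' t 0] closed that by auto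
  have wn: "winding_number (\<lambda>t. P (frac t)) z = winding_number P z" for z
    by (rule winding_number_cong) (rule eq)
  have "winding_number (\<lambda>t. P' (frac t)) 0 = winding_number P' 0"
    by (rule winding_number_cong) (rule eq)
  moreover have "winding_number (\<lambda>t. P' (frac t)) 0 = w"
  proof (rule umlaufsatz)
    fix z assume "z \<notin> path_image (\<lambda>t. P (frac t))"
    moreover have "path_image (\<lambda>t. P (frac t)) = path_image P"
      unfolding path_image_def by (rule image_cong) (auto simp: eq)
    ultimately have "z \<in> inside (path_image P) \<union> outside (path_image P)" unfolding inside_Un_outside by simp
    then consider "z \<in> inside (path_image P)" | "z \<in> outside (path_image P)" by blast
    moreover have "winding_number P z = 0" if "z \<in> outside (path_image P)"
      by (rule winding_number_zero_in_outside[OF path _ that]) (simp add: pathfinish_def pathstart_def closed)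
    ultimately show "winding_number (\<lambda>t. P (frac t)) z \<in> {0, w}" using w[of z] wn[of z] by cases auto
  qed
  ultimately show ?thesis by simp
qed

section \<open>The function h\<close>

text \<open>The identity \<open>\<Delta> = 4 \<partial> \<partial>bar\<close>, with \<open>g\<close>
  the holomorphic derivative of the real function \<open>h\<close>. An open set is needed because
  the inner \<open>deriv\<close> must be known at all nearby points of a line.\<close>

lemma laplacian_eq_dbar:
  assumes U: "open U" "w \<in> U"
    and h: "\<And>z. z \<in> U \<Longrightarrow> has_wirtinger (\<lambda>z. complex_of_real (h z)) (g z) (cnj (g z)) z"
    and g: "has_wirtinger g a b w"
  shows "laplacian h w = 4 * Re b"
proof -
  define x y where "x = Re w" and "y = Im w"
  have w: "w = Complex x y" by (simp add: x_def y_def)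
  have hx: "((\<lambda>x. h (Complex x y)) has_real_derivative 2 * Re (g (Complex x y))) (at x)" if "Complex x y \<in> U" for x y
  proof -
    have "((\<lambda>x. complex_of_real (h (Complex x y))) has_vector_derivative (g (Complex x y) + cnj (g (Complex x y)))) (at x)"
      by (rule has_wirtinger_Re[OF h[OF that]])
    then have "((\<lambda>x. Re (complex_of_real (h (Complex x y)))) has_vector_derivative Re (g (Complex x y) + cnj (g (Complex x y)))) (at x)"
      by (rule bounded_linear.has_vector_derivative[OF bounded_linear_Re])
    then show ?thesis by (simp add: has_real_derivative_iff_has_vector_derivative)
  qed
  have hy: "((\<lambda>y. h (Complex x y)) has_real_derivative - 2 * Im (g (Complex x y))) (at y)" if "Complex x y \<in> U" for x y
  proof -
    have "((\<lambda>y. complex_of_real (h (Complex x y))) has_vector_derivative (\<i> * (g (Complex x y) - cnj (g (Complex x y))))) (at y)"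
      by (rule has_wirtinger_Im[OF h[OF that]])
    then have "((\<lambda>y. Re (complex_of_real (h (Complex x y)))) has_vector_derivative Re (\<i> * (g (Complex x y) - cnj (g (Complex x y))))) (at y)"
      by (rule bounded_linear.has_vector_derivative[OF bounded_linear_Re])
    then show ?thesis by (simp add: has_real_derivative_iff_has_vector_derivative)
  qed
  have gx: "((\<lambda>x. 2 * Re (g (Complex x y))) has_real_derivative 2 * Re (a + b)) (at x)"
  proof -
    have "((\<lambda>x. Re (g (Complex x y))) has_vector_derivative Re (a + b)) (at x)"
      by (rule bounded_linear.has_vector_derivative[OF bounded_linear_Re has_wirtinger_Re[OF g[unfolded w]]])
    then show ?thesis unfolding has_real_derivative_iff_has_vector_derivative[symmetric] by (rule DERIV_cmult)
  qed
  have gy: "((\<lambda>y. - 2 * Im (g (Complex x y))) has_real_derivative - 2 * Im (\<i> * (a - b))) (at y)"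
  proof -
    have "((\<lambda>y. Im (g (Complex x y))) has_vector_derivative Im (\<i> * (a - b))) (at y)"
      by (rule bounded_linear.has_vector_derivative[OF bounded_linear_Im has_wirtinger_Im[OF g[unfolded w]]])
    then show ?thesis unfolding has_real_derivative_iff_has_vector_derivative[symmetric] by (rule DERIV_cmult)
  qed
  have cx: "continuous_on UNIV (\<lambda>x. Complex x y)" and cy: "continuous_on UNIV (Complex x)"
    using continuous_on_Complex_line by auto
  have "open ((\<lambda>x. Complex x y) -` U)" by (rule open_vimage[OF U(1) cx])
  then have ex: "eventually (\<lambda>x. Complex x y \<in> U) (nhds x)"
    using eventually_nhds_in_open[of "(\<lambda>x. Complex x y) -` U" x] U(2) w by simp
  have "open (Complex x -` U)" by (rule open_vimage[OF U(1) cy])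
  then have ey: "eventually (\<lambda>y. Complex x y \<in> U) (nhds y)"
    using eventually_nhds_in_open[of "Complex x -` U" y] U(2) w by simp
  have "deriv (deriv (\<lambda>x. h (Complex x y))) x = deriv (\<lambda>x. 2 * Re (g (Complex x y))) x"
    by (intro deriv_cong_ev refl eventually_mono[OF ex]) (rule DERIV_imp_deriv[OF hx])
  also have "\<dots> = 2 * Re (a + b)" by (rule DERIV_imp_deriv[OF gx])
  finally have X: "deriv (deriv (\<lambda>x. h (Complex x y))) x = 2 * Re (a + b)" .
  have "deriv (deriv (\<lambda>y. h (Complex x y))) y = deriv (\<lambda>y. - 2 * Im (g (Complex x y))) y"
    by (intro deriv_cong_ev refl eventually_mono[OF ey]) (rule DERIV_imp_deriv[OF hy])
  also have "\<dots> = - 2 * Im (\<i> * (a - b))" by (rule DERIV_imp_deriv[OF gy])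
  finally show ?thesis unfolding laplacian_def using X by (simp add: x_def y_def)
qed

lemma has_wirtinger_compose_holomorphic:
  assumes f: "has_wirtinger f a b (g z)" and g: "(g has_field_derivative g') (at z)"
  shows "has_wirtinger (\<lambda>z. f (g z)) (a * g') (b * cnj g') z"
  using has_derivative_compose[OF g[unfolded has_field_derivative_def] f[unfolded has_wirtinger_def]]
  unfolding has_wirtinger_def by (simp add: mult_ac)

lemma has_wirtinger_inverse_norm:
  assumes "z \<noteq> c"
  shows "has_wirtinger (\<lambda>z. inverse (complex_of_real (norm (z - c))))
    (- cnj (z - c) / (2 * norm (z - c) ^ 3)) (- (z - c) / (2 * norm (z - c) ^ 3)) z"
proof -
  have v: "has_wirtinger (\<lambda>z. z - c) 1 0 z"
    by (rule has_wirtinger_holomorphic) (auto intro!: derivative_eq_intros)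
  have ne: "z - c \<noteq> 0" "complex_of_real (norm (z - c)) \<noteq> 0" using assms by auto
  have eq: "- (x / complex_of_real (2 * N)) * (inverse (complex_of_real N))\<^sup>2 = - x / complex_of_real (2 * N ^ 3)" for x :: complex and N
    by (simp add: power2_eq_square power3_eq_cube inverse_eq_divide mult.assoc)
  show ?thesis
  proof (rule has_wirtinger_eq[OF has_wirtinger_inverse[OF has_wirtinger_norm[OF v ne(1)] ne(2)]])
    show "- ((1 * cnj (z - c) + (z - c) * cnj 0) / complex_of_real (2 * norm (z - c))) * (inverse (complex_of_real (norm (z - c))))\<^sup>2
       = - cnj (z - c) / complex_of_real (2 * norm (z - c) ^ 3)"
      unfolding eq by simp
    show "- ((0 * cnj (z - c) + (z - c) * cnj 1) / complex_of_real (2 * norm (z - c))) * (inverse (complex_of_real (norm (z - c))))\<^sup>2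
       = - (z - c) / complex_of_real (2 * norm (z - c) ^ 3)"
      unfolding eq by simp
  qed
qed

section \<open>The function \<open>2 \<omega> - C\<close> and its derivative\<close>

lemma primary1_eq: "primary1 \<mu> = - of_real \<mu>" and primary2_eq: "primary2 \<mu> = of_real (1 - \<mu>)"
  by (simp_all add: primary1_def primary2_def complex_eq_iff)

lemma phi_eq: "phi \<mu> n w = primary2 \<mu> + (w - primary2 \<mu>) ^ n"
proof -
  have "complex_of_real (Re w + \<mu> - 1) + \<i> * complex_of_real (Im w) = w - primary2 \<mu>"
    by (simp add: primary2_eq complex_eq_iff)
  then show ?thesis by (simp only: phi_def complex_surj xi_def primary2_eq)
qed

lemma phi_has_field_derivative:
  "(phi \<mu> n has_field_derivative of_nat n * (w - primary2 \<mu>) ^ (n - 1)) (at w)"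
  unfolding phi_eq[abs_def] by (auto intro!: derivative_eq_intros)

definition excess :: "real \<Rightarrow> real \<Rightarrow> complex \<Rightarrow> real" where
  "excess \<mu> C z = 2 * omega \<mu> (Re z) (Im z) - C"

lemma excess_eq:
  "complex_of_real (excess \<mu> C z) = z * cnj z + of_real (2 * (1 - \<mu>)) * inverse (of_real (norm (z - primary1 \<mu>)))
      + of_real (2 * \<mu>) * inverse (of_real (norm (z - primary2 \<mu>))) - of_real C"
proof -
  have 1: "sqrt ((Re z + \<mu>)\<^sup>2 + (Im z)\<^sup>2) = norm (z - primary1 \<mu>)"
    and 2: "sqrt ((Re z + \<mu> - 1)\<^sup>2 + (Im z)\<^sup>2) = norm (z - primary2 \<mu>)"
    by (simp_all add: cmod_def primary1_eq primary2_eq algebra_simps)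
  have 3: "(Re z)\<^sup>2 + (Im z)\<^sup>2 = (norm z)\<^sup>2" by (simp add: cmod_power2)
  have r: "2 * (1 / 2 * a + b / x + c / y) - C = a + 2 * b * inverse x + 2 * c * inverse y - C" for a b c x y :: real
    by (simp add: inverse_eq_divide)
  show ?thesis
    unfolding excess_def omega_def 1 2 3 r complex_norm_square[symmetric]
    by (simp only: of_real_add of_real_diff of_real_mult of_real_inverse)
qed

text \<open>This is \<open>\<omega>_x - i \<omega>_y\<close>, the holomorphic derivative of
  \<open>2 \<omega> - C\<close>; its conjugate is the gradient in the equations of motion.\<close>

definition dexcess :: "real \<Rightarrow> complex \<Rightarrow> complex" where
  "dexcess \<mu> z = cnj z - of_real (1 - \<mu>) * cnj (z - primary1 \<mu>) / of_real (norm (z - primary1 \<mu>) ^ 3)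
     - of_real \<mu> * cnj (z - primary2 \<mu>) / of_real (norm (z - primary2 \<mu>) ^ 3)"

lemma has_wirtinger_excess:
  assumes "z \<noteq> primary1 \<mu>" "z \<noteq> primary2 \<mu>"
  shows "has_wirtinger (\<lambda>z. complex_of_real (excess \<mu> C z)) (dexcess \<mu> z) (cnj (dexcess \<mu> z)) z"
proof -
  have z: "has_wirtinger (\<lambda>z. z) 1 0 z" by (rule has_wirtinger_holomorphic) simp
  have E: "complex_of_real (2 * k) * (- x / complex_of_real (2 * N)) = - (complex_of_real k * x / complex_of_real N)" for k N and x :: complex
    by (simp add: mult.assoc)
  show ?thesis unfolding excess_eq
    by (rule has_wirtinger_eq[OF has_wirtinger_diff[OF has_wirtinger_add[OF has_wirtinger_add[OF
          has_wirtinger_mult[OF z has_wirtinger_cnj[OF z]]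
          has_wirtinger_mult[OF has_wirtinger_const has_wirtinger_inverse_norm[OF assms(1)]]]
          has_wirtinger_mult[OF has_wirtinger_const has_wirtinger_inverse_norm[OF assms(2)]]] has_wirtinger_const]])
       (simp_all only: E dexcess_def, simp_all)
qed

section \<open>The singularity of the derivative of \<open>h\<close> at the second primary\<close>

locale r3bp_lift =
  fixes \<mu> C :: real and n :: nat
  assumes mu: "0 < \<mu>" "\<mu> \<le> 1/2" and n: "n \<ge> 1"
begin

abbreviation p :: complex where "p \<equiv> primary2 \<mu>"

definition u :: "complex \<Rightarrow> complex" where "u w = (w - p) ^ n"

definition inv_dist1 :: "complex \<Rightarrow> complex" where "inv_dist1 w = inverse (of_real (norm (1 + u w)))"

definition regular_part :: "complex \<Rightarrow> complex" where
  "regular_part w = (p + u w) * cnj (p + u w) + of_real (2 * (1 - \<mu>)) * inv_dist1 w + of_real (- C)"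

text \<open>Half the holomorphic derivative of the regular part with respect to the variable
  \<open>phi \<mu> n w\<close>, not \<open>w\<close>.\<close>

definition regular_grad :: "complex \<Rightarrow> complex" where
  "regular_grad w = of_real (1/2) * cnj (p + u w) + of_real (- (1 - \<mu>) / 2) * (cnj (1 + u w) * inv_dist1 w ^ 3)"

text \<open>Clearing the denominator of \<open>2\<omega> - C\<close>: by \<open>excess_phi\<close> below it equals
  \<open>cleared w / (4 |w - p|\<^sup>n)\<close> at \<open>phi \<mu> n w\<close>, and \<open>cleared\<close> has no pole at \<open>p\<close>.\<close>

definition cleared :: "complex \<Rightarrow> complex" where
  "cleared w = of_real (8 * \<mu>) + 4 * (of_real (norm (w - p)) ^ n * regular_part w)"

text \<open>The set on which \<open>g0\<close> is controlled: the image avoids the first primary and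
  the cleared denominator does not vanish. It contains \<open>p\<close>, where
  \<open>cleared\<close> has the value \<open>8 * \<mu> > 0\<close>.\<close>

definition good :: "complex set" where
  "good = {w. 1 + u w \<noteq> 0} \<inter> cleared -` (-{0})"

text \<open>What remains of \<open>dh\<close> without its pole (\<open>dh_eq\<close>), arranged as a
  product to which the \<open>istame\<close> rules apply. The direction factor is the only one
  without a limit at \<open>p\<close>.\<close>

definition g0 :: "complex \<Rightarrow> complex" where
  "g0 w = of_nat n * ((of_real (norm (w - p)) * inverse (w - p)) * (of_real (norm (w - p)) ^ (n - 1) *
      ((4 * (u w * regular_grad w) + regular_part w) * inverse (cleared w))))"

lemma u_p [simp]: "u p = 0" using n by (simp add: u_def)

lemma p_minus_primary1: "p - primary1 \<mu> = 1"
  by (simp add: primary1_eq primary2_eq)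

lemma continuous_u: "continuous_on S u"
  unfolding u_def by (intro continuous_intros)

lemma open_punctured: "open {w. 1 + u w \<noteq> 0}"
  by (intro open_Collect_neq continuous_intros continuous_u)

lemma continuous_regular:
  assumes "\<And>w. w \<in> S \<Longrightarrow> 1 + u w \<noteq> 0"
  shows "continuous_on S inv_dist1" "continuous_on S regular_part" "continuous_on S cleared"
proof -
  show i: "continuous_on S inv_dist1"
    unfolding inv_dist1_def by (intro continuous_intros continuous_u) (use assms in auto)
  show r: "continuous_on S regular_part"
    unfolding regular_part_def by (intro continuous_intros continuous_u i)
  show "continuous_on S cleared"
    unfolding cleared_def by (intro continuous_intros r)
qed

lemma open_good: "open good"
  unfolding good_def by (rule continuous_open_preimage[OF continuous_regular(3) open_punctured]) auto

lemma p_in_good: "p \<in> good"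
  using mu n by (auto simp: good_def cleared_def power_0_left)

lemma istame_g0: "istame good p g0"
proof -
  note o = open_good
  have u: "istame good p u" unfolding u_def by (rule istame_power_diff)
  have u1: "istame good p (\<lambda>w. 1 + u w)" and pu: "istame good p (\<lambda>w. p + u w)"
    by (rule istame_add[OF o istame_const u])+
  have ne: "1 + u w \<noteq> 0" "cleared w \<noteq> 0" if "w \<in> good" for w using that by (auto simp: good_def)
  have i: "istame good p inv_dist1"
    unfolding inv_dist1_def
    by (rule istame_inverse[OF o p_in_good istame_norm[OF o u1]])
       (use ne in \<open>auto intro!: continuous_intros continuous_u\<close>)
  have r: "istame good p regular_part"
    unfolding regular_part_def
    by (rule istame_add[OF o istame_add[OF o istame_mult[OF o pu istame_cnj[OF o pu]] istame_mult[OF o istame_const i]] istame_const])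
  have gr: "istame good p regular_grad"
    unfolding regular_grad_def
    by (rule istame_add[OF o istame_mult[OF o istame_const istame_cnj[OF o pu]]
          istame_mult[OF o istame_const istame_mult[OF o istame_cnj[OF o u1] istame_power[OF o i]]]])
  have nm: "istame good p (\<lambda>w. of_real (norm (w - p)))"
    by (rule istame_norm[OF o istame_diff_const]) auto
  have c: "istame good p cleared"
    unfolding cleared_def
    by (rule istame_add[OF o istame_const istame_mult[OF o istame_const istame_mult[OF o istame_power[OF o nm] r]]])
  have ic: "istame good p (\<lambda>w. inverse (cleared w))"
    by (rule istame_inverse[OF o p_in_good c continuous_regular(3)]) (use ne in auto)
  show ?thesis
    unfolding g0_def
    by (rule istame_mult[OF o istame_const istame_mult[OF o istame_direction[OF o] istame_mult[OF o istame_power[OF o nm]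
         istame_mult[OF o istame_add[OF o istame_mult[OF o istame_const istame_mult[OF o u gr]] r] ic]]]])
qed

lemma phi_minus_primary: "phi \<mu> n w - p = u w" "phi \<mu> n w - primary1 \<mu> = 1 + u w"
  using p_minus_primary1 by (simp_all add: phi_eq u_def algebra_simps)

lemma excess_phi:
  assumes "w \<noteq> p"
  shows "complex_of_real (excess \<mu> C (phi \<mu> n w)) = cleared w / (4 * of_real (norm (w - p)) ^ n)"
proof -
  have "complex_of_real (excess \<mu> C (phi \<mu> n w)) = regular_part w + of_real (2 * \<mu>) * inverse (of_real (norm (w - p)) ^ n)"
    unfolding excess_eq phi_minus_primary regular_part_def inv_dist1_def
    by (simp add: phi_eq u_def norm_power)
  then show ?thesis using assms by (simp add: cleared_def field_simps)
qed

text \<open>The chain rule for \<open>h = (1/2) ln (2 \<omega> - C)\<close> composed with the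
  holomorphic map \<open>phi\<close>.\<close>

definition dh :: "complex \<Rightarrow> complex" where
  "dh w = of_nat n * (w - p) ^ (n - 1) * dexcess \<mu> (phi \<mu> n w) / (2 * of_real (excess \<mu> C (phi \<mu> n w)))"

text \<open>Expand the fraction by \<open>4 * r ^ n\<close>. The attraction of the second primary
  leaves \<open>- 2 * \<mu>\<close> in the numerator, and writing this through
  \<open>cleared\<close> splits off the pole.\<close>

lemma dh_eq:
  assumes w: "w \<in> good" "w \<noteq> p"
  shows "dh w = g0 w - of_nat n / 4 / (w - p)"
proof -
  define v r where "v = w - p" and "r = complex_of_real (norm (w - p))"
  define A B D where "A = regular_grad w" and "B = regular_part w" and "D = cleared w"
  have nz: "v \<noteq> 0" "r \<noteq> 0" "v ^ n \<noteq> 0" "r ^ n \<noteq> 0" "D \<noteq> 0"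
    using w by (auto simp: v_def r_def D_def good_def)
  have D: "D = 8 * of_real \<mu> + 4 * (r ^ n * B)" by (simp add: D_def cleared_def r_def B_def)
  have uv: "u w = v ^ n" by (simp add: u_def v_def)
  have vn: "v ^ n = v * v ^ (n - 1)" "r ^ n = r * r ^ (n - 1)" using n by (cases n; simp)+
  \<comment> \<open>The product of \<open>v ^ n\<close> and its conjugate is
    \<open>(r ^ n)\<^sup>2\<close>; this removes the conjugate and one square of the norm.\<close>
  have cj: "cnj (v ^ n) / (r ^ n) ^ 3 = 1 / (v ^ n * r ^ n)"
  proof -
    have "v ^ n * cnj (v ^ n) = (r ^ n)\<^sup>2"
      unfolding complex_norm_square[symmetric] by (simp add: v_def r_def norm_power power_mult[symmetric] mult.commute)
    moreover have "c / R ^ 3 = 1 / (V * R)" if "V * c = R\<^sup>2" "V \<noteq> 0" "R \<noteq> 0" for c V R :: complex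
    proof -
      have "c = R\<^sup>2 / V" using that by (simp add: eq_divide_eq mult.commute)
      then show ?thesis using that by (simp add: power2_eq_square power3_eq_cube)
    qed
    ultimately show ?thesis using nz(3,4) by blast
  qed
  have dx: "dexcess \<mu> (phi \<mu> n w) = 2 * A - of_real \<mu> / (v ^ n * r ^ n)"
  proof -
    have "dexcess \<mu> (phi \<mu> n w) = 2 * A - of_real \<mu> * (cnj (v ^ n) / (r ^ n) ^ 3)"
    proof -
      have 1: "x - of_real m * y / of_real (N ^ 3) - of_real \<mu> * c / of_real (M ^ 3)
        = 2 * (of_real (1 / 2) * x + of_real (- m / 2) * (y * inverse (of_real N) ^ 3)) - of_real \<mu> * (c / of_real M ^ 3)"
        for x y c :: complex and m N M
        by (simp add: power_divide inverse_eq_divide distrib_left)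
      have 2: "phi \<mu> n w = p + u w" by (simp add: phi_eq u_def)
      have 3: "complex_of_real (norm (v ^ n)) = r ^ n" by (simp add: v_def r_def norm_power)
      show ?thesis
        unfolding dexcess_def phi_minus_primary A_def regular_grad_def inv_dist1_def 1 unfolding 2 uv 3 ..
    qed
    then show ?thesis unfolding cj by simp
  qed
  have ex: "complex_of_real (excess \<mu> C (phi \<mu> n w)) = D / (4 * r ^ n)"
    using excess_phi[OF w(2)] by (simp add: D_def r_def)
  have "dh w = of_nat n * v ^ (n - 1) * (2 * A - of_real \<mu> / (v ^ n * r ^ n)) / (2 * (D / (4 * r ^ n)))"
    unfolding dh_def dx ex v_def ..
  also have "\<dots> = of_nat n * (4 * v ^ n * A * r ^ n - 2 * of_real \<mu>) / (v * D)"
  proof -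
    have "N * W * (2 * A - m / (v * W * R)) / (2 * (D / (4 * R))) = N * (4 * (v * W) * A * R - 2 * m) / (v * D)"
      if "W \<noteq> 0" "R \<noteq> 0" for N W R m :: complex
      using that nz(1,5) by (simp add: field_simps)
    from this[of "v ^ (n - 1)" "r ^ n" "of_nat n" "of_real \<mu>"] nz show ?thesis unfolding vn(1)[symmetric] by auto
  qed
  \<comment> \<open>Substitute \<open>2 * \<mu> = D / 4 - r ^ n * B\<close>. The summand
    \<open>D / 4\<close> cancels against the denominator and becomes the pole.\<close>
  also have "4 * v ^ n * A * r ^ n - 2 * of_real \<mu> = r ^ n * (4 * (v ^ n * A) + B) - D / 4"
    unfolding D by (simp add: algebra_simps)
  also have "of_nat n * (r ^ n * (4 * (v ^ n * A) + B) - D / 4) / (v * D)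
    = of_nat n * (r * r ^ (n - 1)) * (4 * (v ^ n * A) + B) / (v * D) - of_nat n / 4 / v"
  proof -
    have "N * (X - D / 4) / (v * D) = N * X / (v * D) - N / 4 / v" for N X :: complex
      using nz(1,5) by (simp add: field_simps)
    then show ?thesis unfolding vn(2)[symmetric] by (simp only: mult.assoc)
  qed
  also have "of_nat n * (r * r ^ (n - 1)) * (4 * (v ^ n * A) + B) / (v * D) = g0 w"
    unfolding g0_def uv A_def[symmetric] B_def[symmetric] D_def[symmetric] unfolding r_def[symmetric] unfolding v_def[symmetric]
    by (simp only: divide_inverse inverse_mult_distrib mult_ac)
  finally show ?thesis by (simp only: v_def)
qed

lemma has_wirtinger_h_fun:
  assumes w: "w \<in> good" "w \<noteq> p" "excess \<mu> C (phi \<mu> n w) > 0"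
  shows "has_wirtinger (\<lambda>z. complex_of_real (h_fun \<mu> C n z)) (dh w) (cnj (dh w)) w"
proof -
  let ?E = "excess \<mu> C (phi \<mu> n w)"
  have "u w \<noteq> 0" using w(2) by (simp add: u_def)
  then have ne: "phi \<mu> n w \<noteq> primary1 \<mu>" "phi \<mu> n w \<noteq> p"
    using phi_minus_primary[of w] w(1) by (auto simp: good_def)
  have E: "has_wirtinger (\<lambda>z. complex_of_real (excess \<mu> C (phi \<mu> n z)))
     (dexcess \<mu> (phi \<mu> n w) * (of_nat n * (w - p) ^ (n - 1))) (cnj (dexcess \<mu> (phi \<mu> n w)) * cnj (of_nat n * (w - p) ^ (n - 1))) w"
    by (rule has_wirtinger_compose_holomorphic[OF has_wirtinger_excess[OF ne] phi_has_field_derivative])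
  have ln: "((\<lambda>x. ln (sqrt x)) has_real_derivative 1 / (2 * ?E)) (at ?E)"
    using w(3) by (auto intro!: derivative_eq_intros simp: field_simps)
  have h: "h_fun \<mu> C n z = ln (sqrt (excess \<mu> C (phi \<mu> n z)))" for z
    by (simp add: h_fun_def f_tilde_def f_speed_def excess_def)
  show ?thesis unfolding h
    by (rule has_wirtinger_eq[OF has_wirtinger_real_compose[OF E ln]]) (simp_all add: dh_def)
qed

end

section \<open>Periodic orbits\<close>

lemma has_vector_derivative_Complex:
  assumes "(f has_real_derivative f') (at t)" "(g has_real_derivative g') (at t)"
  shows "((\<lambda>t. Complex (f t) (g t)) has_vector_derivative Complex f' g') (at t)"
proof -
  have "((\<lambda>t. of_real (f t) + \<i> * of_real (g t)) has_vector_derivative of_real f' + \<i> * of_real g') (at t)"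
    using has_vector_derivative_of_real[OF assms(1)] has_vector_derivative_of_real[OF assms(2)]
    by (intro has_vector_derivative_add has_vector_derivative_mult_right)
  then show ?thesis by (simp add: Complex_eq)
qed

text \<open>One setting for both orientations; it is instantiated with \<open>w = -1\<close> and
  \<open>w = 1\<close>.\<close>

locale r3bp_orbit = r3bp_lift +
  fixes T :: real and \<alpha> \<beta> :: "real \<Rightarrow> complex" and \<Omega> :: "complex set" and w :: real
  assumes T: "T > 0"
    and sol: "r3bp_solution \<mu> \<alpha>"
    and jacobi: "has_jacobi_integral \<mu> \<alpha> C"
    and periodic: "\<And>t. \<alpha> (t + T) = \<alpha> t"
    and lift: "n_simple_with_lifting n p T \<alpha> \<beta>"
    and Omega: "\<Omega> = enclosed_region T \<beta>"
    and h_defined: "\<And>z. z \<in> \<Omega> - {p} \<Longrightarrow> f_tilde \<mu> C n z > 0"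
    and wn_Omega: "\<And>z. z \<in> \<Omega> \<Longrightarrow> winding_number (unit_path T \<beta>) z = of_real w"
    and phi_Omega: "phi \<mu> n ` \<Omega> \<subseteq> U_region \<mu> C \<union> {p}"
begin

definition y1' :: "real \<Rightarrow> real" where "y1' t = deriv (\<lambda>s. Re (\<alpha> s)) t"
definition y2' :: "real \<Rightarrow> real" where "y2' t = deriv (\<lambda>s. Im (\<alpha> s)) t"
definition \<alpha>' :: "real \<Rightarrow> complex" where "\<alpha>' t = Complex (y1' t) (y2' t)"
text \<open>The equations of motion in complex form: gradient of \<open>\<omega>\<close> plus the
  Coriolis term \<open>- 2 * \<i> * \<alpha>'\<close>.\<close>

definition \<alpha>'' :: "real \<Rightarrow> complex" where "\<alpha>'' t = cnj (dexcess \<mu> (\<alpha> t)) - 2 * \<i> * \<alpha>' t"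

lemma \<alpha>_ne: "\<alpha> t \<noteq> primary1 \<mu>" "\<alpha> t \<noteq> p"
  using sol unfolding r3bp_solution_def Let_def by auto

lemma \<alpha>_deriv: "(\<alpha> has_vector_derivative \<alpha>' t) (at t)"
proof -
  have "((\<lambda>s. Re (\<alpha> s)) has_real_derivative y1' t) (at t)" "((\<lambda>s. Im (\<alpha> s)) has_real_derivative y2' t) (at t)"
    using sol unfolding r3bp_solution_def Let_def y1'_def y2'_def
    by (auto simp: DERIV_deriv_iff_field_differentiable)
  from has_vector_derivative_Complex[OF this] show ?thesis by (simp add: \<alpha>'_def)
qed

lemma omega_partials:
  assumes "z \<noteq> primary1 \<mu>" "z \<noteq> p"
  shows "deriv (\<lambda>x. omega \<mu> x (Im z)) (Re z) = Re (dexcess \<mu> z)"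
    and "deriv (\<lambda>y. omega \<mu> (Re z) y) (Im z) = - Im (dexcess \<mu> z)"
proof -
  have w: "has_wirtinger (\<lambda>z. complex_of_real (excess \<mu> 0 z)) (dexcess \<mu> z) (cnj (dexcess \<mu> z)) (Complex (Re z) (Im z))"
    using has_wirtinger_excess[OF assms] by simp
  have "((\<lambda>x. Re (complex_of_real (excess \<mu> 0 (Complex x (Im z))))) has_vector_derivative
      Re (dexcess \<mu> z + cnj (dexcess \<mu> z))) (at (Re z))"
    by (rule bounded_linear.has_vector_derivative[OF bounded_linear_Re has_wirtinger_Re[OF w]])
  then have "((\<lambda>x. 2 * omega \<mu> x (Im z)) has_real_derivative 2 * Re (dexcess \<mu> z)) (at (Re z))"
    by (simp add: has_real_derivative_iff_has_vector_derivative excess_def)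
  from DERIV_cmult[OF this, of "1/2"] show "deriv (\<lambda>x. omega \<mu> x (Im z)) (Re z) = Re (dexcess \<mu> z)"
    by (simp add: DERIV_imp_deriv)
  have "((\<lambda>y. Re (complex_of_real (excess \<mu> 0 (Complex (Re z) y)))) has_vector_derivative
      Re (\<i> * (dexcess \<mu> z - cnj (dexcess \<mu> z)))) (at (Im z))"
    by (rule bounded_linear.has_vector_derivative[OF bounded_linear_Re has_wirtinger_Im[OF w]])
  then have "((\<lambda>y. 2 * omega \<mu> (Re z) y) has_real_derivative - 2 * Im (dexcess \<mu> z)) (at (Im z))"
    by (simp add: has_real_derivative_iff_has_vector_derivative excess_def)
  from DERIV_cmult[OF this, of "1/2"] show "deriv (\<lambda>y. omega \<mu> (Re z) y) (Im z) = - Im (dexcess \<mu> z)"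
    by (simp add: DERIV_imp_deriv)
qed

lemma \<alpha>'_deriv: "(\<alpha>' has_vector_derivative \<alpha>'' t) (at t)"
proof -
  have "(y1' has_real_derivative (Re (dexcess \<mu> (\<alpha> t)) + 2 * y2' t)) (at t)"
       "(y2' has_real_derivative (- Im (dexcess \<mu> (\<alpha> t)) - 2 * y1' t)) (at t)"
    using spec[OF sol[unfolded r3bp_solution_def Let_def], of t] omega_partials[OF \<alpha>_ne, of t]
    by (simp_all add: y1'_def[abs_def] y2'_def[abs_def])
  from has_vector_derivative_Complex[OF this]
  have "((\<lambda>t. Complex (y1' t) (y2' t)) has_vector_derivative Complex (Re (dexcess \<mu> (\<alpha> t)) + 2 * y2' t) (- Im (dexcess \<mu> (\<alpha> t)) - 2 * y1' t)) (at t)" .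
  moreover have "Complex (Re (dexcess \<mu> (\<alpha> t)) + 2 * y2' t) (- Im (dexcess \<mu> (\<alpha> t)) - 2 * y1' t) = \<alpha>'' t"
    by (simp add: \<alpha>''_def \<alpha>'_def complex_eq_iff)
  ultimately show ?thesis by (simp add: \<alpha>'_def[abs_def])
qed

lemma excess_\<alpha>: "excess \<mu> C (\<alpha> t) = (norm (\<alpha>' t))\<^sup>2"
  using jacobi unfolding has_jacobi_integral_def
  by (simp add: excess_def cmod_power2 \<alpha>'_def y1'_def y2'_def) (metis (no_types) add.commute add_diff_cancel_left' diff_add_cancel diff_minus_eq_add minus_diff_eq)

lemma cont_\<alpha>: "continuous_on S \<alpha>" "continuous_on S \<alpha>'"
  using \<alpha>_deriv \<alpha>'_deriv by (auto intro!: continuous_on_vector_derivative intro: has_vector_derivative_at_within)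

lemma cont_\<alpha>'': "continuous_on S \<alpha>''"
  unfolding \<alpha>''_def dexcess_def
  by (intro continuous_intros cont_\<alpha>) (use \<alpha>_ne in auto)

lemma \<alpha>'_periodic: "\<alpha>' (t + T) = \<alpha>' t"
proof -
  have "((\<alpha> \<circ> (\<lambda>s. s + T)) has_vector_derivative 1 *\<^sub>R \<alpha>' (t + T)) (at t)"
    by (rule vector_diff_chain_at) (auto intro!: derivative_eq_intros \<alpha>_deriv)
  moreover have "\<alpha> \<circ> (\<lambda>s. s + T) = \<alpha>" using periodic by auto
  ultimately show ?thesis using vector_derivative_unique_at[OF \<alpha>_deriv[of t]] by simp
qed

section \<open>The lifted curve and its rotation number\<close>

abbreviation P :: "real \<Rightarrow> complex" where "P \<equiv> unit_path T \<beta>"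

text \<open>Solving the chain rule for \<open>\<alpha> = p + (\<beta> - p) ^ n\<close> for the
  derivative of the lifting. This form makes continuity and periodicity of the derivative visible,
  neither of which is part of the definition of a lifting.\<close>

definition P' :: "real \<Rightarrow> complex" where
  "P' s = of_real T * \<alpha>' (T * s) / (of_nat n * (P s - p) ^ (n - 1))"

lemma simple_P: "simple_path P" and closed_P: "P 1 = P 0" and p_inside: "p \<in> inside (path_image P)"
  and \<alpha>_eq: "t \<in> {0..T} \<Longrightarrow> \<alpha> t = p + (\<beta> t - p) ^ n"
  using lift unfolding n_simple_with_lifting_def simple_regular_closed_curve_def enclosed_region_def
  by (auto simp: pathfinish_def pathstart_def)

lemma Omega_eq: "\<Omega> = inside (path_image P)" by (simp add: Omega enclosed_region_def)

lemma p_Omega: "p \<in> \<Omega>" using p_inside Omega_eq by simp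

lemma p_notin_path: "p \<notin> path_image P"
  using p_inside inside_no_overlap by blast

lemma Tt: "t \<in> {0..1} \<Longrightarrow> T * t \<in> {0..T}" using T by (auto simp: mult_left_le)

lemma \<alpha>_P: "t \<in> {0..1} \<Longrightarrow> \<alpha> (T * t) = phi \<mu> n (P t)"
  using \<alpha>_eq[OF Tt] by (simp add: unit_path_def phi_eq)

lemma P_ne_p: "t \<in> {0..1} \<Longrightarrow> P t \<noteq> p"
  using p_notin_path imageI[of t "{0..1}" P] unfolding path_image_def by metis

lemma P_deriv:
  assumes t: "t \<in> {0..1}"
  shows "(P has_vector_derivative P' t) (at t within {0..1})" "P' t \<noteq> 0"
proof -
  obtain d where d: "d \<noteq> 0" "(\<beta> has_vector_derivative d) (at (T * t) within {0..T})"
    using lift Tt[OF t] unfolding n_simple_with_lifting_def simple_regular_closed_curve_def by blast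
  have img: "(\<lambda>s. T * s) ` {0..1} = {0..T}" using T by (simp add: image_mult_atLeastAtMost)
  have "((\<beta> \<circ> (\<lambda>s. T * s)) has_vector_derivative T *\<^sub>R d) (at t within {0..1})"
  proof (rule vector_diff_chain_within)
    show "((*) T has_vector_derivative T) (at t within {0..1})"
      by (auto intro!: derivative_eq_intros)
    show "(\<beta> has_vector_derivative d) (at (T * t) within (*) T ` {0..1})" unfolding img by (rule d)
  qed
  then have P1: "(P has_vector_derivative of_real T * d) (at t within {0..1})"
    by (simp add: unit_path_def[abs_def] o_def scaleR_conv_of_real)
  have "((\<lambda>z. p + (z - p) ^ n) has_field_derivative of_nat n * (P t - p) ^ (n - 1)) (at (P t))"
    by (auto intro!: derivative_eq_intros)
  from field_vector_diff_chain_within[OF P1 has_field_derivative_at_within[OF this]]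
  have "((\<lambda>s. p + (P s - p) ^ n) has_vector_derivative of_real T * d * (of_nat n * (P t - p) ^ (n - 1))) (at t within {0..1})"
    by (simp add: o_def)
  then have 1: "((\<lambda>s. \<alpha> (T * s)) has_vector_derivative of_real T * d * (of_nat n * (P t - p) ^ (n - 1))) (at t within {0..1})"
    by (rule has_vector_derivative_transform[rotated 2]) (use t \<alpha>_eq[OF Tt] in \<open>auto simp: unit_path_def\<close>)
  have "((\<alpha> \<circ> (\<lambda>s. T * s)) has_vector_derivative T *\<^sub>R \<alpha>' (T * t)) (at t)"
    by (rule vector_diff_chain_at) (auto intro!: derivative_eq_intros \<alpha>_deriv)
  then have 2: "((\<lambda>s. \<alpha> (T * s)) has_vector_derivative of_real T * \<alpha>' (T * t)) (at t within {0..1})"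
    by (auto simp: o_def scaleR_conv_of_real intro: has_vector_derivative_at_within)
  \<comment> \<open>Two derivatives of the same rescaled orbit have been found; they agree since the
    interval has no isolated points.\<close>
  have "at t within {0..1} \<noteq> bot" using t by (simp add: trivial_limit_within islimpt_Icc)
  then have "of_real T * \<alpha>' (T * t) = of_real T * d * (of_nat n * (P t - p) ^ (n - 1))"
    using 1 2 vector_derivative_unique_within by blast
  then have eq: "P' t = of_real T * d" using n P_ne_p[OF t] by (simp add: P'_def field_simps)
  show "(P has_vector_derivative P' t) (at t within {0..1})" using P1 eq by simp
  show "P' t \<noteq> 0" using eq d T by simp
qed

lemma P'_mult: "t \<in> {0..1} \<Longrightarrow> of_nat n * (P t - p) ^ (n - 1) * P' t = of_real T * \<alpha>' (T * t)"
  using P_ne_p n by (simp add: P'_def)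

lemma cont_P: "continuous_on {0..1} P"
  by (rule continuous_on_vector_derivative[OF P_deriv(1)])

lemma cont_P': "continuous_on {0..1} P'"
  unfolding P'_def by (intro continuous_intros cont_P continuous_on_compose2[OF cont_\<alpha>(2)]) (use P_ne_p n in auto)

lemma \<alpha>'_ne_0: "t \<in> {0..1} \<Longrightarrow> \<alpha>' (T * t) \<noteq> 0"
  using P'_mult[of t] P_deriv(2)[of t] P_ne_p[of t] n T by auto

lemma P'_closed: "P' 1 = P' 0"
  using \<alpha>'_periodic[of 0] closed_P by (simp add: P'_def)

lemma tangent_winding_number: "winding_number P' 0 = w"
  by (rule umlaufsatz_simple_closed[OF P_deriv(1) cont_P' P_deriv(2) simple_P])
     (use closed_P P'_closed wn_Omega Omega_eq in auto)

lemma velocity_winding_number: "winding_number (\<lambda>s. \<alpha>' (T * s)) 0 = of_nat n * w"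
proof -
  have path: "path P" "path P'" using cont_P cont_P' by (auto simp: path_def)
  obtain q where q: "path q" "pathfinish q - pathstart q = 2 * of_real pi * \<i> * winding_number P p"
      "\<And>t. t \<in> {0..1} \<Longrightarrow> P t = p + exp (q t)"
    by (rule winding_number_as_continuous_log[OF path(1) p_notin_path]) (rule that)
  have "0 \<notin> path_image P'" using P_deriv(2) by (auto simp: path_image_def)
  then obtain r where r: "path r" "pathfinish r - pathstart r = 2 * of_real pi * \<i> * winding_number P' 0"
      "\<And>t. t \<in> {0..1} \<Longrightarrow> P' t = 0 + exp (r t)"
    by (rule winding_number_as_continuous_log[OF path(2)]) (rule that)
  \<comment> \<open>The constant factor \<open>n / T\<close> in \<open>\<alpha>'\<close>; its
    logarithm drops out of the increment over the period.\<close>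
  define c where "c = Ln (of_nat n / of_real T)"
  have c: "exp c = of_nat n / of_real T" using n T by (simp add: c_def)
  have "winding_number (\<lambda>s. \<alpha>' (T * s)) 0 =
     ((c + of_nat (n - 1) * q 1 + r 1) - (c + of_nat (n - 1) * q 0 + r 0)) / (2 * pi * \<i>)"
  proof (rule winding_number_continuous_log)
    show "continuous_on {0..1} (\<lambda>s. c + of_nat (n - 1) * q s + r s)"
      using q(1) r(1) by (intro continuous_intros) (auto simp: path_def)
    show "\<alpha>' (T * t) = 0 + exp (c + of_nat (n - 1) * q t + r t)" if t: "t \<in> {0..1}" for t
    proof -
      have "exp (q t) = P t - p" "exp (r t) = P' t" using q(3)[OF t] r(3)[OF t] by auto
      then have "exp (c + of_nat (n - 1) * q t + r t) = of_nat n / of_real T * (P t - p) ^ (n - 1) * P' t"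
        by (simp add: exp_add exp_of_nat_mult c)
      also have "\<dots> = \<alpha>' (T * t)" using P'_mult[OF t] T by (simp add: field_simps)
      finally show ?thesis by simp
    qed
  qed
  also have "(c + of_nat (n - 1) * q 1 + r 1) - (c + of_nat (n - 1) * q 0 + r 0)
     = of_nat (n - 1) * (pathfinish q - pathstart q) + (pathfinish r - pathstart r)"
    by (simp add: pathfinish_def pathstart_def algebra_simps)
  also have "\<dots> = 2 * pi * \<i> * (of_nat n * w)"
    unfolding q(2) r(2) tangent_winding_number using wn_Omega[OF p_Omega] n
    by (simp add: of_nat_diff algebra_simps)
  finally show ?thesis by simp
qed

end

section \<open>Green's theorem on the region enclosed by the lifting\<close>

context r3bp_orbit
begin

definition K :: "complex set" where "K = path_image P \<union> \<Omega>"

lemma compact_K: "compact K"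
proof -
  have "path P" using simple_P by (rule simple_path_imp_path)
  moreover have "K = path_image P \<union> inside (path_image P)" unfolding K_def by (rule arg_cong[OF Omega_eq])
  ultimately have "closed K" "bounded K"
    by (simp_all add: closed_path_image_Un_inside bounded_path_image bounded_inside)
  then show ?thesis by (simp add: compact_eq_bounded_closed)
qed

text \<open>In the region positivity comes from \<open>h_defined\<close>; on the curve the value is
  the squared speed of the orbit, which is nonzero because the lifting is regular.\<close>

lemma excess_pos: "z \<in> K \<Longrightarrow> z \<noteq> p \<Longrightarrow> excess \<mu> C (phi \<mu> n z) > 0"
proof -
  assume z: "z \<in> K" "z \<noteq> p"
  show ?thesis
  proof (cases "z \<in> \<Omega>")
    case True
    then have "sqrt (excess \<mu> C (phi \<mu> n z)) > 0"
      using h_defined[of z] z(2) by (simp add: f_tilde_def f_speed_def excess_def)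
    then show ?thesis by simp
  next
    case False
    then obtain t where t: "t \<in> {0..1}" "z = P t" using z by (auto simp: K_def path_image_def)
    then show ?thesis using \<alpha>'_ne_0[OF t(1)] excess_\<alpha>[of "T * t"] \<alpha>_P[OF t(1)] by simp
  qed
qed

text \<open>Positivity of \<open>f_tilde\<close> does not exclude the first primary, where the total
  function \<open>omega\<close> has a finite default value. In the region \<open>U_region\<close>
  excludes it, on the curve the equations of motion do.\<close>

lemma phi_ne_primary1:
  assumes z: "z \<in> K" shows "phi \<mu> n z \<noteq> primary1 \<mu>"
proof (cases "z \<in> \<Omega>")
  case True
  then have "phi \<mu> n z \<in> U_region \<mu> C \<union> {p}" using phi_Omega by blast
  moreover have "p \<noteq> primary1 \<mu>" using p_minus_primary1 by auto
  ultimately show ?thesis by (auto simp: U_region_def)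
next
  case False
  then obtain t where t: "t \<in> {0..1}" "z = P t" using z by (auto simp: K_def path_image_def)
  then show ?thesis using \<alpha>_ne(1)[of "T * t"] \<alpha>_P[OF t(1)] by simp
qed

lemma K_good: "K \<subseteq> good"
proof
  fix z assume z: "z \<in> K"
  show "z \<in> good"
  proof (cases "z = p")
    case False
    have "1 + u z \<noteq> 0" using phi_ne_primary1[OF z] phi_minus_primary(2)[of z] by auto
    moreover have "cleared z \<noteq> 0"
      using excess_phi[OF False] excess_pos[OF z False] by auto
    ultimately show ?thesis by (simp add: good_def)
  qed (simp add: p_in_good)
qed

lemma open_Omega: "open \<Omega>"
  unfolding Omega_eq
  by (rule open_inside, rule closed_path_image) (rule simple_path_imp_path[OF simple_P])

lemma winding_number_P:
  assumes "z \<notin> path_image P"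
  shows "winding_number P z = of_real w * indicator \<Omega> z"
proof (cases "z \<in> \<Omega>")
  case True
  then show ?thesis using wn_Omega by simp
next
  case False
  have "z \<in> inside (path_image P) \<union> outside (path_image P)" unfolding inside_Un_outside using assms by simp
  then have "z \<in> outside (path_image P)" using False Omega_eq by blast
  then have "winding_number P z = 0"
    by (intro winding_number_zero_in_outside simple_path_imp_path[OF simple_P])
       (simp_all add: pathfinish_def pathstart_def closed_P)
  then show ?thesis using False by simp
qed

text \<open>The pole by which \<open>dh\<close> and \<open>g0\<close> differ is holomorphic off
  \<open>p\<close>, so both have the same antiholomorphic derivative.\<close>

lemma laplacian_h_fun:
  assumes z: "z \<in> \<Omega> - {p}" and g0: "has_wirtinger g0 a b z"
  shows "laplacian (h_fun \<mu> C n) z = 4 * Re b"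
proof -
  let ?V = "good - {p}"
  \<comment> \<open>Off \<open>p\<close>, \<open>cleared\<close> is \<open>2 \<omega> - C\<close> at
    the image point times a positive factor, so positivity of its real part describes the domain of
    \<open>h\<close> as an open set.\<close>
  let ?U = "?V \<inter> cleared -` {y. Re y > 0}"
  have oV: "open ?V" using open_good by (simp add: open_delete)
  have oU: "open ?U"
    by (rule continuous_open_preimage[OF _ oV])
       (auto intro!: continuous_regular(3) open_halfspace_Re_gt simp: good_def)
  have U: "excess \<mu> C (phi \<mu> n y) > 0 \<longleftrightarrow> Re (cleared y) > 0" if "y \<noteq> p" for y
  proof -
    have "cleared y = complex_of_real (excess \<mu> C (phi \<mu> n y) * (4 * norm (y - p) ^ n))"
      using excess_phi[OF that] that by simp
    then have "Re (cleared y) = excess \<mu> C (phi \<mu> n y) * (4 * norm (y - p) ^ n)" by (simp only: Re_complex_of_real)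
    then show ?thesis using that by (simp add: zero_less_mult_iff)
  qed
  have zK: "z \<in> K" using z by (simp add: K_def)
  have zU: "z \<in> ?U" using K_good zK z U[of z] excess_pos[OF zK] by auto
  have zp: "z - p \<noteq> 0" using z by auto
  have "((\<lambda>y. c / (y - p)) has_field_derivative - c / (z - p)\<^sup>2) (at z)" for c
    using zp by (auto intro!: derivative_eq_intros simp: power2_eq_square)
  then have "((\<lambda>y. of_nat n / 4 / (y - p)) has_field_derivative - (of_nat n / 4) / (z - p)\<^sup>2) (at z)" .
  from has_wirtinger_diff[OF g0 has_wirtinger_holomorphic[OF this]]
  have "has_wirtinger (\<lambda>y. g0 y - of_nat n / 4 / (y - p)) (a - - (of_nat n / 4) / (z - p)\<^sup>2) (b - 0) z" .
  then have dh: "has_wirtinger dh (a - - (of_nat n / 4) / (z - p)\<^sup>2) (b - 0) z"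
    by (rule has_wirtinger_transform_open[OF _ oU zU]) (use dh_eq in auto)
  have "laplacian (h_fun \<mu> C n) z = 4 * Re (b - 0)"
    by (rule laplacian_eq_dbar[OF oU zU _ dh]) (use has_wirtinger_h_fun U in auto)
  then show ?thesis by simp
qed

text \<open>\<open>green_winding\<close> handles the extension of \<open>g0\<close>, and the pole
  contributes only the winding number about \<open>p\<close>. The two functions agree on the closed
  region, so boundary values and area integrand are the original ones.\<close>

lemma contour_integral_dh:
  obtains b where "set_integrable lborel (\<Omega> - {p}) b"
    "\<And>z. z \<in> \<Omega> - {p} \<Longrightarrow> laplacian (h_fun \<mu> C n) z = 4 * Re (b z)"
    "(LINT s:{0..1}|lborel. dh (P s) * P' s) = 2 * \<i> * w * (LINT z:\<Omega> - {p}|lborel. b z) - of_nat n / 4 * (2 * pi * \<i> * w)"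
proof -
  obtain a b where tm: "tame good p g0 a b" using istame_g0 unfolding istame_def by blast
  obtain g2 a2 b2 R M where pc: "punctured_C1 g2 a2 b2 p R M" and eq: "\<And>z. z \<in> K \<Longrightarrow> g2 z = g0 z" "\<And>z. z \<in> K \<Longrightarrow> b2 z = b z"
    by (rule tame_extend[OF tm open_good compact_K K_good]) (rule that)
  interpret pc: punctured_C1 g2 a2 b2 p R M by (rule pc)
  have [measurable]: "\<Omega> \<in> sets borel" using open_Omega by simp
  have ib: "set_integrable lborel (\<Omega> - {p}) b2"
    unfolding set_integrable_def by (rule integrable_mult_indicator[OF _ pc.integrable(2)]) simp
  have lap: "laplacian (h_fun \<mu> C n) z = 4 * Re (b2 z)" if "z \<in> \<Omega> - {p}" for z
  proof -
    have zK: "z \<in> K" using that by (simp add: K_def)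
    then have "has_wirtinger g0 (a z) (b z) z" using tm K_good that unfolding tame_def by blast
    from laplacian_h_fun[OF that this] show ?thesis using eq(2)[OF zK] by simp
  qed
  have "contour_integral P g2 = 2 * \<i> * of_real w * (LINT z:\<Omega>|lborel. b2 z)"
    by (rule pc.green_winding[OF P_deriv(1) cont_P' p_notin_path _ winding_number_P]) auto
  \<comment> \<open>Removing one point does not change an area integral.\<close>
  also have "(LINT z:\<Omega>|lborel. b2 z) = (LINT z:\<Omega> - {p}|lborel. b2 z)"
    unfolding set_lebesgue_integral_def
    by (rule integral_cong_AE) (use AE_lborel_singleton[of p] in \<open>auto elim!: eventually_mono simp: indicator_def\<close>)
  finally have G: "contour_integral P g2 = 2 * \<i> * of_real w * (LINT z:\<Omega> - {p}|lborel. b2 z)" .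
  have cg: "continuous_on (path_image P) g2"
    by (rule continuous_on_subset[OF pc.cont_g]) (use p_notin_path in auto)
  have ci: "continuous_on (path_image P) (\<lambda>z. 1 / (z - p))"
    using p_notin_path by (intro continuous_intros) auto
  have W: "contour_integral P (\<lambda>z. 1 / (z - p)) = 2 * pi * \<i> * w"
    using winding_number_valid_path[OF valid_path_C1[OF P_deriv(1) cont_P'] p_notin_path] wn_Omega[OF p_Omega]
    by simp
  have I1: "set_integrable lborel {0..1} (\<lambda>s. g2 (P s) * P' s)"
    by (intro borel_integrable_atLeastAtMost' continuous_intros cont_P' continuous_on_compose2[OF cg cont_P]) (auto simp: path_image_def)
  have I2: "set_integrable lborel {0..1} (\<lambda>s. of_nat n / 4 * (1 / (P s - p) * P' s))"
    by (intro borel_integrable_atLeastAtMost' continuous_intros cont_P' cont_P) (use P_ne_p in auto)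
  have "(LINT s:{0..1}|lborel. dh (P s) * P' s) = (LINT s:{0..1}|lborel. g2 (P s) * P' s - of_nat n / 4 * (1 / (P s - p) * P' s))"
  proof (rule set_lebesgue_integral_cong)
    show "\<forall>s. s \<in> {0..1} \<longrightarrow> dh (P s) * P' s = g2 (P s) * P' s - of_nat n / 4 * (1 / (P s - p) * P' s)"
    proof (intro allI impI)
      fix s :: real assume s: "s \<in> {0..1}"
      then have "P s \<in> K" by (auto simp: K_def path_image_def)
      then have "dh (P s) = g2 (P s) - of_nat n / 4 / (P s - p)"
        using dh_eq[of "P s"] K_good P_ne_p[OF s] eq(1) by auto
      then show "dh (P s) * P' s = g2 (P s) * P' s - of_nat n / 4 * (1 / (P s - p) * P' s)"
        by (simp add: left_diff_distrib)
    qed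
  qed simp
  also have "\<dots> = (LINT s:{0..1}|lborel. g2 (P s) * P' s) - (LINT s:{0..1}|lborel. of_nat n / 4 * (1 / (P s - p) * P' s))"
    by (rule set_integral_diff(2)[OF I1 I2])
  also have "(LINT s:{0..1}|lborel. of_nat n / 4 * (1 / (P s - p) * P' s)) = of_nat n / 4 * contour_integral P (\<lambda>z. 1 / (z - p))"
  proof -
    have "contour_integral P (\<lambda>z. 1 / (z - p)) = (LINT s:{0..1}|lborel. 1 / (P s - p) * P' s)"
      by (rule contour_integral_C1[OF P_deriv(1) cont_P' ci])
    then show ?thesis by (simp only: set_integral_mult_right)
  qed
  also have "(LINT s:{0..1}|lborel. g2 (P s) * P' s) = contour_integral P g2"
    by (rule contour_integral_C1[OF P_deriv(1) cont_P' cg, symmetric])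
  finally show ?thesis using that[OF ib lap] G W by simp
qed

section \<open>Turning of the velocity and the period\<close>

text \<open>The left-hand side is the rate at which the argument of the velocity changes. By the
  Jacobian integral \<open>2 \<omega> - C\<close> is \<open>(norm v)\<^sup>2\<close>, so dividing
  the force by \<open>v\<close> gives twice the conjugate of \<open>dh (P s) * P' s\<close>; the
  Coriolis term gives \<open>- 2 * T\<close>.\<close>

lemma turning_rate:
  assumes s: "s \<in> {0..1}"
  shows "Im (of_real T * \<alpha>'' (T * s) / \<alpha>' (T * s)) = - 2 * Im (dh (P s) * P' s) - 2 * T"
proof -
  define v d where "v = \<alpha>' (T * s)" and "d = dexcess \<mu> (\<alpha> (T * s))"
  have v0: "v \<noteq> 0" using \<alpha>'_ne_0[OF s] by (simp add: v_def)
  have E: "excess \<mu> C (\<alpha> (T * s)) = (norm v)\<^sup>2" by (simp add: v_def excess_\<alpha>)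
  have "dh (P s) * P' s = (of_nat n * (P s - p) ^ (n - 1) * P' s) * d / (2 * of_real ((norm v)\<^sup>2))"
    unfolding dh_def \<alpha>_P[OF s, symmetric] E d_def by simp
  then have dh: "dh (P s) * P' s = of_real T * (v * d / (2 * of_real ((norm v)\<^sup>2)))"
    unfolding P'_mult[OF s] v_def by simp
  have "\<alpha>'' (T * s) / v = cnj d / v - 2 * \<i>"
    using v0 by (simp add: \<alpha>''_def v_def[symmetric] d_def[symmetric] diff_divide_distrib)
  then have "of_real T * \<alpha>'' (T * s) / v = of_real T * (cnj d / v - 2 * \<i>)"
    by (simp only: times_divide_eq_right[symmetric])
  also have "cnj d / v = cnj (v * d) / of_real ((norm v)\<^sup>2)"
    using v0 unfolding complex_norm_square by simp
  finally have A: "of_real T * \<alpha>'' (T * s) / v = of_real T * (cnj (v * d) / of_real ((norm v)\<^sup>2) - 2 * \<i>)" .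
  have F: "Im (of_real T * (cnj x / of_real r - 2 * \<i>)) = - 2 * Im (of_real T * (x / (2 * of_real r))) - 2 * T" for x r
    by (simp add: Im_divide_of_real field_simps)
  show ?thesis unfolding v_def[symmetric] A dh by (rule F)
qed

theorem period_formula:
  assumes w: "w * w = 1"
  shows "laplacian (h_fun \<mu> C n) absolutely_integrable_on (\<Omega> - {p})"
    and "2 * T = - w * (real n * pi + integral (\<Omega> - {p}) (laplacian (h_fun \<mu> C n)))"
proof -
  obtain b where b: "set_integrable lborel (\<Omega> - {p}) b"
    "\<And>z. z \<in> \<Omega> - {p} \<Longrightarrow> laplacian (h_fun \<mu> C n) z = 4 * Re (b z)"
    "(LINT s:{0..1}|lborel. dh (P s) * P' s) = 2 * \<i> * w * (LINT z:\<Omega> - {p}|lborel. b z) - of_nat n / 4 * (2 * pi * \<i> * w)"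
    by (rule contour_integral_dh) (rule that)
  have "set_integrable lborel (\<Omega> - {p}) (\<lambda>z. Re (b z))"
    using integrable_Re[OF b(1)[unfolded set_integrable_def]] by (simp add: set_integrable_def)
  then have i4: "set_integrable lborel (\<Omega> - {p}) (\<lambda>z. 4 * Re (b z))" by simp
  have L4: "indicat_real (\<Omega> - {p}) z *\<^sub>R laplacian (h_fun \<mu> C n) z = indicat_real (\<Omega> - {p}) z *\<^sub>R (4 * Re (b z))" for z
    using b(2)[of z] by (cases "z \<in> \<Omega> - {p}") (simp_all only: indicator_simps scaleR_zero_left not_False_eq_True)
  have "integrable lborel (\<lambda>z. indicator (\<Omega> - {p}) z *\<^sub>R laplacian (h_fun \<mu> C n) z)"
    unfolding L4 using i4 by (simp only: set_integrable_def)
  then have iL: "set_integrable lborel (\<Omega> - {p}) (laplacian (h_fun \<mu> C n))" by (simp add: set_integrable_def)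
  \<comment> \<open>Absolute integrability refers to the completed measure, whereas the integrals so
    far are with respect to \<open>lborel\<close>.\<close>
  then show "laplacian (h_fun \<mu> C n) absolutely_integrable_on (\<Omega> - {p})"
    unfolding set_integrable_def by (subst integrable_completion) (auto dest: borel_measurable_integrable)
  have "integral (\<Omega> - {p}) (laplacian (h_fun \<mu> C n)) = (LINT z:\<Omega> - {p}|lborel. laplacian (h_fun \<mu> C n) z)"
    using set_borel_integral_eq_integral(2)[OF iL] by simp
  also have "\<dots> = (LINT z:\<Omega> - {p}|lborel. 4 * Re (b z))"
    by (simp only: set_lebesgue_integral_def L4)
  also have "\<dots> = 4 * (LINT z:\<Omega> - {p}|lborel. Re (b z))" by (rule set_integral_mult_right)
  also have "(LINT z:\<Omega> - {p}|lborel. Re (b z)) = Re (LINT z:\<Omega> - {p}|lborel. b z)"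
    unfolding set_lebesgue_integral_def using integral_Re[OF b(1)[unfolded set_integrable_def]] by simp
  finally have L: "integral (\<Omega> - {p}) (laplacian (h_fun \<mu> C n)) = 4 * Re (LINT z:\<Omega> - {p}|lborel. b z)" .

  let ?A = "\<lambda>s. \<alpha>' (T * s)" and ?A' = "\<lambda>s. of_real T * \<alpha>'' (T * s)"
  have Ad: "(?A has_vector_derivative ?A' s) (at s within {0..1})" for s
  proof -
    have "((\<alpha>' \<circ> (\<lambda>s. T * s)) has_vector_derivative T *\<^sub>R \<alpha>'' (T * s)) (at s)"
      by (rule vector_diff_chain_at) (auto intro!: derivative_eq_intros \<alpha>'_deriv)
    then show ?thesis by (auto simp: o_def scaleR_conv_of_real intro: has_vector_derivative_at_within)
  qed
  have cA': "continuous_on {0..1} ?A'"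
    by (intro continuous_intros continuous_on_compose2[OF cont_\<alpha>'']) auto
  have cA: "continuous_on {0..1} ?A"
    by (intro continuous_on_compose2[OF cont_\<alpha>(2)] continuous_intros) auto
  have A0: "0 \<notin> path_image ?A" using \<alpha>'_ne_0 by (auto simp: path_image_def)
  have cinv: "continuous_on (path_image ?A) (\<lambda>z. 1 / (z - 0))" using A0 by (intro continuous_intros) auto
  have "2 * pi * \<i> * (of_nat n * w) = contour_integral ?A (\<lambda>z. 1 / (z - 0))"
    using winding_number_valid_path[OF valid_path_C1[OF Ad cA'] A0] velocity_winding_number by simp
  also have "\<dots> = (LINT s:{0..1}|lborel. ?A' s / ?A s)"
    unfolding contour_integral_C1[OF Ad cA' cinv] by simp
  finally have N: "(LINT s:{0..1}|lborel. ?A' s / ?A s) = 2 * pi * \<i> * (of_nat n * w)" ..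
  have c1: "continuous_on {0..1} (\<lambda>s. ?A' s / ?A s)"
    using \<alpha>'_ne_0 by (intro continuous_intros cA' cA) auto
  have cdh: "continuous_on {0..1} (\<lambda>s. dh (P s) * P' s)"
  proof -
    have "continuous_on {0..1} (\<lambda>s. of_nat n * (P s - p) ^ (n - 1) * dexcess \<mu> (\<alpha> (T * s)) / (2 * of_real ((norm (\<alpha>' (T * s)))\<^sup>2)))"
      unfolding dexcess_def
      by (intro continuous_intros cont_P continuous_on_compose2[OF cont_\<alpha>(1)] continuous_on_compose2[OF cont_\<alpha>(2)])
         (use \<alpha>_ne \<alpha>'_ne_0 in auto)
    then have "continuous_on {0..1} (\<lambda>s. dh (P s))"
      by (rule continuous_on_eq) (simp add: dh_def \<alpha>_P[symmetric] excess_\<alpha>)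
    then show ?thesis by (intro continuous_on_mult cont_P')
  qed
  have Iim: "(LINT s:{0..1}|lborel. Im (F s)) = Im (LINT s:{0..1}|lborel. F s)" if "continuous_on {0..1} F" for F :: "real \<Rightarrow> complex"
    using integral_Im[OF borel_integrable_atLeastAtMost'[OF that, unfolded set_integrable_def]]
    by (simp add: set_lebesgue_integral_def)
  \<comment> \<open>Total turning of the velocity over one period: once as a winding number, once as
    the integral of \<open>turning_rate\<close>.\<close>
  have "2 * pi * (n * w) = (LINT s:{0..1}|lborel. Im (?A' s / ?A s))"
    unfolding Iim[OF c1] N by simp
  also have "\<dots> = (LINT s:{0..1}|lborel. - 2 * Im (dh (P s) * P' s) - 2 * T)"
    by (rule set_lebesgue_integral_cong) (use turning_rate in auto)
  also have "\<dots> = (LINT s:{0..1}|lborel. - 2 * Im (dh (P s) * P' s)) - (LINT s:{0..1::real}|lborel. 2 * T)"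
  proof (rule set_integral_diff(2))
    show "set_integrable lborel {0..1} (\<lambda>s. - 2 * Im (dh (P s) * P' s))"
      by (intro borel_integrable_atLeastAtMost' continuous_intros cdh)
    show "set_integrable lborel {0..1::real} (\<lambda>s. 2 * T)"
      by (intro borel_integrable_atLeastAtMost' continuous_intros)
  qed
  also have "(LINT s:{0..1::real}|lborel. 2 * T) = 2 * T" by (simp add: set_lebesgue_integral_def)
  also have "(LINT s:{0..1}|lborel. - 2 * Im (dh (P s) * P' s)) = - 2 * Im (LINT s:{0..1}|lborel. dh (P s) * P' s)"
    unfolding Iim[OF cdh, symmetric] by (rule set_integral_mult_right)
  \<comment> \<open>With \<open>L\<close> for the Laplacian integral, which is four times the real
    part of the integral of \<open>b\<close>, the area term gives \<open>w * L / 2\<close> and the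
    pole gives \<open>- w * n * pi / 2\<close>.\<close>
  also have "Im (LINT s:{0..1}|lborel. dh (P s) * P' s) = w * (integral (\<Omega> - {p}) (laplacian (h_fun \<mu> C n)) / 2 - n * pi / 2)"
    unfolding b(3) L by (simp add: algebra_simps)
  finally show "2 * T = - w * (real n * pi + integral (\<Omega> - {p}) (laplacian (h_fun \<mu> C n)))"
    by (simp add: algebra_simps)
qed

end

theorem theorem3p3:
  fixes \<mu> C T :: real and n :: nat and \<alpha> \<beta> :: "real \<Rightarrow> complex" and \<Omega> :: "complex set"
  assumes mu: "0 < \<mu>" "\<mu> \<le> 1/2"
    and n: "n \<ge> 1"
    and T: "T > 0"
    and sol: "r3bp_solution \<mu> \<alpha>"
    and jacobi: "has_jacobi_integral \<mu> \<alpha> C"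
    and periodic: "\<And>t. \<alpha> (t + T) = \<alpha> t"
    and lift: "n_simple_with_lifting n (primary2 \<mu>) T \<alpha> \<beta>"
    and Omega: "\<Omega> = enclosed_region T \<beta>"
    and h_defined: "\<And>z. z \<in> \<Omega> - {primary2 \<mu>} \<Longrightarrow> f_tilde \<mu> C n z > 0"
  shows "(clockwise T \<beta> \<and> phi \<mu> n ` \<Omega> \<subseteq> U_region \<mu> C \<union> {primary2 \<mu>} \<longrightarrow>
            laplacian (h_fun \<mu> C n) absolutely_integrable_on (\<Omega> - {primary2 \<mu>}) \<and>
            2 * T = real n * pi + integral (\<Omega> - {primary2 \<mu>}) (laplacian (h_fun \<mu> C n)))
       \<and> (counterclockwise T \<beta> \<and> phi \<mu> n ` \<Omega> \<subseteq> U_region \<mu> C \<union> {primary2 \<mu>} \<longrightarrow>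
            laplacian (h_fun \<mu> C n) absolutely_integrable_on (\<Omega> - {primary2 \<mu>}) \<and>
            2 * T = - (real n * pi) - integral (\<Omega> - {primary2 \<mu>}) (laplacian (h_fun \<mu> C n)))"
proof (intro conjI impI; elim conjE)
  \<comment> \<open>The two claims are \<open>period_formula\<close> for the two values of the
    winding number.\<close>
  have orbit: "r3bp_orbit \<mu> C n T \<alpha> \<beta> \<Omega> w"
    if "\<And>z. z \<in> \<Omega> \<Longrightarrow> winding_number (unit_path T \<beta>) z = of_real w"
       "phi \<mu> n ` \<Omega> \<subseteq> U_region \<mu> C \<union> {primary2 \<mu>}" for w
    by unfold_locales (use assms that in auto)
  {
    assume "clockwise T \<beta>" and phi: "phi \<mu> n ` \<Omega> \<subseteq> U_region \<mu> C \<union> {primary2 \<mu>}"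
    then interpret r3bp_orbit \<mu> C n T \<alpha> \<beta> \<Omega> "-1"
      by (intro orbit) (auto simp: clockwise_def Omega)
    show "laplacian (h_fun \<mu> C n) absolutely_integrable_on (\<Omega> - {primary2 \<mu>})"
      "2 * T = real n * pi + integral (\<Omega> - {primary2 \<mu>}) (laplacian (h_fun \<mu> C n))"
      using period_formula by simp_all
  next
    assume "counterclockwise T \<beta>" and phi: "phi \<mu> n ` \<Omega> \<subseteq> U_region \<mu> C \<union> {primary2 \<mu>}"
    then interpret r3bp_orbit \<mu> C n T \<alpha> \<beta> \<Omega> 1
      by (intro orbit) (auto simp: counterclockwise_def Omega)
    show "laplacian (h_fun \<mu> C n) absolutely_integrable_on (\<Omega> - {primary2 \<mu>})"
      "2 * T = - (real n * pi) - integral (\<Omega> - {primary2 \<mu>}) (laplacian (h_fun \<mu> C n))"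
      using period_formula by simp_all
  }
qed

end
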